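(* Let $b\in C^1_\sharp(Y_2)^2$ and let $\mu,\nu$ be invariant probability measures for the flow of $b$. Then there exist functions $u^\sharp,v^\sharp\in BV_\sharp(Y_2)$, unique up to additive constants, such that $$b\,\mu=\mu(b)+R_\perp\nabla u^\sharp\quad\text{and}\quad b\,\nu=\nu(b)+R_\perp\nabla v^\sharp\quad\text{in }Y_2,$$ in the sense that for every $\Psi\in C^\infty_\sharp(Y_2)^2$, $\int_{Y_2}b\cdot\Psi\,d\mu=\int_{Y_2}\mu(b)\cdot\Psi\,dx+\int_{Y_2}\mathrm{div}(R_\perp\Psi)\,u^\sharp\,dx$, and similarly for $\nu,v^\sharp$. Moreover, for every $\rho\in C^2_\sharp(Y_2\times Y_2)$, $$\begin{aligned}\int_{Y_2}\!\int_{Y_2}\rho(x,y)\det(b(x),b(y))\,d\mu(x)\,d\nu(y)=\;&R_\perp\nu(b)\cdot\int_{Y_2}\Big(\int_{Y_2}\rho(x,y)\,dy\Big)b(x)\,d\mu(x)-R_\perp\mu(b)\cdot\int_{Y_2}\Big(\int_{Y_2}\rho(x,y)\,dx\Big)b(y)\,d\nu(y)\\&+\int_{Y_2}\!\int_{Y_2}\Big(\frac{\partial^2\rho}{\partial x_1\partial y_2}-\frac{\partial^2\rho}{\partial x_2\partial y_1}\Big)u^\sharp(x)\,v^\sharp(y)\,dx\,dy,\end{aligned}$$ and equivalently, for all $(j,k)\in(\mathbb{Z}^2\setminus\{0\})^2\cup\{(0,0)\}$, $$\det\big(\widehat{\mu b}(j),\widehat{\nu b}(k)\big)=-4\pi^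2\det(j,k)\,\widehat{u^\sharp}(j)\,\widehat{v^\sharp}(k).$$
   Context: $Y_2=\mathbb{R}^2/\mathbb{Z}^2$; $C^k_\sharp$ denotes $\mathbb{Z}^2$-periodic $C^k$ functions (for $Y_2\times Y_2$, periodic in each variable). $BV_\sharp(Y_2)$ is the space of $\mathbb{Z}^2$-periodic functions in $L^2_{\rm loc}(\mathbb{R}^2)$ whose distributional gradient is a locally finite (periodic) Radon measure. The flow $X$ of $b$: $\partial_tX=b(X)$, $X(0,x)=x$; a Borel probability measure $\mu$ on $Y_2$ is invariant if $\int\psi(X(t,y))\,d\mu(y)=\int\psi\,d\mu$ for all $t$ and continuous periodic $\psi$; $\mu(b)=\int_{Y_2}b\,d\mu$. $R_\perp=\begin{pmatrix}0&1\\-1&0\end{pmatrix}$. Fourier coefficients of a (vector) measure $\lambda$ on $Y_2$: $\widehat{\lambda}(k)=\int_{Y_2}e^{-2i\pi k\cdot x}\,d\lambda(x)$, $k\in\mathbb{Z}^2$; $\widehat{\mu b}$ is that of the vector measure $b\,\mu$, and $\widehat{u^\sharp}(k)=\int_{Y_2}e^{-2i\pi k\cdot x}u^\sharp(x)\,dx$. *)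

theory Defs
  imports "HOL-Analysis.Analysis"
begin

section \<open>Points of R^2 are modelled as real \<times> real; Y_2 via the fundamental cell\<close>

definition unit_sq :: "(real \<times> real) set" where
  "unit_sq = {0..<1::real} \<times> {0..<1::real}"

definition periodic :: "(real \<times> real \<Rightarrow> 'b) \<Rightarrow> bool" where
  "periodic f \<longleftrightarrow> (\<forall>x. f (x + (1,0)) = f x \<and> f (x + (0,1)) = f x)"

definition periodic2 :: "(real \<times> real \<Rightarrow> real \<times> real \<Rightarrow> 'b) \<Rightarrow> bool" where
  "periodic2 \<rho> \<longleftrightarrow> (\<forall>y. periodic (\<lambda>x. \<rho> x y)) \<and> (\<forall>x. periodic (\<rho> x))"

definition partial :: "'a::euclidean_space \<Rightarrow> ('a \<Rightarrow> 'b::real_normed_vector) \<Rightarrow> 'a \<Rightarrow> 'b" where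
  "partial i f x = vector_derivative (\<lambda>t. f (x + t *\<^sub>R i)) (at 0)"

fun Ck :: "nat \<Rightarrow> ('a::euclidean_space \<Rightarrow> 'b::real_normed_vector) \<Rightarrow> bool" where
  "Ck 0 f = continuous_on UNIV f"
| "Ck (Suc k) f = (continuous_on UNIV f \<and>
      (\<forall>i\<in>Basis. (\<forall>x. (\<lambda>t. f (x + t *\<^sub>R i)) differentiable (at 0)) \<and> Ck k (partial i f)))"

definition smooth :: "('a::euclidean_space \<Rightarrow> 'b::real_normed_vector) \<Rightarrow> bool" where
  "smooth f \<longleftrightarrow> (\<forall>k. Ck k f)"

definition test_fun :: "(real \<times> real \<Rightarrow> real) \<Rightarrow> bool" where
  "test_fun \<phi> \<longleftrightarrow> smooth \<phi> \<and> compact (closure {x. \<phi> x \<noteq> 0})"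

text \<open>BV_sharp(Y_2): periodic, L^2_loc, distributional gradient a locally finite (signed)
  Radon measure, written componentwise as a difference of two locally finite Borel measures.\<close>
definition BV_per :: "(real \<times> real \<Rightarrow> real) \<Rightarrow> bool" where
  "BV_per u \<longleftrightarrow> periodic u \<and> u \<in> borel_measurable lborel \<and>
     set_integrable lborel unit_sq (\<lambda>x. (u x)\<^sup>2) \<and>
     (\<exists>Mp Mn :: real \<times> real \<Rightarrow> (real \<times> real) measure. \<forall>i\<in>(Basis :: (real \<times> real) set).
        sets (Mp i) = sets borel \<and> sets (Mn i) = sets borel \<and>
        (\<forall>K. compact K \<longrightarrow> emeasure (Mp i) K < \<infinity> \<and> emeasure (Mn i) K < \<infinity>) \<and>
        (\<forall>\<phi>. test_fun \<phi> \<longrightarrow>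
           (\<integral>x. u x * partial i \<phi> x \<partial>lborel) = - ((\<integral>x. \<phi> x \<partial>Mp i) - (\<integral>x. \<phi> x \<partial>Mn i))))"

text \<open>Borel probability measures on Y_2, represented as Borel probability measures on R^2
  carried by the fundamental cell.\<close>
definition torus_prob :: "(real \<times> real) measure \<Rightarrow> bool" where
  "torus_prob \<mu> \<longleftrightarrow> sets \<mu> = sets borel \<and> emeasure \<mu> (space \<mu>) = 1 \<and> emeasure \<mu> unit_sq = 1"

definition is_flow :: "(real \<times> real \<Rightarrow> real \<times> real) \<Rightarrow> (real \<Rightarrow> real \<times> real \<Rightarrow> real \<times> real) \<Rightarrow> bool" where
  "is_flow b X \<longleftrightarrow> (\<forall>x. X 0 x = x \<and> (\<forall>t. ((\<lambda>s. X s x) has_vector_derivative b (X t x)) (at t)))"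

definition invariant_measure :: "(real \<Rightarrow> real \<times> real \<Rightarrow> real \<times> real) \<Rightarrow> (real \<times> real) measure \<Rightarrow> bool" where
  "invariant_measure X \<mu> \<longleftrightarrow> (\<forall>t \<psi>::real \<times> real \<Rightarrow> real. continuous_on UNIV \<psi> \<and> periodic \<psi> \<longrightarrow>
      (\<integral>y. \<psi> (X t y) \<partial>\<mu>) = (\<integral>y. \<psi> y \<partial>\<mu>))"

definition mean :: "(real \<times> real) measure \<Rightarrow> (real \<times> real \<Rightarrow> real \<times> real) \<Rightarrow> real \<times> real" where
  "mean \<mu> b = (\<integral>x. b x \<partial>\<mu>)"

definition Rperp :: "real \<times> real \<Rightarrow> real \<times> real" where
  "Rperp a = (snd a, - fst a)"

definition det2 :: "'a::comm_ring \<times> 'a \<Rightarrow> 'a \<times> 'a \<Rightarrow> 'a" where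
  "det2 a c = fst a * snd c - snd a * fst c"

definition divg :: "(real \<times> real \<Rightarrow> real \<times> real) \<Rightarrow> real \<times> real \<Rightarrow> real" where
  "divg F x = fst (partial (1,0) F x) + snd (partial (0,1) F x)"

text \<open>b mu = mu(b) + R_perp grad u in the weak sense against C^\<infinity>_sharp test fields.\<close>
definition weak_repr :: "(real \<times> real \<Rightarrow> real \<times> real) \<Rightarrow> (real \<times> real) measure \<Rightarrow> (real \<times> real \<Rightarrow> real) \<Rightarrow> bool" where
  "weak_repr b \<mu> u \<longleftrightarrow> (\<forall>\<Psi>::real \<times> real \<Rightarrow> real \<times> real. smooth \<Psi> \<and> periodic \<Psi> \<longrightarrow>
     (\<integral>x. b x \<bullet> \<Psi> x \<partial>\<mu>) =
       (LINT x:unit_sq|lborel. mean \<mu> b \<bullet> \<Psi> x) +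
       (LINT x:unit_sq|lborel. divg (\<lambda>y. Rperp (\<Psi> y)) x * u x))"

definition ekx :: "int \<times> int \<Rightarrow> real \<times> real \<Rightarrow> complex" where
  "ekx k x = cis (- 2 * pi * (of_int (fst k) * fst x + of_int (snd k) * snd x))"

definition fourier_meas :: "(real \<times> real) measure \<Rightarrow> (real \<times> real \<Rightarrow> real \<times> real) \<Rightarrow> int \<times> int \<Rightarrow> complex \<times> complex" where
  "fourier_meas \<mu> b k = ((\<integral>x. ekx k x * complex_of_real (fst (b x)) \<partial>\<mu>),
                          (\<integral>x. ekx k x * complex_of_real (snd (b x)) \<partial>\<mu>))"

definition fourier_fun :: "(real \<times> real \<Rightarrow> real) \<Rightarrow> int \<times> int \<Rightarrow> complex" where
  "fourier_fun u k = (LINT x:unit_sq|lborel. ekx k x * complex_of_real (u x))"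

end

theory Submission
  imports Defs "HOL-Probability.Probability_Measure"
begin

text \<open>Write \<open>m = \<mu>(b)\<close>. Invariance says that the vector measure \<open>b \<mu>\<close> is divergence free, so its stream function
  exists as a functional \<open>A\<close> on continuous periodic functions, given by convolution with sawtooth kernels, and
  satisfies \<open>A(\<partial>\<^sub>1 \<psi>) = \<integral> \<psi> b\<^sub>2 d\<mu> - m\<^sub>2 \<integral> \<psi>\<close> and \<open>A(\<partial>\<^sub>2 \<psi>) = m\<^sub>1 \<integral> \<psi> - \<integral> \<psi> b\<^sub>1 d\<mu>\<close>. The functional can be
  written with the singular kernel in either coordinate; on the cells of a partition of unity it is therefore
  bounded by a function of the column and by a function of the row, whence \<open>\<bar>A \<phi>\<bar> \<le> M \<parallel>\<phi>\<parallel>\<close> in \<open>L\<^sup>2\<close>, and Riesz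
  representation yields \<open>u\<close>. Uniqueness holds because the weak equation determines all Fourier coefficients of
  \<open>u\<close> of nonzero frequency.

  The bilinear formula follows by applying the weak equation first in \<open>y\<close> and then in \<open>x\<close>, up to the term
  \<open>det(\<mu>(b), \<nu>(b)) \<integral>\<integral> \<rho>\<close>. That this determinant vanishes is the theorem of Franks and Misiurewicz: otherwise the
  rotation set would have two linearly independent exposed points, and orbits drifting in these two directions
  would cross modulo integer translations, hence coincide, although their drifts differ.\<close>

section \<open>Periodic functions and the unit cell\<close>

text \<open>The obstacle is that \<open>b \<mu>\<close> is only a measure: convolving it with the
  gradient of the Green function places \<open>u\<close> in weak \<open>L\<^sup>2\<close> only.
  Duality avoids this: the functional is estimated on test functions, and \<open>u\<close> appears
  only at the end. Sawtooth kernels are bounded, so on a product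
  \<open>f(x\<^sub>1) g(x\<^sub>2)\<close> each form of the functional sees one factor only through
  its integral and the other only through a marginal of \<open>\<mu>\<close>. On a grid the product
  of the two bounds factorises into a column sum times a row sum, both controlled by total masses.
  That both forms agree is exactly divergence freeness.

  For the determinant, ergodic measures and convexity of the rotation set are avoided. A point of
  the rotation set farthest from some centre is exposed by a circle, and strict convexity of the
  disc forces the averages of one well chosen orbit to stay near that point from some time on. Such
  an orbit follows a ray with an error small relative to time, which is all that the crossing
  argument needs.\<close>

declare split_paired_All [simp del] split_paired_Ex [simp del]

lemma periodic_int:
  assumes "periodic f"
  shows "f (x + (of_int m, of_int n)) = f x"
proof -
  have 1: "f (x + (1,0)) = f x" "f (x + (0,1)) = f x" for x
    using assms unfolding periodic_def by blast+
  have 2: "f (x + (of_int m, 0)) = f x" for x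
  proof (induction m rule: int_induct[where k=0])
    case base then show ?case by (simp flip: zero_prod_def)
  next
    case (step1 i)
    have "x + (of_int (i+1), 0) = (x + (of_int i, 0)) + (1,0)" by (cases x) simp
    then show ?case using 1(1) step1 by metis
  next
    case (step2 i)
    have "(x + (of_int (i-1), 0)) + (1,0) = x + (of_int i, 0)" by (cases x) simp
    then show ?case using 1(1)[of "x + (of_int (i-1), 0)"] step2 by metis
  qed
  have 3: "f (x + (0, of_int n)) = f x" for x
  proof (induction n rule: int_induct[where k=0])
    case base then show ?case by (simp flip: zero_prod_def)
  next
    case (step1 i)
    have "x + (0, of_int (i+1)) = (x + (0, of_int i)) + (0,1)" by (cases x) simp
    then show ?case using 1(2) step1 by metis
  next
    case (step2 i)
    have "(x + (0, of_int (i-1))) + (0,1) = x + (0, of_int i)" by (cases x) simp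
    then show ?case using 1(2)[of "x + (0, of_int (i-1))"] step2 by metis
  qed
  have "x + (of_int m, of_int n) = (x + (of_int m, 0)) + (0, of_int n)" by (cases x) simp
  then show ?thesis using 2 3 by metis
qed

definition fract :: "real \<times> real \<Rightarrow> real \<times> real" where
  "fract x = (frac (fst x), frac (snd x))"

lemma fract_in: "fract x \<in> unit_sq"
  by (simp add: fract_def unit_sq_def frac_lt_1)

lemma fract_id: "x \<in> unit_sq \<Longrightarrow> fract x = x"
  by (cases x) (auto simp: fract_def unit_sq_def frac_eq)

lemma fract_eq: "x = fract x + (of_int \<lfloor>fst x\<rfloor>, of_int \<lfloor>snd x\<rfloor>)"
  by (cases x) (simp add: fract_def frac_def)

lemma periodic_fract: "periodic f \<Longrightarrow> f (fract x) = f x"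
  using periodic_int[of f "fract x"] fract_eq[of x] by metis

lemma periodic_comp_fract: "periodic (\<lambda>x. f (fract x))"
  by (auto simp: periodic_def fract_def frac_1_eq)

lemma fract_measurable [measurable]: "fract \<in> borel_measurable borel"
proof -
  have 1: "(\<lambda>x. frac (fst x)) \<in> borel_measurable (borel :: (real\<times>real) measure)"
    unfolding frac_def by (intro borel_measurable_diff borel_measurable_real_floor[THEN measurable_compose[rotated]]
      borel_measurable_continuous_onI continuous_intros)
  have 2: "(\<lambda>x. frac (snd x)) \<in> borel_measurable (borel :: (real\<times>real) measure)"
    unfolding frac_def by (intro borel_measurable_diff borel_measurable_real_floor[THEN measurable_compose[rotated]]
      borel_measurable_continuous_onI continuous_intros)
  show ?thesis unfolding fract_def using borel_measurable_Pair[OF 1 2] .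
qed

lemma unit_sq_subset: "unit_sq \<subseteq> cbox (0,0) (1,1)"
  by (auto simp: unit_sq_def cbox_Pair_eq)

lemma unit_sq_borel [measurable]: "unit_sq \<in> sets borel"
proof -
  have "unit_sq = fst -` {0..<1} \<inter> snd -` {0..<1}" by (auto simp: unit_sq_def)
  moreover have "fst -` {0..<1::real} \<in> sets (borel :: (real\<times>real) measure)"
    using measurable_sets[OF borel_measurable_continuous_onI[OF continuous_on_fst[OF continuous_on_id]], of "{0..<1::real}"] by simp
  moreover have "snd -` {0..<1::real} \<in> sets (borel :: (real\<times>real) measure)"
    using measurable_sets[OF borel_measurable_continuous_onI[OF continuous_on_snd[OF continuous_on_id]], of "{0..<1::real}"] by simp
  ultimately show ?thesis by (metis sets.Int)
qed

lemma periodic_bounded: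
  fixes f :: "real \<times> real \<Rightarrow> 'b::real_normed_vector"
  assumes "periodic f" "continuous_on UNIV f"
  obtains C where "C > 0" "\<And>x. norm (f x) \<le> C"
proof -
  have "bounded (f ` cbox (0,0) (1,1))"
    by (intro compact_imp_bounded compact_continuous_image compact_cbox continuous_on_subset[OF assms(2)]) auto
  then obtain C where C: "C > 0" "\<And>x. x \<in> cbox (0,0) (1,1) \<Longrightarrow> norm (f x) \<le> C"
    by (force simp: bounded_pos)
  have "norm (f x) \<le> C" for x
    using C(2)[of "fract x"] fract_in[of x] unit_sq_subset periodic_fract[OF assms(1), of x] by auto
  with C(1) that show ?thesis by blast
qed

lemma periodic2_bounded:
  fixes f :: "real \<times> real \<Rightarrow> real \<times> real \<Rightarrow> 'b::real_normed_vector"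
  assumes "periodic2 f" "continuous_on UNIV (case_prod f)"
  obtains C where "C > 0" "\<And>x y. norm (f x y) \<le> C"
proof -
  let ?K = "cbox (0,0) (1,1) :: (real\<times>real) set"
  have "bounded (case_prod f ` (?K \<times> ?K))"
    by (intro compact_imp_bounded compact_continuous_image compact_Times compact_cbox continuous_on_subset[OF assms(2)]) auto
  then obtain C where C: "C > 0" "\<And>x. x \<in> ?K \<times> ?K \<Longrightarrow> norm (case_prod f x) \<le> C"
    by (force simp: bounded_pos)
  have "norm (f x y) \<le> C" for x y
  proof -
    have p: "periodic (\<lambda>x. f x y)" "periodic (f (fract x))" using assms(1) unfolding periodic2_def by blast+
    have "f x y = f (fract x) y" using periodic_fract[OF p(1)] by simp
    also have "\<dots> = f (fract x) (fract y)" using periodic_fract[OF p(2)] by simp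
    finally show ?thesis using C(2)[of "(fract x, fract y)"] fract_in[of x] fract_in[of y] unit_sq_subset by auto
  qed
  with C(1) that show ?thesis by blast
qed

lemma periodic_uniformly_continuous:
  fixes f :: "real \<times> real \<Rightarrow> 'b::real_normed_vector"
  assumes "periodic f" "continuous_on UNIV f"
  shows "uniformly_continuous_on UNIV f"
  unfolding uniformly_continuous_on_def
proof (intro allI impI)
  fix e :: real assume "e > 0"
  \<comment> \<open>The cell with a margin: once \<open>x\<close> is translated into the cell, every
    point at distance below 1 from it still lies in this box. This is why \<open>min d 1\<close> is
    used below.\<close>
  let ?K = "cbox (-2,-2) (2,2) :: (real\<times>real) set"
  have "uniformly_continuous_on ?K f"
    by (intro compact_uniformly_continuous compact_cbox continuous_on_subset[OF assms(2)]) auto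
  then obtain d where d: "d > 0" "\<And>x y. x \<in> ?K \<Longrightarrow> y \<in> ?K \<Longrightarrow> dist y x < d \<Longrightarrow> dist (f y) (f x) < e"
    using \<open>e > 0\<close> unfolding uniformly_continuous_on_def by metis
  show "\<exists>d>0. \<forall>x\<in>UNIV. \<forall>x'\<in>UNIV. dist x' x < d \<longrightarrow> dist (f x') (f x) < e"
  proof (intro exI[of _ "min d 1"] conjI ballI impI)
    show "min d 1 > 0" using d by simp
    fix x y :: "real \<times> real" assume dxy: "dist y x < min d 1"
    define k :: "real\<times>real" where "k = (of_int \<lfloor>fst x\<rfloor>, of_int \<lfloor>snd x\<rfloor>)"
    have x: "x = fract x + k" unfolding k_def by (rule fract_eq)
    let ?y = "y - k"
    have dd: "dist ?y (fract x) = dist y x" by (subst (2) x) (simp add: dist_norm algebra_simps)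
    have "\<bar>fst ?y - fst (fract x)\<bar> \<le> dist ?y (fract x)" "\<bar>snd ?y - snd (fract x)\<bar> \<le> dist ?y (fract x)"
      using dist_fst_le[of ?y "fract x"] dist_snd_le[of ?y "fract x"] by (auto simp: dist_real_def)
    moreover have fx: "0 \<le> fst (fract x)" "fst (fract x) < 1" "0 \<le> snd (fract x)" "snd (fract x) < 1"
      using fract_in[of x] by (auto simp: unit_sq_def)
    ultimately have "\<bar>fst ?y\<bar> \<le> 2" "\<bar>snd ?y\<bar> \<le> 2" using dxy dd by auto
    then have yK: "?y \<in> ?K" by (cases ?y) (auto simp: cbox_Pair_eq)
    have xK: "fract x \<in> ?K" using fx by (cases "fract x") (auto simp: cbox_Pair_eq)
    have "dist (f ?y) (f (fract x)) < e" using d(2)[OF xK yK] dd dxy by simp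
    moreover have "f ?y = f y"
      using periodic_int[OF assms(1), of ?y "\<lfloor>fst x\<rfloor>" "\<lfloor>snd x\<rfloor>"] by (simp add: k_def)
    ultimately show "dist (f y) (f x) < e" using periodic_fract[OF assms(1)] by simp
  qed
qed

text \<open>Lebesgue measure of the torus in the same format as \<open>\<mu>\<close> and
  \<open>\<nu>\<close>: a Borel probability measure on the plane carried by the cell. Facts about
  \<open>torus_prob\<close> then apply to \<open>dx\<close> too.\<close>

definition unif_sq :: "(real \<times> real) measure" where
  "unif_sq = density lborel (indicator unit_sq)"

lemma sets_unif_sq [simp, measurable_cong]: "sets unif_sq = sets borel"
  by (simp add: unif_sq_def)

lemma space_unif_sq [simp]: "space unif_sq = UNIV"
  by (simp add: unif_sq_def)

text \<open>The half-open cell is squeezed between the open and the closed box, which have the same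
  volume.\<close>

lemma emeasure_unit_sq: "emeasure lborel unit_sq = 1"
proof -
  have "emeasure lborel unit_sq = emeasure (lborel :: (real\<times>real) measure) (cbox (0,0) (1,1))"
  proof (rule antisym)
    show "emeasure lborel unit_sq \<le> emeasure lborel (cbox (0::real,0::real) (1,1))"
      by (intro emeasure_mono unit_sq_subset) auto
    have "emeasure (lborel :: (real\<times>real) measure) (cbox (0,0) (1,1)) = emeasure lborel (box (0::real,0::real) (1,1))"
      by (simp add: emeasure_lborel_box_eq emeasure_lborel_cbox_eq)
    also have "\<dots> \<le> emeasure lborel unit_sq"
      by (intro emeasure_mono) (auto simp: unit_sq_def box_def Basis_prod_def intro: unit_sq_borel[unfolded unit_sq_def])
    finally show "emeasure lborel (cbox (0::real,0::real) (1,1)) \<le> emeasure lborel unit_sq" .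
  qed
  also have "\<dots> = 1" by (simp add: emeasure_lborel_cbox_eq Basis_prod_def)
  finally show ?thesis .
qed

lemma prob_space_unif_sq: "prob_space unif_sq"
  by (rule prob_spaceI) (simp add: unif_sq_def emeasure_density emeasure_unit_sq)

lemma integral_unif_sq:
  fixes f :: "real \<times> real \<Rightarrow> 'b::{banach, second_countable_topology}"
  assumes "f \<in> borel_measurable borel"
  shows "(LINT x:unit_sq|lborel. f x) = (\<integral>x. f x \<partial>unif_sq)"
  using integral_density[of f lborel "indicator unit_sq"] assms
  by (simp add: unif_sq_def set_lebesgue_integral_def ennreal_indicator)

lemma integrable_unif_sq:
  fixes f :: "real \<times> real \<Rightarrow> 'b::{banach, second_countable_topology}"
  assumes "f \<in> borel_measurable borel"
  shows "set_integrable lborel unit_sq f \<longleftrightarrow> integrable unif_sq f"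
  using integrable_density[of f lborel "indicator unit_sq"] assms
  by (simp add: unif_sq_def set_integrable_def ennreal_indicator)

lemma torus_prob_unif_sq: "torus_prob unif_sq"
proof -
  have "(\<integral>\<^sup>+ x. indicator unit_sq x * indicator unit_sq x \<partial>lborel) = emeasure lborel unit_sq"
    by (subst indicator_inter_arith[symmetric]) simp
  then show ?thesis
    by (simp add: torus_prob_def emeasure_unit_sq unif_sq_def emeasure_density)
qed

lemma torus_probD:
  assumes "torus_prob \<mu>"
  shows "sets \<mu> = sets borel" "space \<mu> = UNIV" "prob_space \<mu>"
  using assms sets_eq_imp_space_eq[of \<mu> borel] by (auto simp: torus_prob_def intro!: prob_spaceI)

lemma integrable_cont_periodic:
  fixes f :: "real \<times> real \<Rightarrow> 'b::{banach, second_countable_topology}"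
  assumes "torus_prob \<mu>" "continuous_on UNIV f" "periodic f"
  shows "integrable \<mu> f"
proof -
  interpret prob_space \<mu> using torus_probD[OF assms(1)] by simp
  obtain C where "\<And>x. norm (f x) \<le> C" using periodic_bounded[OF assms(3,2)] by blast
  moreover have "f \<in> borel_measurable \<mu>"
    using borel_measurable_continuous_onI[OF assms(2)] torus_probD(1)[OF assms(1)] by (simp cong: measurable_cong_sets)
  ultimately show ?thesis by (intro integrable_const_bound[of _ C]) auto
qed

section \<open>Periodic functions with continuous gradient\<close>

text \<open>The gradient is named explicitly instead of being taken from \<open>partial\<close>,
  because the main examples (sawtooth convolutions, periodizations, waves) come with closed formulas
  for it. Periodicity of \<open>f1\<close> and \<open>f2\<close> follows, see
  \<open>C1grad_periodic\<close>.\<close>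

definition C1grad :: "(real \<times> real \<Rightarrow> real) \<Rightarrow> (real \<times> real \<Rightarrow> real) \<Rightarrow> (real \<times> real \<Rightarrow> real) \<Rightarrow> bool" where
  "C1grad f f1 f2 \<longleftrightarrow> periodic f \<and> continuous_on UNIV f1 \<and> continuous_on UNIV f2 \<and>
     (\<forall>x. (f has_derivative (\<lambda>h. f1 x * fst h + f2 x * snd h)) (at x))"

lemma C1grad_cont: "C1grad f f1 f2 \<Longrightarrow> continuous_on UNIV f"
  by (intro continuous_at_imp_continuous_on ballI) (auto simp: C1grad_def intro: has_derivative_continuous)

text \<open>Total differentiability is what the chain rule along orbits in
  \<open>divergence_free\<close> requires; continuous partial derivatives provide it.\<close>

lemma has_gradientI:
  fixes f :: "real \<times> real \<Rightarrow> real"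
  assumes c: "continuous_on UNIV f1" "continuous_on UNIV f2"
    and d1: "\<And>a c. ((\<lambda>t. f (t, c)) has_real_derivative f1 (a, c)) (at a)"
    and d2: "\<And>a c. ((\<lambda>t. f (a, t)) has_real_derivative f2 (a, c)) (at c)"
  shows "(f has_derivative (\<lambda>h. f1 x * fst h + f2 x * snd h)) (at x)"
proof (cases x)
  case (Pair a c)
  have "((\<lambda>(x, y). f (x, y)) has_derivative (\<lambda>(tx, ty). f1 (a,c) * tx + blinfun_apply (blinfun_mult_right (f2 (a,c))) ty)) (at (a, c) within UNIV \<times> UNIV)"
  proof (rule has_derivative_partialsI[where f = "\<lambda>x y. f (x,y)" and fy = "\<lambda>x y. blinfun_mult_right (f2 (x,y))"])
    show "((\<lambda>x. f (x, c)) has_derivative (*) (f1 (a, c))) (at a within UNIV)"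
      using d1[of c a] by (simp add: has_field_derivative_def)
    show "((\<lambda>y. f (x, y)) has_derivative blinfun_apply (blinfun_mult_right (f2 (x, y)))) (at y within UNIV)" for x y
      using d2[of x y] by (simp add: has_field_derivative_def)
    have "continuous_on UNIV (\<lambda>z. blinfun_mult_right (f2 z))"
      by (intro continuous_intros c)
    then show "continuous (at (a, c) within UNIV \<times> UNIV) (\<lambda>(x, y). blinfun_mult_right (f2 (x, y)))"
      by (simp add: continuous_on_eq_continuous_within case_prod_unfold)
  qed auto
  then show ?thesis by (simp add: Pair case_prod_unfold)
qed

lemma C1gradI:
  assumes "periodic f" "continuous_on UNIV f1" "continuous_on UNIV f2"
    and "\<And>a c. ((\<lambda>t. f (t, c)) has_real_derivative f1 (a, c)) (at a)"
    and "\<And>a c. ((\<lambda>t. f (a, t)) has_real_derivative f2 (a, c)) (at c)"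
  shows "C1grad f f1 f2"
  unfolding C1grad_def using assms has_gradientI[OF assms(2-5)] by blast

lemma C1grad_partial:
  assumes "C1grad f f1 f2"
  shows "((\<lambda>t. f (t, c)) has_real_derivative f1 (a, c)) (at a)"
    and "((\<lambda>t. f (a, t)) has_real_derivative f2 (a, c)) (at c)"
proof -
  have D: "(f has_derivative (\<lambda>h. f1 (a,c) * fst h + f2 (a,c) * snd h)) (at (a,c))"
    using assms by (simp add: C1grad_def)
  have p1: "((\<lambda>t. (t, c)) has_derivative (\<lambda>h. (h, 0))) (at a)"
    by (auto intro!: derivative_eq_intros)
  have p2: "((\<lambda>t. (a, t)) has_derivative (\<lambda>h. (0, h))) (at c)"
    by (auto intro!: derivative_eq_intros)
  show "((\<lambda>t. f (t, c)) has_real_derivative f1 (a, c)) (at a)"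
    using has_derivative_compose[OF p1, of f "\<lambda>h. f1 (a,c) * fst h + f2 (a,c) * snd h"] D by (simp add: has_field_derivative_def)
  show "((\<lambda>t. f (a, t)) has_real_derivative f2 (a, c)) (at c)"
    using has_derivative_compose[OF p2, of f "\<lambda>h. f1 (a,c) * fst h + f2 (a,c) * snd h"] D by (simp add: has_field_derivative_def)
qed

text \<open>A translate of \<open>f\<close> by a period is \<open>f\<close> itself, so uniqueness of
  the derivative identifies the two gradients.\<close>

lemma C1grad_periodic:
  assumes "C1grad f f1 f2"
  shows "periodic f1" "periodic f2"
proof -
  have p: "f (x + (1,0)) = f x" "f (x + (0,1)) = f x" for x using assms by (auto simp: C1grad_def periodic_def)
  have a: "(\<lambda>h. f1 (x+k) * fst h + f2 (x+k) * snd h) = (\<lambda>h. f1 x * fst h + f2 x * snd h)"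
    if k: "\<And>x. f (x + k) = f x" for x k
  proof -
    have D: "(f has_derivative (\<lambda>h. f1 x * fst h + f2 x * snd h)) (at x)" for x
      using assms by (simp add: C1grad_def)
    have s: "((\<lambda>x. x + k) has_derivative (\<lambda>h. h)) (at x)" by (auto intro!: derivative_eq_intros)
    have "((\<lambda>x. f (x + k)) has_derivative (\<lambda>h. f1 (x+k) * fst h + f2 (x+k) * snd h)) (at x)"
      using has_derivative_compose[OF s, of f "\<lambda>h. f1 (x+k) * fst h + f2 (x+k) * snd h"] D by simp
    then show ?thesis using has_derivative_unique[OF _ D] k by simp
  qed
  have "f1 (x+k) = f1 x \<and> f2 (x+k) = f2 x" if k: "\<And>x. f (x + k) = f x" for x k
    using fun_cong[OF a[OF k], of x "(1,0)"] fun_cong[OF a[OF k], of x "(0,1)"] by simp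
  then show "periodic f1" "periodic f2" using p by (auto simp: periodic_def)
qed

lemma dir_deriv_shift:
  fixes f :: "real \<times> real \<Rightarrow> real"
  assumes "\<And>x. ((\<lambda>t. f (x + t *\<^sub>R (1,0))) has_vector_derivative f1 x) (at 0)"
    and "\<And>x. ((\<lambda>t. f (x + t *\<^sub>R (0,1))) has_vector_derivative f2 x) (at 0)"
  shows "((\<lambda>t. f (t, c)) has_real_derivative f1 (a, c)) (at a)"
    and "((\<lambda>t. f (a, t)) has_real_derivative f2 (a, c)) (at c)"
  using assms(1)[of "(a,c)"] assms(2)[of "(a,c)"]
    DERIV_at_within_shift[of "\<lambda>t. f (t, c)" "f1 (a,c)" a 0 UNIV] DERIV_at_within_shift[of "\<lambda>t. f (a, t)" "f2 (a,c)" c 0 UNIV]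
  by (simp_all add: has_real_derivative_iff_has_vector_derivative)

lemma C1grad_dirI:
  assumes "periodic f" "continuous_on UNIV f1" "continuous_on UNIV f2"
    and "\<And>x. ((\<lambda>t. f (x + t *\<^sub>R (1,0))) has_vector_derivative f1 x) (at 0)"
    and "\<And>x. ((\<lambda>t. f (x + t *\<^sub>R (0,1))) has_vector_derivative f2 x) (at 0)"
  shows "C1grad f f1 f2"
  using dir_deriv_shift[OF assms(4,5)] by (intro C1gradI assms) auto

lemma partial_has_vector_derivative:
  assumes "Ck (Suc k) f" "i \<in> Basis"
  shows "((\<lambda>t. f (x + t *\<^sub>R i)) has_vector_derivative partial i f x) (at 0)"
  using assms by (auto simp: partial_def vector_derivative_works)

lemma Ck_cont: "Ck k f \<Longrightarrow> continuous_on UNIV f"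
  by (cases k) auto

lemma Ck_partial: "Ck (Suc k) f \<Longrightarrow> i \<in> Basis \<Longrightarrow> Ck k (partial i f)"
  by simp

lemma Ck_C1grad:
  assumes "Ck (Suc k) f" "periodic f"
  shows "C1grad f (partial (1,0) f) (partial (0,1) f)"
proof -
  have B: "(1,0) \<in> (Basis :: (real\<times>real) set)" "(0,1) \<in> (Basis :: (real\<times>real) set)" by (auto simp: Basis_prod_def)
  show ?thesis
    using Ck_cont[OF Ck_partial[OF assms(1) B(1)]] Ck_cont[OF Ck_partial[OF assms(1) B(2)]]
      partial_has_vector_derivative[OF assms(1) B(1)] partial_has_vector_derivative[OF assms(1) B(2)] assms(2)
    by (intro C1grad_dirI) 
qed

lemma Ck_C1grad_pair:
  fixes f :: "real \<times> real \<Rightarrow> real \<times> real"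
  assumes "Ck (Suc k) f" "periodic f"
  shows "C1grad (\<lambda>x. fst (f x)) (\<lambda>x. fst (partial (1,0) f x)) (\<lambda>x. fst (partial (0,1) f x))"
    and "C1grad (\<lambda>x. snd (f x)) (\<lambda>x. snd (partial (1,0) f x)) (\<lambda>x. snd (partial (0,1) f x))"
proof -
  have B: "(1,0) \<in> (Basis :: (real\<times>real) set)" "(0,1) \<in> (Basis :: (real\<times>real) set)" by (auto simp: Basis_prod_def)
  note c = Ck_cont[OF Ck_partial[OF assms(1) B(1)]] Ck_cont[OF Ck_partial[OF assms(1) B(2)]]
  note d = partial_has_vector_derivative[OF assms(1) B(1)] partial_has_vector_derivative[OF assms(1) B(2)]
  show "C1grad (\<lambda>x. fst (f x)) (\<lambda>x. fst (partial (1,0) f x)) (\<lambda>x. fst (partial (0,1) f x))"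
    using c d assms(2) by (intro C1grad_dirI bounded_linear.has_vector_derivative[OF bounded_linear_fst] continuous_on_fst) (auto simp: periodic_def)
  show "C1grad (\<lambda>x. snd (f x)) (\<lambda>x. snd (partial (1,0) f x)) (\<lambda>x. snd (partial (0,1) f x))"
    using c d assms(2) by (intro C1grad_dirI bounded_linear.has_vector_derivative[OF bounded_linear_snd] continuous_on_snd) (auto simp: periodic_def)
qed

lemma Ck_C1grad_section:
  fixes g :: "(real \<times> real) \<times> (real \<times> real) \<Rightarrow> real"
  assumes "Ck (Suc k) g" "periodic2 (\<lambda>x y. g (x, y))"
  shows "C1grad (\<lambda>x. g (x, y)) (\<lambda>x. partial ((1,0),(0,0)) g (x, y)) (\<lambda>x. partial ((0,1),(0,0)) g (x, y))"
    and "C1grad (\<lambda>y. g (x, y)) (\<lambda>y. partial ((0,0),(1,0)) g (x, y)) (\<lambda>y. partial ((0,0),(0,1)) g (x, y))"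
proof -
  have B: "((1,0),(0,0)) \<in> (Basis :: ((real\<times>real)\<times>(real\<times>real)) set)" "((0,1),(0,0)) \<in> (Basis :: ((real\<times>real)\<times>(real\<times>real)) set)"
   "((0,0),(1,0)) \<in> (Basis :: ((real\<times>real)\<times>(real\<times>real)) set)" "((0,0),(0,1)) \<in> (Basis :: ((real\<times>real)\<times>(real\<times>real)) set)"
    by (auto simp: Basis_prod_def zero_prod_def)
  note c = B[THEN Ck_partial[OF assms(1)], THEN Ck_cont]
  note d = B[THEN partial_has_vector_derivative[OF assms(1)]]
  have cx: "continuous_on UNIV (\<lambda>x. h (x, y))" if "continuous_on UNIV h" for h :: "(real \<times> real) \<times> (real \<times> real) \<Rightarrow> real" and y
    by (rule continuous_on_compose2[OF that]) (auto intro!: continuous_intros)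
  have cy: "continuous_on UNIV (\<lambda>y. h (x, y))" if "continuous_on UNIV h" for h :: "(real \<times> real) \<times> (real \<times> real) \<Rightarrow> real" and x
    by (rule continuous_on_compose2[OF that]) (auto intro!: continuous_intros)
  show "C1grad (\<lambda>x. g (x, y)) (\<lambda>x. partial ((1,0),(0,0)) g (x, y)) (\<lambda>x. partial ((0,1),(0,0)) g (x, y))"
    using d(1,2)[where x = "(_, y)"] assms(2)
    by (intro C1grad_dirI cx c) (auto simp: periodic2_def simp flip: zero_prod_def)
  show "C1grad (\<lambda>y. g (x, y)) (\<lambda>y. partial ((0,0),(1,0)) g (x, y)) (\<lambda>y. partial ((0,0),(0,1)) g (x, y))"
    using d(3,4)[where x = "(x, _)"] assms(2)
    by (intro C1grad_dirI cy c) (auto simp: periodic2_def simp flip: zero_prod_def)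
qed

lemma periodic2_partial:
  fixes g :: "(real \<times> real) \<times> (real \<times> real) \<Rightarrow> real"
  assumes "periodic2 (\<lambda>x y. g (x, y))"
  shows "periodic2 (\<lambda>x y. partial i g (x, y))"
proof -
  have p: "periodic (\<lambda>x. g (x, z))" "periodic (\<lambda>x. g (z, x))" for z
    using assms unfolding periodic2_def by blast+
  have 1: "g (x + k + t *\<^sub>R fst i, z) = g (x + t *\<^sub>R fst i, z)" if "k = (1,0) \<or> k = (0,1)" for x k t z
  proof -
    have "x + k + t *\<^sub>R fst i = (x + t *\<^sub>R fst i) + k" by (simp add: algebra_simps)
    with p(1)[of z] that show ?thesis unfolding periodic_def by metis
  qed
  have 2: "g (z, x + k + t *\<^sub>R snd i) = g (z, x + t *\<^sub>R snd i)" if "k = (1,0) \<or> k = (0,1)" for x k t z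
  proof -
    have "x + k + t *\<^sub>R snd i = (x + t *\<^sub>R snd i) + k" by (simp add: algebra_simps)
    with p(2)[of z] that show ?thesis unfolding periodic_def by metis
  qed
  show ?thesis unfolding periodic2_def periodic_def partial_def
    using 1[of "(1,0)"] 1[of "(0,1)"] 2[of "(1,0)"] 2[of "(0,1)"] by (cases i) simp
qed

text \<open>Serves twice: as majorant of difference quotients along the flow, and as source of the
  Lipschitz constant of \<open>b\<close>.\<close>

lemma C1grad_lipschitz:
  assumes "C1grad f f1 f2"
  obtains L where "L \<ge> 0" "\<And>x y. \<bar>f x - f y\<bar> \<le> L * norm (x - y)"
proof -
  note p = C1grad_periodic[OF assms]
  have c: "continuous_on UNIV f1" "continuous_on UNIV f2" using assms by (auto simp: C1grad_def)
  obtain C1 where C1: "C1 > 0" "\<And>x. norm (f1 x) \<le> C1" using periodic_bounded[OF p(1) c(1)] by blast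
  obtain C2 where C2: "C2 > 0" "\<And>x. norm (f2 x) \<le> C2" using periodic_bounded[OF p(2) c(2)] by blast
  have "norm (f x - f y) \<le> (C1 + C2) * norm (x - y)" for x y
  proof (rule differentiable_bound[of UNIV f "\<lambda>x h. f1 x * fst h + f2 x * snd h"])
    show "(f has_derivative (\<lambda>h. f1 x * fst h + f2 x * snd h)) (at x within UNIV)" for x
      using assms by (auto simp: C1grad_def)
    fix x show "onorm (\<lambda>h. f1 x * fst h + f2 x * snd h) \<le> C1 + C2"
    proof (rule onorm_bound)
      fix h :: "real\<times>real"
      have "\<bar>f1 x * fst h\<bar> \<le> C1 * norm h" using C1(2)[of x] norm_fst_le[of "fst h" "snd h"] 
        by (auto simp: abs_mult intro!: mult_mono)
      moreover have "\<bar>f2 x * snd h\<bar> \<le> C2 * norm h" using C2(2)[of x] norm_snd_le[of "snd h" "fst h"] 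
        by (auto simp: abs_mult intro!: mult_mono)
      ultimately show "norm (f1 x * fst h + f2 x * snd h) \<le> (C1 + C2) * norm h"
        by (simp add: distrib_right)
    qed (use C1 C2 in auto)
  qed auto
  then show ?thesis using that[of "C1+C2"] C1 C2 by auto
qed

section \<open>The flow and its rotation set\<close>

text \<open>Of the regularity of \<open>b\<close> only a Lipschitz constant \<open>L\<close> and a
  bound \<open>M\<close> are retained; periodicity makes both global.\<close>

locale torus_flow =
  fixes b :: "real \<times> real \<Rightarrow> real \<times> real" and X :: "real \<Rightarrow> real \<times> real \<Rightarrow> real \<times> real"
    and L M :: real
  assumes b_per: "periodic b"
    and b_lip: "\<And>x y. norm (b x - b y) \<le> L * norm (x - y)"
    and L_pos: "L > 0"
    and b_bound: "\<And>x. norm (b x) \<le> M"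
    and M_pos: "M > 0"
    and X_flow: "is_flow b X"
begin

lemma X_0 [simp]: "X 0 x = x"
  using X_flow by (simp add: is_flow_def)

lemma X_deriv: "((\<lambda>s. X s x) has_vector_derivative b (X t x)) (at t)"
  using X_flow by (simp add: is_flow_def)

lemma b_cont: "continuous_on A b"
proof -
  have "L-lipschitz_on UNIV b"
    using b_lip L_pos by (intro lipschitz_onI) (auto simp: dist_norm)
  then show ?thesis
    using continuous_on_subset lipschitz_on_continuous_on by blast
qed

lemma X_cont_time: "continuous_on A (\<lambda>s. X s x)"
  by (intro continuous_at_imp_continuous_on ballI has_vector_derivative_continuous[OF X_deriv])

text \<open>The squared distance is differentiable even where the curves meet, and its derivative is
  at most \<open>2 * L\<close> times itself; hence it decreases after multiplication by
  \<open>exp (-2 * L * t)\<close>.\<close>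

lemma gronwall:
  assumes f: "\<And>t. (f has_vector_derivative b (f t)) (at t)"
    and g: "\<And>t. (g has_vector_derivative b (g t)) (at t)"
    and t: "t \<ge> 0"
  shows "norm (f t - g t) \<le> exp (L * t) * norm (f 0 - g 0)"
proof -
  define h where "h t = (f t - g t) \<bullet> (f t - g t) * exp (-2 * L * t)" for t
  have d: "((\<lambda>t. (f t - g t) \<bullet> (f t - g t)) has_real_derivative
      2 * ((f t - g t) \<bullet> (b (f t) - b (g t)))) (at t)" for t
  proof -
    have "((\<lambda>t. f t - g t) has_vector_derivative b (f t) - b (g t)) (at t)"
      by (intro has_vector_derivative_diff f g)
    from bounded_bilinear.has_vector_derivative[OF bounded_bilinear_inner this this]
    show ?thesis by (simp add: has_real_derivative_iff_has_vector_derivative inner_commute)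
  qed
  have dh: "(h has_real_derivative (2 * ((f t - g t) \<bullet> (b (f t) - b (g t))) - 2 * L * ((f t - g t) \<bullet> (f t - g t))) * exp (-2 * L * t)) (at t)" for t
    unfolding h_def by (rule derivative_eq_intros d refl | simp add: algebra_simps)+
  have "h t \<le> h 0"
  proof (rule DERIV_nonpos_imp_nonincreasing[OF t])
    fix s :: real
    have "(f s - g s) \<bullet> (b (f s) - b (g s)) \<le> norm (f s - g s) * norm (b (f s) - b (g s))"
      by (rule norm_cauchy_schwarz)
    also have "\<dots> \<le> norm (f s - g s) * (L * norm (f s - g s))"
      by (intro mult_left_mono b_lip) auto
    also have "\<dots> = L * ((f s - g s) \<bullet> (f s - g s))"
      by (simp add: power2_eq_square flip: power2_norm_eq_inner)
    finally have "(2 * ((f s - g s) \<bullet> (b (f s) - b (g s))) - 2 * L * ((f s - g s) \<bullet> (f s - g s))) * exp (-2 * L * s) \<le> 0"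
      by (intro mult_nonpos_nonneg) auto
    with dh show "\<exists>y. DERIV h s :> y \<and> y \<le> 0" by blast
  qed
  then have "(norm (f t - g t))\<^sup>2 * exp (-2 * L * t) \<le> (norm (f 0 - g 0))\<^sup>2"
    by (simp add: h_def power2_norm_eq_inner)
  then have "exp (2 * L * t) * ((norm (f t - g t))\<^sup>2 * exp (-2 * L * t)) \<le> exp (2 * L * t) * (norm (f 0 - g 0))\<^sup>2"
    by (rule mult_left_mono) simp
  moreover have "exp (2 * L * t) * ((norm (f t - g t))\<^sup>2 * exp (-2 * L * t)) = (norm (f t - g t))\<^sup>2"
  proof -
    have "exp (2 * L * t) * exp (-2 * L * t) = 1" by (simp flip: exp_add)
    then show ?thesis by (metis mult.commute mult.left_commute mult_1_right)
  qed
  moreover have "exp (2 * L * t) = (exp (L * t))\<^sup>2" by (simp add: power2_eq_square flip: exp_add)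
  ultimately have "(norm (f t - g t))\<^sup>2 \<le> (exp (L * t) * norm (f 0 - g 0))\<^sup>2"
    by (metis power_mult_distrib)
  then show ?thesis by (rule power2_le_imp_le) simp
qed

lemma ode_unique:
  assumes "\<And>t. (f has_vector_derivative b (f t)) (at t)"
    and "\<And>t. (g has_vector_derivative b (g t)) (at t)"
    and "t \<ge> 0" "f 0 = g 0"
  shows "f t = g t"
  using gronwall[OF assms(1-3)] assms(4) by simp

lemma X_lip: "t \<ge> 0 \<Longrightarrow> norm (X t x - X t y) \<le> exp (L * t) * norm (x - y)"
  using gronwall[of "\<lambda>s. X s x" "\<lambda>s. X s y" t] X_deriv by simp

lemma X_cont: "t \<ge> 0 \<Longrightarrow> continuous_on A (X t)"
proof -
  assume "t \<ge> 0"
  then have "(exp (L * t))-lipschitz_on UNIV (X t)"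
    using X_lip by (intro lipschitz_onI) (auto simp: dist_norm)
  then show ?thesis
    using continuous_on_subset lipschitz_on_continuous_on by blast
qed

lemma X_semigroup:
  assumes "t \<ge> 0"
  shows "X t (X s x) = X (s + t) x"
proof -
  have d: "((\<lambda>t. X (s + t) x) has_vector_derivative b (X (s + t) x)) (at t)" for t
  proof -
    have "((\<lambda>t. s + t) has_vector_derivative 1) (at t)" by (auto intro!: derivative_eq_intros)
    from vector_diff_chain_at[OF this, of "\<lambda>r. X r x"] X_deriv[of x "s + t"]
    show ?thesis by (simp add: o_def)
  qed
  show ?thesis
    using ode_unique[of "\<lambda>t. X t (X s x)" "\<lambda>t. X (s + t) x" t, OF X_deriv d assms] by simp
qed

text \<open>An integer translate of a solution is again a solution, so uniqueness lets the flow
  descend to the torus and makes the displacement periodic.\<close>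

lemma X_int:
  assumes "t \<ge> 0"
  shows "X t (x + (of_int m, of_int n)) = X t x + (of_int m, of_int n)" (is "_ (_ + ?k) = _")
proof -
  have "((\<lambda>t. X t x + ?k) has_vector_derivative b (X t x + ?k)) (at t)" for t
    using periodic_int[OF b_per, of "X t x" m n] X_deriv[of x t]
    by (auto intro!: derivative_eq_intros)
  then show ?thesis
    using ode_unique[of "\<lambda>t. X t (x + ?k)" "\<lambda>t. X t x + ?k" t, OF X_deriv _ assms] by simp
qed

lemma periodic_disp: "t \<ge> 0 \<Longrightarrow> periodic (\<lambda>x. X t x - x)"
  using X_int[of t _ 1 0] X_int[of t _ 0 1] by (simp add: periodic_def)

lemma periodic_X: "t \<ge> 0 \<Longrightarrow> periodic f \<Longrightarrow> periodic (\<lambda>x. f (X t x))"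
  using X_int[of t _ 1 0] X_int[of t _ 0 1] by (simp add: periodic_def)

lemma X_disp:
  assumes "t \<ge> 0" shows "norm (X t x - x) \<le> M * t"
proof -
  have "norm (X t x - X 0 x) \<le> M * norm (t - 0)"
  proof (rule differentiable_bound[of UNIV "\<lambda>s. X s x" "\<lambda>s h. h *\<^sub>R b (X s x)"])
    show "onorm (\<lambda>h. h *\<^sub>R b (X s x)) \<le> M" for s
      using mult_left_mono[OF b_bound[of "X s x"]] M_pos by (intro onorm_bound) (simp_all add: mult.commute[of M])
  qed (use X_deriv in \<open>auto simp: has_vector_derivative_def\<close>)
  with assms show ?thesis by simp
qed

text \<open>The velocity changes by at most \<open>L * M * t\<close> during time \<open>t\<close>.
  The quadratic order of the error, uniform in \<open>x\<close>, is what
  \<open>integral_disp\<close> exploits.\<close>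

lemma X_approx:
  assumes "t \<ge> 0" shows "norm (X t x - x - t *\<^sub>R b x) \<le> L * M * t\<^sup>2"
proof -
  have "norm (X t x - X 0 x - (t - 0) *\<^sub>R b (X 0 x)) \<le> norm (t - 0) * (L * M * t)"
  proof (rule vector_differentiable_bound_linearization[where S = "{0..t}"])
    show "((\<lambda>s. X s x) has_vector_derivative b (X s x)) (at s within {0..t})" for s
      by (rule has_vector_derivative_at_within[OF X_deriv])
    show "closed_segment 0 t \<subseteq> {0..t}" using assms by (simp add: closed_segment_eq_real_ivl)
    show "norm (b (X s x) - b (X 0 x)) \<le> L * M * t" if "s \<in> {0..t}" for s
    proof -
      have "norm (b (X s x) - b (X 0 x)) \<le> L * norm (X s x - x)" using b_lip[of "X s x" "X 0 x"] by simp
      also have "\<dots> \<le> L * (M * s)" using X_disp that L_pos by (intro mult_left_mono) auto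
      also have "\<dots> \<le> L * (M * t)" using that L_pos M_pos by (intro mult_left_mono) auto
      finally show ?thesis by simp
    qed
  qed (use assms in auto)
  then show ?thesis using assms by (simp add: power2_eq_square algebra_simps)
qed

lemma invariantD:
  fixes \<psi> :: "real \<times> real \<Rightarrow> real"
  assumes "invariant_measure X \<mu>" "continuous_on UNIV \<psi>" "periodic \<psi>"
  shows "(\<integral>y. \<psi> (X t y) \<partial>\<mu>) = (\<integral>y. \<psi> y \<partial>\<mu>)"
  using assms unfolding invariant_measure_def by blast

text \<open>By invariance the mean displacement is additive in time, and for small times it is
  \<open>t * (mean \<mu> b \<bullet> w)\<close> up to a quadratic error. An additive function with
  this property is exactly linear.\<close>

lemma integral_disp:
  assumes \<mu>: "torus_prob \<mu>" "invariant_measure X \<mu>" and "t \<ge> 0"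
  shows "(\<integral>x. (X t x - x) \<bullet> w \<partial>\<mu>) = t * (mean \<mu> b \<bullet> w)"
proof -
  interpret prob_space \<mu> using torus_probD[OF \<mu>(1)] by simp
  define h where "h t = (\<integral>x. (X t x - x) \<bullet> w \<partial>\<mu>)" for t
  have cd: "continuous_on UNIV (\<lambda>x. (X t x - x) \<bullet> w)" if "t \<ge> 0" for t
    by (intro continuous_intros X_cont that)
  have pd: "periodic (\<lambda>x. (X t x - x) \<bullet> w)" if "t \<ge> 0" for t
    using periodic_disp[OF that] unfolding periodic_def by metis
  have int: "integrable \<mu> (\<lambda>x. (X t x - x) \<bullet> w)" if "t \<ge> 0" for t
    by (intro integrable_cont_periodic \<mu> cd pd that)
  have add: "h (s + t) = h s + h t" if "s \<ge> 0" "t \<ge> 0" for s t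
  proof -
    have "h (s + t) = (\<integral>x. (X t (X s x) - X s x) \<bullet> w + (X s x - x) \<bullet> w \<partial>\<mu>)"
      unfolding h_def using that by (simp add: X_semigroup inner_diff_left)
    also have "\<dots> = (\<integral>x. (X t (X s x) - X s x) \<bullet> w \<partial>\<mu>) + h s"
      unfolding h_def
    proof (rule Bochner_Integration.integral_add)
      show "integrable \<mu> (\<lambda>x. (X t (X s x) - X s x) \<bullet> w)"
        using periodic_X[OF that(1) pd[OF that(2)]]
        by (intro integrable_cont_periodic \<mu> continuous_on_compose2[OF cd[OF that(2)] X_cont[OF that(1)]]) auto
    qed (use int that in auto)
    also have "(\<integral>x. (X t (X s x) - X s x) \<bullet> w \<partial>\<mu>) = h t"
      unfolding h_def using invariantD[OF \<mu>(2) cd[OF that(2)] pd[OF that(2)], of s] by simp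
    finally show ?thesis by simp
  qed
  have "integrable \<mu> b" by (intro integrable_cont_periodic \<mu> b_cont b_per)
  then have mb: "(\<integral>x. b x \<bullet> w \<partial>\<mu>) = mean \<mu> b \<bullet> w" and ib: "integrable \<mu> (\<lambda>x. b x \<bullet> w)"
    unfolding mean_def by auto
  have small: "\<bar>h t - t * (mean \<mu> b \<bullet> w)\<bar> \<le> L * M * norm w * t\<^sup>2" if "t \<ge> 0" for t
  proof -
    have "h t - t * (mean \<mu> b \<bullet> w) = (\<integral>x. (X t x - x) \<bullet> w - t * (b x \<bullet> w) \<partial>\<mu>)"
      unfolding h_def mb[symmetric] using int[OF that] ib by (subst Bochner_Integration.integral_diff) auto
    also have "\<bar>\<dots>\<bar> \<le> (\<integral>x. L * M * norm w * t\<^sup>2 \<partial>\<mu>)"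
    proof (rule integral_abs_bound[THEN order_trans], rule integral_mono)
      show "integrable \<mu> (\<lambda>x. \<bar>(X t x - x) \<bullet> w - t * (b x \<bullet> w)\<bar>)"
        using int[OF that] ib by auto
      fix x
      have "\<bar>(X t x - x) \<bullet> w - t * (b x \<bullet> w)\<bar> = \<bar>(X t x - x - t *\<^sub>R b x) \<bullet> w\<bar>"
        by (simp add: inner_diff_left)
      also have "\<dots> \<le> norm (X t x - x - t *\<^sub>R b x) * norm w" by (rule Cauchy_Schwarz_ineq2)
      also have "\<dots> \<le> L * M * t\<^sup>2 * norm w" by (intro mult_right_mono X_approx that) auto
      finally show "\<bar>(X t x - x) \<bullet> w - t * (b x \<bullet> w)\<bar> \<le> L * M * norm w * t\<^sup>2" by (simp add: algebra_simps)
    qed auto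
    also have "\<dots> = L * M * norm w * t\<^sup>2" by (simp add: prob_space)
    finally show ?thesis .
  qed
  have hn: "h (real n * s) = real n * h s" if "s \<ge> 0" for n s
  proof (induction n)
    case 0 show ?case using small[of 0] by simp
  next
    case (Suc n)
    have "h (real (Suc n) * s) = h (real n * s + s)" by (simp add: algebra_simps)
    also have "\<dots> = h (real n * s) + h s" by (rule add) (use that in auto)
    finally show ?case using Suc by (simp add: algebra_simps)
  qed
  define C where "C = L * M * norm w * t\<^sup>2"
  \<comment> \<open>Cutting \<open>[0, t]\<close> into \<open>Suc n\<close> equal pieces adds up
    \<open>Suc n\<close> errors of size \<open>(t / Suc n)\<^sup>2\<close>, a total of order
    \<open>1 / Suc n\<close>.\<close>
  have "\<bar>h t - t * (mean \<mu> b \<bullet> w)\<bar> \<le> C * inverse (real (Suc n))" for n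
  proof -
    let ?n = "real (Suc n)"
    have "h t = ?n * h (t / ?n)" using hn[of "t / ?n" "Suc n"] \<open>t \<ge> 0\<close> by simp
    then have "h t - t * (mean \<mu> b \<bullet> w) = ?n * (h (t / ?n) - t / ?n * (mean \<mu> b \<bullet> w))"
      by (simp add: right_diff_distrib del: of_nat_Suc)
    then have "\<bar>h t - t * (mean \<mu> b \<bullet> w)\<bar> = ?n * \<bar>h (t / ?n) - t / ?n * (mean \<mu> b \<bullet> w)\<bar>"
      by (simp add: abs_mult del: of_nat_Suc)
    also have "\<dots> \<le> ?n * (L * M * norm w * (t / ?n)\<^sup>2)"
      by (intro mult_left_mono small) (use \<open>t \<ge> 0\<close> in auto)
    also have "\<dots> = C * inverse ?n" unfolding C_def
      by (simp add: power2_eq_square divide_inverse del: of_nat_Suc)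
    finally show ?thesis .
  qed
  moreover have "(\<lambda>n. C * inverse (real (Suc n))) \<longlonglongrightarrow> C * 0"
    by (intro tendsto_intros LIMSEQ_inverse_real_of_nat)
  ultimately have "\<bar>h t - t * (mean \<mu> b \<bullet> w)\<bar> \<le> C * 0"
    by (intro LIMSEQ_le_const) auto
  then show ?thesis by (simp add: h_def)
qed

text \<open>Invariance makes every difference quotient of \<open>f\<close> along the flow integrate
  to zero. The quotients are bounded by \<open>K * M\<close>, so dominated convergence passes to the
  derivative along \<open>b\<close>.\<close>

lemma divergence_free:
  assumes \<mu>: "torus_prob \<mu>" "invariant_measure X \<mu>" and f: "C1grad f f1 f2"
  shows "(\<integral>x. f1 x * fst (b x) + f2 x * snd (b x) \<partial>\<mu>) = 0"
proof -
  interpret prob_space \<mu> using torus_probD[OF \<mu>(1)] by simp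
  obtain K where K: "K \<ge> 0" "\<And>x y. \<bar>f x - f y\<bar> \<le> K * norm (x - y)" using C1grad_lipschitz[OF f] by metis
  have fc: "continuous_on UNIV f" "periodic f" using C1grad_cont[OF f] f by (auto simp: C1grad_def)
  define q where "q n x = (f (X (inverse (real (Suc n))) x) - f x) * real (Suc n)" for n x
  have cX: "continuous_on UNIV (\<lambda>x. f (X (inverse (real (Suc n))) x))" for n
    by (intro continuous_on_compose2[OF fc(1) X_cont]) auto
  have i0: "integrable \<mu> f" by (intro integrable_cont_periodic \<mu> fc)
  have i1: "integrable \<mu> (\<lambda>x. f (X (inverse (real (Suc n))) x))" for n
    by (intro integrable_cont_periodic \<mu> cX periodic_X fc) auto
  have q0: "(\<integral>x. q n x \<partial>\<mu>) = 0" for n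
    unfolding q_def using i0 i1[of n] invariantD[OF \<mu>(2) fc, of "inverse (real (Suc n))"] by simp
  have "(\<lambda>n. \<integral>x. q n x \<partial>\<mu>) \<longlonglongrightarrow> (\<integral>x. f1 x * fst (b x) + f2 x * snd (b x) \<partial>\<mu>)"
  proof (rule integral_dominated_convergence[where w = "\<lambda>_. K * M"])
    have m: "h \<in> borel_measurable \<mu>" if "continuous_on UNIV h" for h :: "real \<times> real \<Rightarrow> real"
      using borel_measurable_continuous_onI[OF that] torus_probD(1)[OF \<mu>(1)] by (simp cong: measurable_cong_sets)
    show "(\<lambda>x. f1 x * fst (b x) + f2 x * snd (b x)) \<in> borel_measurable \<mu>"
      using f by (intro m continuous_intros b_cont) (auto simp: C1grad_def)
    show "q n \<in> borel_measurable \<mu>" for n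
      unfolding q_def by (intro m continuous_intros cX fc)
    show "AE x in \<mu>. norm (q n x) \<le> K * M" for n
    proof (rule AE_I2)
      fix x
      let ?n = "real (Suc n)"
      have "norm (q n x) = \<bar>f (X (inverse ?n) x) - f x\<bar> * ?n" by (simp add: q_def abs_mult)
      also have "\<dots> \<le> (K * norm (X (inverse ?n) x - x)) * ?n" by (intro mult_right_mono K) auto
      also have "\<dots> \<le> (K * (M * inverse ?n)) * ?n" 
        by (intro mult_right_mono mult_left_mono X_disp K) auto
      also have "\<dots> = K * M" by (simp add: field_simps)
      finally show "norm (q n x) \<le> K * M" .
    qed
    show "AE x in \<mu>. (\<lambda>n. q n x) \<longlonglongrightarrow> f1 x * fst (b x) + f2 x * snd (b x)"
    proof (rule AE_I2)
      fix x
      have "((\<lambda>s. X s x) has_derivative (\<lambda>h. h *\<^sub>R b x)) (at 0)"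
        using X_deriv[of x 0] by (simp add: has_vector_derivative_def)
      moreover have "(f has_derivative (\<lambda>h. f1 x * fst h + f2 x * snd h)) (at (X 0 x))" 
        using f by (simp add: C1grad_def)
      ultimately have "((\<lambda>s. f (X s x)) has_derivative (\<lambda>h. f1 x * fst (h *\<^sub>R b x) + f2 x * snd (h *\<^sub>R b x))) (at 0)"
        by (rule has_derivative_compose)
      then have "((\<lambda>s. f (X s x)) has_real_derivative (f1 x * fst (b x) + f2 x * snd (b x))) (at 0)"
        unfolding has_field_derivative_def by (rule has_derivative_eq_rhs) (auto simp: algebra_simps)
      then have "((\<lambda>h. (f (X h x) - f x) / h) \<longlongrightarrow> (f1 x * fst (b x) + f2 x * snd (b x))) (at 0)"
        by (simp add: DERIV_def)
      moreover have "filterlim (\<lambda>n. inverse (real (Suc n))) (at 0) sequentially"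
        by (intro filterlim_atI LIMSEQ_inverse_real_of_nat) auto
      ultimately have "(\<lambda>n. (f (X (inverse (real (Suc n))) x) - f x) / inverse (real (Suc n))) \<longlonglongrightarrow> (f1 x * fst (b x) + f2 x * snd (b x))"
        by (rule filterlim_compose)
      then show "(\<lambda>n. q n x) \<longlonglongrightarrow> f1 x * fst (b x) + f2 x * snd (b x)"
        by (simp add: q_def divide_inverse)
    qed
  qed auto
  then have "(\<lambda>n::nat. 0) \<longlonglongrightarrow> (\<integral>x. f1 x * fst (b x) + f2 x * snd (b x) \<partial>\<mu>)" unfolding q0 .
  then show ?thesis using LIMSEQ_unique tendsto_const by blast
qed


section \<open>Average displacements and the rotation set\<close>

definition avg :: "real \<Rightarrow> real \<times> real \<Rightarrow> real \<times> real" where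
  "avg t x = (X t x - x) /\<^sub>R t"

lemma disp_eq_avg: "t > 0 \<Longrightarrow> X t x - x = t *\<^sub>R avg t x"
  by (simp add: avg_def)

text \<open>The rotation set in the sense of Misiurewicz and Ziemian: limits of averages over times
  tending to infinity, where the starting point may vary with the time. The condition
  \<open>t > 0\<close> excludes the default value of \<open>avg\<close> at time 0.\<close>

definition rot_set :: "(real \<times> real) set" where
  "rot_set = (\<Inter>n::nat. closure {avg t x |t x. t \<ge> real n \<and> t > 0})"

lemma avg_bound: "t > 0 \<Longrightarrow> norm (avg t x) \<le> M"
  using X_disp[of t x] by (simp add: avg_def divide_inverse_commute[symmetric] pos_divide_le_eq)

lemma closed_rot_set: "closed rot_set"
  unfolding rot_set_def by (intro closed_INT) auto

lemma rot_set_bounded: "rot_set \<subseteq> cball 0 M"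
proof -
  have "rot_set \<subseteq> closure {avg t x |t x. t \<ge> real 0 \<and> t > 0}" unfolding rot_set_def by blast
  also have "\<dots> \<subseteq> cball 0 M" by (intro closure_minimal) (use avg_bound in auto)
  finally show ?thesis .
qed

lemma compact_rot_set: "compact rot_set"
  using closed_rot_set rot_set_bounded bounded_subset[OF bounded_cball] by (auto simp: compact_eq_bounded_closed)

lemma rot_set_near:
  assumes "r \<in> rot_set" "e > 0"
  obtains t x where "t \<ge> real n" "t > 0" "norm (avg t x - r) < e"
proof -
  have "r \<in> closure {avg t x |t x. t \<ge> real n \<and> t > 0}" using assms unfolding rot_set_def by blast
  then obtain y where "y \<in> {avg t x |t x. t \<ge> real n \<and> t > 0}" "dist y r < e"
    using assms(2) closure_approachable by blast
  then show ?thesis using that by (auto simp: dist_norm)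
qed

text \<open>All averages lie in a fixed ball, so those found in \<open>C\<close> at larger and
  larger times accumulate, and the accumulation point belongs to every closure in
  \<open>rot_set\<close>.\<close>

lemma rot_set_meets:
  assumes "closed C" "\<And>n::nat. \<exists>t x. t \<ge> real n \<and> t > 0 \<and> avg t x \<in> C"
  shows "\<exists>r\<in>rot_set. r \<in> C"
proof -
  have "\<forall>n. \<exists>t x. t \<ge> real n \<and> t > 0 \<and> avg t x \<in> C" using assms(2) by blast
  then obtain t x where tx: "\<And>n. t n \<ge> real n \<and> t n > 0 \<and> avg (t n) (x n) \<in> C" by metis
  have "compact (C \<inter> cball 0 M)" using assms(1) by (intro closed_Int_compact) auto
  moreover have "avg (t n) (x n) \<in> C \<inter> cball 0 M" for n using tx[of n] avg_bound by auto
  ultimately obtain r k where r0: "r \<in> C \<inter> cball 0 M" "strict_mono (k :: nat \<Rightarrow> nat)" "((\<lambda>n. avg (t n) (x n)) \<circ> k) \<longlonglongrightarrow> r"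
    using seq_compactE[of "C \<inter> cball 0 M" "\<lambda>n. avg (t n) (x n)"] compact_imp_seq_compact by metis
  note r = r0[unfolded o_def]
  have "r \<in> closure {avg t x |t x. t \<ge> real n \<and> t > 0}" for n
  proof (rule Lim_in_closed_set[OF closed_closure _ _ r(3)])
    show "\<forall>\<^sub>F m in sequentially. avg (t (k m)) (x (k m)) \<in> closure {avg t x |t x. t \<ge> real n \<and> t > 0}"
      using eventually_ge_at_top[of n]
    proof eventually_elim
      case (elim m)
      then have "real n \<le> t (k m)" using tx[of "k m"] seq_suble[OF r(2), of m] by linarith
      then show ?case using tx[of "k m"] by (intro subsetD[OF closure_subset]) blast
    qed
  qed auto
  then have "r \<in> rot_set" by (auto simp: rot_set_def)
  with r(1) show ?thesis by blast
qed

lemma rot_set_avoids: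
  assumes "closed C" "rot_set \<inter> C = {}"
  obtains n :: nat where "\<And>t x. t \<ge> real n \<Longrightarrow> t > 0 \<Longrightarrow> avg t x \<notin> C"
  using rot_set_meets[OF assms(1)] assms(2) by blast

text \<open>The support function form of the fact that \<open>mean \<mu> b\<close> lies in the
  convex hull of \<open>rot_set\<close>. If at some long time all averages were smaller in direction
  \<open>w\<close>, integration would contradict \<open>integral_disp\<close>.\<close>

lemma rot_set_mean:
  assumes \<mu>: "torus_prob \<mu>" "invariant_measure X \<mu>"
  shows "\<exists>r\<in>rot_set. r \<bullet> w \<ge> mean \<mu> b \<bullet> w"
proof -
  interpret prob_space \<mu> using torus_probD[OF \<mu>(1)] by simp
  let ?C = "{r. r \<bullet> w \<ge> mean \<mu> b \<bullet> w}"
  have "\<exists>t x. t \<ge> real n \<and> t > 0 \<and> avg t x \<in> ?C" for n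
  proof (rule ccontr)
    assume no: "\<not> ?thesis"
    let ?t = "real (Suc n)"
    let ?g = "\<lambda>x. (X ?t x - x) \<bullet> w"
    have lt: "?g x < ?t * (mean \<mu> b \<bullet> w)" for x
    proof -
      have "\<not> (avg ?t x \<bullet> w \<ge> mean \<mu> b \<bullet> w)"
      proof
        assume "avg ?t x \<bullet> w \<ge> mean \<mu> b \<bullet> w"
        moreover have "?t \<ge> real n" "?t > 0" by auto
        ultimately show False using no by blast
      qed
      then have "avg ?t x \<bullet> w < mean \<mu> b \<bullet> w" by simp
      then show ?thesis by (simp add: disp_eq_avg del: of_nat_Suc)
    qed
    have int: "integrable \<mu> ?g"
    proof (rule integrable_cont_periodic[OF \<mu>(1)])
      show "continuous_on UNIV ?g" by (intro continuous_intros X_cont) auto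
      show "periodic ?g" using periodic_disp[of ?t] unfolding periodic_def by (metis of_nat_0_le_iff)
    qed
    have "(\<integral>x. ?g x \<partial>\<mu>) < (\<integral>x. ?t * (mean \<mu> b \<bullet> w) \<partial>\<mu>)"
      by (rule integral_less_AE_space) (use int lt emeasure_space_1 in auto)
    then show False using integral_disp[OF \<mu>, of ?t w] by (simp add: prob_space)
  qed
  moreover have "closed ?C" by (intro closed_Collect_le continuous_intros)
  ultimately show ?thesis using rot_set_meets[of ?C] by blast
qed

text \<open>If every orbit fell below the line of slope \<open>c\<close> at some time, compactness of the torus would bound
  these times, and concatenating the pieces would keep all averages asymptotically below \<open>c\<close>.\<close>
lemma orbit_above:
  assumes r: "r \<in> rot_set" and c: "c < r \<bullet> w"
  obtains x where "\<And>s. s \<ge> 0 \<Longrightarrow> (X s x - x) \<bullet> w \<ge> s * c"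
proof -
  define g where "g s x = (X s x - x) \<bullet> w - s * c" for s x
  have "\<exists>x. \<forall>s\<ge>0. g s x \<ge> 0"
  proof (rule ccontr)
    assume "\<not> ?thesis"
    then have neg: "\<forall>x. \<exists>s\<ge>0. g s x < 0" by (meson not_le)
    let ?K = "cbox (0,0) (1,1) :: (real \<times> real) set"
    let ?U = "\<lambda>s. {x. g s x < 0}"
    have opn: "open (?U s)" if "s \<ge> 0" for s
      unfolding g_def by (intro open_Collect_less continuous_intros X_cont that)
    have "?K \<subseteq> (\<Union>s\<in>{0..}. ?U s)" using neg by auto
    then obtain F where F: "F \<subseteq> {0..}" "finite F" "?K \<subseteq> (\<Union>s\<in>F. ?U s)"
      using compactE_image[OF compact_cbox, of "{0..}" ?U "(0,0)" "(1,1)"] opn by (metis atLeast_iff)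
    have gper: "g s (fract x) = g s x" if "s \<ge> 0" for s x
      using periodic_fract[OF periodic_disp[OF that]] by (simp add: g_def)
    have cov: "\<exists>s\<in>F. g s x < 0" for x
    proof -
      have "fract x \<in> ?K" using fract_in unit_sq_subset by blast
      then obtain s where s: "s \<in> F" "g s (fract x) < 0" using F(3) by blast
      then have "s \<ge> 0" using F(1) by auto
      then show ?thesis using gper[of s x] s by auto
    qed
    \<comment> \<open>At time 0 nothing has dropped, so the covering times that act are positive.
      Their minimum \<open>\<sigma>\<close> is then a positive lower bound for the length of a
      piece.\<close>
    have g0: "g 0 x = 0" for x by (simp add: g_def)
    have Fpos: "s > 0" if "s \<in> F" "g s x < 0" for s x
      using that F(1) g0[of x] by (metis atLeast_iff less_irrefl order_le_less subsetD)
    define F' where "F' = {s\<in>F. s > 0}"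
    have F': "finite F'" "F' \<noteq> {}" using F(2) cov[of 0] Fpos[of _ 0] by (auto simp: F'_def)
    define \<sigma> where "\<sigma> = Min F'"
    define S where "S = Max F'"
    have \<sigma>: "\<sigma> > 0" "\<And>s. s \<in> F' \<Longrightarrow> \<sigma> \<le> s" "\<And>s. s \<in> F' \<Longrightarrow> s \<le> S"
      using F' by (auto simp: \<sigma>_def S_def F'_def)
    have S: "S > 0" using \<sigma> F'(2) by fastforce
    define C where "C = (M * norm w + \<bar>c\<bar>) * S"
    have gadd: "g (s + t) x = g s x + g t (X s x)" if "t \<ge> 0" for s t x
      using X_semigroup[OF that, of s x] by (simp add: g_def inner_diff_left algebra_simps)
    have gC: "g t x \<le> C" if "t \<ge> 0" "t \<le> S" for t x
    proof -
      have "(X t x - x) \<bullet> w \<le> norm (X t x - x) * norm w" by (rule norm_cauchy_schwarz)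
      also have "\<dots> \<le> (M * t) * norm w" by (intro mult_right_mono X_disp that) auto
      also have "\<dots> \<le> (M * S) * norm w" using that M_pos by (intro mult_right_mono mult_left_mono) auto
      finally have "(X t x - x) \<bullet> w \<le> M * S * norm w" .
      moreover have "- (t * c) \<le> \<bar>c\<bar> * S"
      proof -
        have "- (t * c) \<le> t * \<bar>c\<bar>" using mult_left_mono[of "- c" "\<bar>c\<bar>" t] that by simp
        also have "\<dots> \<le> S * \<bar>c\<bar>" by (intro mult_right_mono that) auto
        finally show ?thesis by (simp add: mult.commute)
      qed
      ultimately show ?thesis by (simp add: g_def C_def algebra_simps)
    qed
    \<comment> \<open>Induction over time in units of \<open>\<sigma>\<close>: from a longer orbit a
      first piece with negative \<open>g\<close> and duration between \<open>\<sigma>\<close> and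
      \<open>S\<close> is removed. What finally remains is shorter than \<open>S\<close> and
      contributes at most \<open>C\<close>.\<close>
    have all: "\<forall>t x. t \<ge> 0 \<longrightarrow> t \<le> real n * \<sigma> \<longrightarrow> g t x \<le> C" for n :: nat
    proof (induction n)
      case 0
      show ?case using gC S by auto
    next
      case (Suc n)
      show ?case
      proof (intro allI impI)
        fix t x assume t: "t \<ge> 0" "t \<le> real (Suc n) * \<sigma>"
        show "g t x \<le> C"
        proof (cases "t \<le> S")
          case True then show ?thesis using gC t by simp
        next
          case False
          obtain s where s: "s \<in> F" "g s x < 0" using cov by blast
          then have sF: "s \<in> F'" using Fpos by (auto simp: F'_def)
          have "t - s \<ge> 0" "t - s \<le> real n * \<sigma>"
            using \<sigma>(2,3)[OF sF] False t by (auto simp: algebra_simps)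
          then have "g (t - s) (X s x) \<le> C" using Suc by blast
          then show ?thesis using gadd[of "t - s" s x] \<open>t - s \<ge> 0\<close> s by simp
        qed
      qed
    qed
    have gle: "g t x \<le> C" if "t \<ge> 0" for t x
    proof -
      obtain n :: nat where "t / \<sigma> \<le> real n" using real_arch_simple by blast
      then have "t \<le> real n * \<sigma>" using \<sigma>(1) by (simp add: field_simps)
      then show ?thesis using all that by blast
    qed
    \<comment> \<open>An average this close to \<open>r\<close> exceeds \<open>c\<close> in
      direction \<open>w\<close> by at least half the gap; over a time larger than
      \<open>2 * C / (r \<bullet> w - c)\<close> the gain exceeds \<open>C\<close>.\<close>
    define e where "e = (r \<bullet> w - c) / (2 * (norm w + 1))"
    have e: "e > 0" using c by (simp add: e_def add_nonneg_pos)
    obtain n :: nat where n: "2 * C / (r \<bullet> w - c) < real n" using reals_Archimedean2 by blast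
    obtain t x where t: "t \<ge> real n" "t > 0" "norm (avg t x - r) < e" using rot_set_near[OF r e] by metis
    have "(r - avg t x) \<bullet> w \<le> norm (r - avg t x) * norm w" by (rule norm_cauchy_schwarz)
    also have "\<dots> \<le> e * norm w" using t by (intro mult_right_mono) (auto simp: norm_minus_commute)
    also have "\<dots> < e * (norm w + 1)" using e by simp
    also have "\<dots> = (r \<bullet> w - c) / 2" by (simp add: e_def field_simps add_nonneg_eq_0_iff add_pos_nonneg)
    finally have "avg t x \<bullet> w - c > (r \<bullet> w - c) / 2" by (simp add: inner_diff_left field_simps)
    moreover have "g t x = t * (avg t x \<bullet> w - c)" using t by (simp add: g_def disp_eq_avg algebra_simps)
    ultimately have "g t x > t * ((r \<bullet> w - c) / 2)" using t by simp
    moreover have "t * ((r \<bullet> w - c) / 2) > C"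
    proof -
      have "2 * C / (r \<bullet> w - c) < t" using n t by linarith
      then show ?thesis using c by (simp add: field_simps)
    qed
    ultimately show False using gle[of t x] t by simp
  qed
  then show ?thesis using that by (auto simp: g_def)
qed

text \<open>With \<open>w = p - z\<close>, some orbit keeps all averages in the half plane
  \<open>r \<bullet> w \<ge> p \<bullet> w - d\<close>. That half plane cuts from the disc around
  \<open>z\<close> through \<open>p\<close>, which contains \<open>rot_set\<close>, only a cap
  within distance \<open>e\<close> of \<open>p\<close>. Hence for large times no average of this
  orbit can be farther than \<open>e\<close> from \<open>p\<close>.\<close>

lemma orbit_near_exposed:
  assumes p: "p \<in> rot_set" and far: "\<And>r. r \<in> rot_set \<Longrightarrow> norm (r - z) \<le> norm (p - z)" and e: "e > 0"
  obtains x n where "n > 0" "\<And>t. t \<ge> real n \<Longrightarrow> norm (X t x - x - t *\<^sub>R p) \<le> e * t"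
proof -
  define w where "w = p - z"
  \<comment> \<open>Expanding \<open>norm (r - z) \<le> norm (p - z)\<close> around \<open>p\<close>
    gives \<open>(norm (r - p))\<^sup>2 \<le> 2 * (p \<bullet> w - r \<bullet> w) \<le> 2 *
    d\<close>, which must stay below \<open>e\<^sup>2\<close>.\<close>
  define d where "d = e\<^sup>2 / 4"
  have d: "d > 0" using e by (simp add: d_def)
  obtain x where x: "\<And>s. s \<ge> 0 \<Longrightarrow> (X s x - x) \<bullet> w \<ge> s * (p \<bullet> w - d)"
    using orbit_above[OF p, of "p \<bullet> w - d" w] d by auto
  let ?C = "{r. norm (r - p) \<ge> e \<and> r \<bullet> w \<ge> p \<bullet> w - d}"
  have cl: "closed ?C" by (intro closed_Collect_conj closed_Collect_le continuous_intros)
  have em: "rot_set \<inter> ?C = {}"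
  proof (rule ccontr)
    assume "\<not> ?thesis"
    then obtain r where r: "r \<in> rot_set" "norm (r - p) \<ge> e" "r \<bullet> w \<ge> p \<bullet> w - d" by blast
    have "(norm (r - z))\<^sup>2 \<le> (norm (p - z))\<^sup>2" using far[OF r(1)] by (intro power_mono) auto
    then have "(norm (r - p))\<^sup>2 \<le> 2 * (p \<bullet> w - r \<bullet> w)"
      by (simp add: w_def power2_norm_eq_inner inner_diff_left inner_diff_right inner_commute algebra_simps)
    also have "\<dots> \<le> 2 * d" using r by simp
    also have "\<dots> < e\<^sup>2" using e by (simp add: d_def)
    also have "\<dots> \<le> (norm (r - p))\<^sup>2" using r e by (intro power_mono) auto
    finally show False by simp
  qed
  obtain n where n: "\<And>t x. t \<ge> real n \<Longrightarrow> t > 0 \<Longrightarrow> avg t x \<notin> ?C"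
    by (rule rot_set_avoids[OF cl em]) (rule that)
  \<comment> \<open>\<open>Suc n\<close> rather than \<open>n\<close> guarantees
    \<open>t > 0\<close>, without which \<open>avg\<close> carries no information.\<close>
  have "norm (X t x - x - t *\<^sub>R p) \<le> e * t" if t: "t \<ge> real (Suc n)" for t
  proof -
    have tp: "t > 0" using t by simp
    have "avg t x \<bullet> w \<ge> p \<bullet> w - d" using x[of t] tp by (simp add: disp_eq_avg)
    then have "norm (avg t x - p) < e" using n[of t x] t tp by auto
    moreover have "X t x - x - t *\<^sub>R p = t *\<^sub>R (avg t x - p)" using tp by (simp add: disp_eq_avg scaleR_diff_right)
    ultimately show ?thesis using tp by (simp add: mult.commute)
  qed
  then show ?thesis using that[of "Suc n" x] by blast
qed

end

section \<open>Crossing of orbits with independent drifts\<close>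

lemma det2_bound: "\<bar>det2 u v\<bar> \<le> 2 * norm u * norm v" for u v :: "real \<times> real"
proof -
  have "\<bar>fst u * snd v\<bar> \<le> norm u * norm v" "\<bar>snd u * fst v\<bar> \<le> norm u * norm v"
    unfolding abs_mult using norm_fst_le[of "fst u" "snd u"] norm_snd_le[of "snd u" "fst u"]
      norm_fst_le[of "fst v" "snd v"] norm_snd_le[of "snd v" "fst v"]
    by (auto intro!: mult_mono)
  then show ?thesis unfolding det2_def by linarith
qed

text \<open>Two curves following rays in independent directions \<open>p\<close> and \<open>q\<close> cross: a crossing is a fixed point of a
  self-map of the square \<open>[0, 2T]\<^sup>2\<close>, which Brouwer's theorem provides.\<close>
lemma curves_cross:
  fixes f g :: "real \<Rightarrow> real \<times> real"
  assumes fc: "continuous_on {0..2*T} f" and gc: "continuous_on {0..2*T} g" and T: "T > 0"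
    and f: "\<And>s. s \<in> {0..2*T} \<Longrightarrow> norm (f s - (s - T) *\<^sub>R p) \<le> d * T"
    and g: "\<And>t. t \<in> {0..2*T} \<Longrightarrow> norm (g t - (t - T) *\<^sub>R q) \<le> d * T"
    and pq: "det2 p q \<noteq> 0" and d: "4 * d * norm p \<le> \<bar>det2 p q\<bar>" "4 * d * norm q \<le> \<bar>det2 p q\<bar>"
  obtains s t where "s \<in> {0..2*T}" "t \<in> {0..2*T}" "f s = g t"
proof -
  define E where "E z = f (fst z) - g (snd z)" for z
  \<comment> \<open>Cramer's rule: \<open>G\<close> subtracts from the parameters
    \<open>(s, t)\<close> the coordinates of \<open>E\<close> with respect to \<open>p\<close> and
    \<open>-q\<close>. For exact rays \<open>G\<close> is constantly \<open>(T, T)\<close>; its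
    fixed points are the zeros of \<open>E\<close>.\<close>
  define G where "G z = (fst z - det2 (E z) q / det2 p q, snd z - det2 (E z) p / det2 p q)" for z
  let ?Q = "{0..2*T} \<times> {0..2*T}"
  have cE: "continuous_on ?Q E"
    unfolding E_def by (intro continuous_intros continuous_on_compose2[OF fc] continuous_on_compose2[OF gc]) auto
  have cG: "continuous_on ?Q G"
    unfolding G_def det2_def by (intro continuous_intros cE) (use pq in \<open>auto simp: det2_def\<close>)
  have "G z \<in> ?Q" if "z \<in> ?Q" for z
  proof -
    define err where "err = E z - ((fst z - T) *\<^sub>R p - (snd z - T) *\<^sub>R q)"
    have "err = (f (fst z) - (fst z - T) *\<^sub>R p) - (g (snd z) - (snd z - T) *\<^sub>R q)" by (simp add: err_def E_def)
    then have "norm err \<le> norm (f (fst z) - (fst z - T) *\<^sub>R p) + norm (g (snd z) - (snd z - T) *\<^sub>R q)"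
      by (metis norm_triangle_ineq4)
    also have "\<dots> \<le> d * T + d * T" using f[of "fst z"] g[of "snd z"] that by (intro add_mono) auto
    finally have err: "norm err \<le> 2 * (d * T)" by (simp only: mult_2)
    have Ez: "E z = err + ((fst z - T) *\<^sub>R p - (snd z - T) *\<^sub>R q)" by (simp add: err_def)
    have e1: "fst z - det2 (E z) q / det2 p q = T - det2 err q / det2 p q"
      unfolding Ez using pq by (simp add: det2_def field_simps)
    have e2: "snd z - det2 (E z) p / det2 p q = T - det2 err p / det2 p q"
      unfolding Ez using pq by (simp add: det2_def field_simps)
    \<comment> \<open>The factor 4 in the hypotheses on \<open>d\<close> splits into 2 for the two
      curves and 2 from \<open>det2_bound\<close>.\<close>
    have small: "\<bar>det2 err v / det2 p q\<bar> \<le> T" if "4 * d * norm v \<le> \<bar>det2 p q\<bar>" for v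
    proof -
      have "\<bar>det2 err v\<bar> \<le> 2 * norm err * norm v" by (rule det2_bound)
      also have "\<dots> \<le> 2 * (2 * (d * T)) * norm v" by (intro mult_right_mono mult_left_mono err) auto
      also have "\<dots> = (4 * d * norm v) * T" by simp
      also have "\<dots> \<le> \<bar>det2 p q\<bar> * T" using that T by (intro mult_right_mono) auto
      finally show ?thesis using pq by (simp add: abs_divide field_simps)
    qed
    show ?thesis unfolding G_def e1 e2 using small[OF d(1)] small[OF d(2)] unfolding abs_le_iff by auto
  qed
  then have "G \<in> ?Q \<rightarrow> ?Q" by blast
  moreover have "compact ?Q" "convex ?Q" "?Q \<noteq> {}" using T by (auto intro!: compact_Times convex_Times)
  ultimately obtain z where z: "z \<in> ?Q" "G z = z" using brouwer[of ?Q G] cG by blast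
  then have "fst (G z) = fst z" "snd (G z) = snd z" by auto
  then have "det2 (E z) q = 0" "det2 (E z) p = 0" using pq by (simp_all add: G_def)
  then have "fst (E z) * det2 p q = 0" "snd (E z) * det2 p q = 0"
    unfolding det2_def by algebra+
  then have "E z = 0" using pq by (simp add: prod_eq_iff)
  then show ?thesis using that[of "fst z" "snd z"] z(1) by (auto simp: E_def)
qed

lemma norm_diff3_le: "norm (u - v - w) \<le> norm u + norm v + norm w" for u :: "'a::real_normed_vector"
  using norm_triangle_ineq4[of "u - v" w] norm_triangle_ineq4[of u v] by linarith

lemma norm_fract_le: "norm (fract x) \<le> 2"
proof -
  have "norm (fract x) \<le> \<bar>fst (fract x)\<bar> + \<bar>snd (fract x)\<bar>"
    using norm_Pair_le[of "fst (fract x)" "snd (fract x)"] by simp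
  then show ?thesis using fract_in[of x] by (auto simp: unit_sq_def)
qed

context torus_flow begin

text \<open>Before time \<open>n\<close> only the crude speed bound \<open>M + norm p\<close> is
  available; a large \<open>T\<close> absorbs this initial piece.\<close>

lemma orbit_dev_bound:
  assumes x: "\<And>t. t \<ge> real n \<Longrightarrow> norm (X t x - x - t *\<^sub>R p) \<le> e * t"
    and T: "(M + norm p) * real n \<le> 2 * e * T" and e: "e > 0" and s: "s \<in> {0..2*T}"
  shows "norm (X s x - x - s *\<^sub>R p) \<le> 2 * e * T"
proof (cases "s \<ge> real n")
  case True
  have "norm (X s x - x - s *\<^sub>R p) \<le> e * s" using x True by simp
  also have "\<dots> \<le> e * (2 * T)" using s e by (intro mult_left_mono) auto
  finally show ?thesis by (simp only: mult.left_commute mult.assoc)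
next
  case False
  have "norm (X s x - x - s *\<^sub>R p) \<le> norm (X s x - x) + norm (s *\<^sub>R p)" by (rule norm_triangle_ineq4)
  also have "\<dots> \<le> M * s + s * norm p" using X_disp[of s x] s by (intro add_mono) auto
  also have "\<dots> = (M + norm p) * s" by (simp add: algebra_simps)
  also have "\<dots> \<le> (M + norm p) * real n" using False M_pos by (intro mult_left_mono) (auto simp: add_nonneg_nonneg)
  finally show ?thesis using T by simp
qed

text \<open>One orbit is translated by an integer vector so that the two approximating rays meet at
  time \<open>T\<close> up to an offset in the unit cell. The offset stays bounded while the
  tolerance \<open>d * T\<close> of \<open>curves_cross\<close> grows, so a crossing occurs for
  large \<open>T\<close>.\<close>

lemma exposed_parallel:
  assumes p: "p \<in> rot_set" "\<And>r. r \<in> rot_set \<Longrightarrow> norm (r - z) \<le> norm (p - z)"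
    and q: "q \<in> rot_set" "\<And>r. r \<in> rot_set \<Longrightarrow> norm (r - z') \<le> norm (q - z')"
  shows "det2 p q = 0"
proof (rule ccontr)
  assume nz: "det2 p q \<noteq> 0"
  then have pq: "norm (p - q) > 0" by (auto simp: det2_def)
  define d where "d = \<bar>det2 p q\<bar> / (4 * (norm p + norm q + 1))"
  have d0: "d > 0" using nz by (simp add: d_def add_nonneg_pos)
  have dd: "\<bar>det2 p q\<bar> = 4 * d * (norm p + norm q + 1)"
  proof -
    have "norm p + norm q + 1 > 0" by (simp add: add_nonneg_pos)
    then show ?thesis unfolding d_def by (simp add: field_simps)
  qed
  have dp: "4 * d * norm p \<le> \<bar>det2 p q\<bar>" "4 * d * norm q \<le> \<bar>det2 p q\<bar>"
    unfolding dd using d0 by (auto intro!: mult_left_mono)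
  \<comment> \<open>One quarter of \<open>d\<close> leaves room for the deviation
    \<open>2 * e * T\<close> and the cell offset together; one quarter of
    \<open>norm (p - q)\<close> makes the two drifts distinguishable at the end.\<close>
  define e where "e = min (d / 4) (norm (p - q) / 4)"
  have e: "e > 0" "4 * e \<le> d" "4 * e \<le> norm (p - q)" using d0 pq by (auto simp: e_def)
  obtain x n1 where x: "\<And>t. t \<ge> real n1 \<Longrightarrow> norm (X t x - x - t *\<^sub>R p) \<le> e * t"
    using orbit_near_exposed[OF p e(1)] by metis
  obtain y n2 where y: "\<And>t. t \<ge> real n2 \<Longrightarrow> norm (X t y - y - t *\<^sub>R q) \<le> e * t"
    using orbit_near_exposed[OF q e(1)] by metis
  \<comment> \<open>Chosen so that \<open>2 * e * T\<close> dominates the offset bound 2 as well as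
    both initial pieces in \<open>orbit_dev_bound\<close>.\<close>
  define T where "T = (2 + (M + norm p) * real n1 + (M + norm q) * real n2) / (2 * e)"
  have nn: "(M + norm p) * real n1 \<ge> 0" "(M + norm q) * real n2 \<ge> 0" using M_pos by auto
  have T2: "2 * e * T = 2 + (M + norm p) * real n1 + (M + norm q) * real n2" using e by (simp add: T_def)
  have Tp: "T > 0" unfolding T_def using e nn by (intro divide_pos_pos) auto
  have eT: "4 * e * T \<le> d * T" using e Tp by (intro mult_right_mono) auto
  \<comment> \<open>The point that the ray of the second orbit reaches at time \<open>T\<close>; it
    serves as origin. The vector \<open>k\<close> moves the ray of the first orbit there modulo the
    cell, and the summand 0 in its definition only fixes the type.\<close>
  define z0 where "z0 = y + T *\<^sub>R q"
  define k where "k = (of_int \<lfloor>fst (z0 - x - T *\<^sub>R p)\<rfloor>, of_int \<lfloor>snd (z0 - x - T *\<^sub>R p)\<rfloor>) + (0 :: real \<times> real)"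
  have k: "z0 - x - T *\<^sub>R p = fract (z0 - x - T *\<^sub>R p) + k"
    unfolding k_def using fract_eq[of "z0 - x - T *\<^sub>R p"] by simp
  define f where "f s = X s x + k - z0" for s
  define g where "g t = X t y - z0" for t
  have "\<exists>s t. s \<in> {0..2*T} \<and> t \<in> {0..2*T} \<and> f s = g t"
  proof (rule curves_cross[of T f g p d q])
    show "continuous_on {0..2*T} f" "continuous_on {0..2*T} g"
      unfolding f_def g_def by (intro continuous_intros X_cont_time)+
    show "norm (f s - (s - T) *\<^sub>R p) \<le> d * T" if "s \<in> {0..2*T}" for s
    proof -
      have "f s - (s - T) *\<^sub>R p = (X s x - x - s *\<^sub>R p) - fract (z0 - x - T *\<^sub>R p)"
        using k by (simp add: f_def algebra_simps)
      then have "norm (f s - (s - T) *\<^sub>R p) \<le> norm (X s x - x - s *\<^sub>R p) + norm (fract (z0 - x - T *\<^sub>R p))"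
        by (metis norm_triangle_ineq4)
      also have "\<dots> \<le> 2 * e * T + 2"
        using orbit_dev_bound[OF x _ e(1) that] T2 nn norm_fract_le by (intro add_mono) auto
      finally show ?thesis using eT T2 nn by simp
    qed
    show "norm (g t - (t - T) *\<^sub>R q) \<le> d * T" if "t \<in> {0..2*T}" for t
    proof -
      have "g t - (t - T) *\<^sub>R q = X t y - y - t *\<^sub>R q" by (simp add: g_def z0_def algebra_simps)
      moreover have "norm (X t y - y - t *\<^sub>R q) \<le> 2 * e * T"
        using orbit_dev_bound[OF y _ e(1) that] T2 nn by auto
      ultimately show ?thesis using eT T2 nn by simp
    qed
  qed (use Tp nz dp in auto)
  then obtain s t where st: "s \<ge> 0" "t \<ge> 0" "X s x + k = X t y" by (auto simp: f_def g_def)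
  have same: "X (s + r) x + k = X (t + r) y" if "r \<ge> 0" for r
  proof -
    have "X r (X s x + k) = X r (X s x) + k" unfolding k_def by (simp add: X_int[OF that])
    then show ?thesis using st(3) X_semigroup[OF that] by metis
  qed
  define K where "K = e * (s + t) + norm (x + s *\<^sub>R p + k - y - t *\<^sub>R q)"
  have bd: "r * norm (p - q) \<le> 2 * e * r + K" if r: "r \<ge> real n1" "r \<ge> real n2" for r
  proof -
    have r0: "r \<ge> 0" using r of_nat_0_le_iff[of n1, where ?'a = real] by linarith
    have "r *\<^sub>R (p - q) = (X (t+r) y - y - (t+r) *\<^sub>R q) - (X (s+r) x - x - (s+r) *\<^sub>R p) - (x + s *\<^sub>R p + k - y - t *\<^sub>R q)"
      unfolding same[OF r0, symmetric] by (simp add: algebra_simps)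
    then have "norm (r *\<^sub>R (p - q)) \<le> norm (X (t+r) y - y - (t+r) *\<^sub>R q) + norm (X (s+r) x - x - (s+r) *\<^sub>R p) + norm (x + s *\<^sub>R p + k - y - t *\<^sub>R q)"
      by (metis norm_diff3_le)
    also have "\<dots> \<le> e * (t + r) + e * (s + r) + norm (x + s *\<^sub>R p + k - y - t *\<^sub>R q)"
      using st r by (intro add_mono x y) auto
    finally have "norm (r *\<^sub>R (p - q)) \<le> e * (t + r) + e * (s + r) + norm (x + s *\<^sub>R p + k - y - t *\<^sub>R q)" .
    moreover have "norm (r *\<^sub>R (p - q)) = r * norm (p - q)" using r0 by simp
    ultimately show ?thesis unfolding K_def distrib_left by linarith
  qed
  have K0: "K \<ge> 0" using e st by (simp add: K_def)
  \<comment> \<open>Having met, the orbits agree modulo \<open>k\<close>, so their drifts may differ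
    by at most \<open>2 * e * r + K\<close> after a further time \<open>r\<close>. Since
    \<open>norm (p - q) \<ge> 4 * e\<close>, this fails as soon as
    \<open>2 * e * r > K\<close>.\<close>
  define r where "r = real n1 + real n2 + (K + 1) / (2 * e)"
  have "r * norm (p - q) \<le> 2 * e * r + K" using K0 e by (intro bd) (auto simp: r_def)
  moreover have "r * (4 * e) \<le> r * norm (p - q)" using e K0 by (intro mult_left_mono) (auto simp: r_def)
  ultimately have "2 * e * r \<le> K" by (simp add: mult.commute mult.left_commute)
  moreover have "2 * e * r \<ge> 2 * e * ((K + 1) / (2 * e))" using e by (intro mult_left_mono) (auto simp: r_def)
  ultimately show False using e by simp
qed

text \<open>Points of the rotation set that are farthest from some centre are exposed. With the centres \<open>0\<close> and
  \<open>-N w\<close>, where \<open>w\<close> is orthogonal to the first point, two independent ones would be found.\<close>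
lemma means_parallel:
  assumes \<mu>: "torus_prob \<mu>" "invariant_measure X \<mu>" and \<nu>: "torus_prob \<nu>" "invariant_measure X \<nu>"
  shows "det2 (mean \<mu> b) (mean \<nu> b) = 0"
proof (rule ccontr)
  assume nz: "det2 (mean \<mu> b) (mean \<nu> b) \<noteq> 0"
  define a c where "a = mean \<mu> b" and "c = mean \<nu> b"
  have ac: "\<exists>r\<in>rot_set. r \<bullet> w \<ge> v \<bullet> w" if "v \<in> {a, c}" for v w
    using rot_set_mean[OF \<mu>, of w] rot_set_mean[OF \<nu>, of w] that by (auto simp: a_def c_def)
  then have ne: "rot_set \<noteq> {}" by blast
  have farthest: "\<exists>p\<in>rot_set. \<forall>r\<in>rot_set. norm (r - z) \<le> norm (p - z)" for z
    by (intro continuous_attains_sup compact_rot_set ne continuous_intros)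
  obtain p where p: "p \<in> rot_set" "\<And>r. r \<in> rot_set \<Longrightarrow> norm (r - 0) \<le> norm (p - 0)"
    using farthest[of 0] by blast
  have "a \<noteq> 0" using nz by (auto simp: a_def det2_def)
  obtain r0 where r0: "r0 \<in> rot_set" "r0 \<bullet> a \<ge> a \<bullet> a" using ac by blast
  have "r0 \<noteq> 0" using r0(2) \<open>a \<noteq> 0\<close> inner_gt_zero_iff[of a] by (metis inner_zero_left not_le)
  then have "p \<noteq> 0" using p(2)[OF r0(1)] by auto
  \<comment> \<open>A quarter turn of \<open>p\<close>, so that the inner product with
    \<open>w0\<close> measures independence from \<open>p\<close>. Below, \<open>w\<close> is
    \<open>w0\<close> with the sign for which \<open>v\<close>, and hence some \<open>r\<close> in
    \<open>rot_set\<close>, has positive component.\<close>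
  define w0 where "w0 = (- snd p, fst p)"
  have w0: "v \<bullet> w0 = det2 p v" for v by (simp add: w0_def det2_def inner_prod_def)
  have "\<exists>v\<in>{a, c}. v \<bullet> w0 \<noteq> 0"
  proof (rule ccontr)
    assume "\<not> ?thesis"
    then have "det2 p a = 0" "det2 p c = 0" by (auto simp: w0)
    then have "fst p * det2 a c = 0" "snd p * det2 a c = 0" unfolding det2_def by algebra+
    then show False using \<open>p \<noteq> 0\<close> nz by (auto simp: prod_eq_iff a_def c_def)
  qed
  then obtain v where v: "v \<in> {a, c}" "v \<bullet> w0 \<noteq> 0" by blast
  define w where "w = (if v \<bullet> w0 > 0 then w0 else - w0)"
  have vw: "v \<bullet> w > 0" using v(2) by (auto simp: w_def)
  obtain r where r: "r \<in> rot_set" "r \<bullet> w \<ge> v \<bullet> w" using ac[OF v(1)] by blast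
  \<comment> \<open>Comparing the distances of \<open>r\<close> and \<open>q\<close> from
    \<open>- N *\<^sub>R w\<close> gives \<open>2 * N * (r \<bullet> w) \<le> (norm q)\<^sup>2 + 2 *
    N * (q \<bullet> w)\<close>. With \<open>norm q \<le> M\<close> this choice of \<open>N\<close>
    forces \<open>q \<bullet> w > 0\<close>.\<close>
  define N where "N = M\<^sup>2 / (r \<bullet> w)"
  have rw: "r \<bullet> w > 0" using vw r by simp
  have N: "N > 0" "N * (r \<bullet> w) = M\<^sup>2" using M_pos rw by (auto simp: N_def)
  obtain q where q: "q \<in> rot_set" "\<And>r. r \<in> rot_set \<Longrightarrow> norm (r - (- N *\<^sub>R w)) \<le> norm (q - (- N *\<^sub>R w))"
    using farthest by blast
  have "(norm (r - (- N *\<^sub>R w)))\<^sup>2 \<le> (norm (q - (- N *\<^sub>R w)))\<^sup>2"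
    using q(2)[OF r(1)] by (intro power_mono) auto
  then have "(norm r)\<^sup>2 + 2 * (N * (r \<bullet> w)) \<le> (norm q)\<^sup>2 + 2 * (N * (q \<bullet> w))"
    by (simp add: power2_norm_eq_inner inner_add_left inner_add_right inner_commute algebra_simps)
  moreover have "(norm q)\<^sup>2 \<le> M\<^sup>2" using rot_set_bounded q(1) by (intro power_mono) auto
  moreover have "M\<^sup>2 > 0" using M_pos by simp
  ultimately have "N * (q \<bullet> w) > 0" using N(2) zero_le_power2[of "norm r"] by linarith
  then have "q \<bullet> w0 \<noteq> 0" by (auto simp: w_def split: if_splits)
  moreover have "det2 p q = 0" by (rule exposed_parallel[OF p q])
  ultimately show False by (simp add: w0)
qed

end

section \<open>Sawtooth convolution\<close>

definition per1 :: "(real \<Rightarrow> real) \<Rightarrow> bool" where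
  "per1 f \<longleftrightarrow> (\<forall>t. f (t + 1) = f t)"

text \<open>On the circle this inverts \<open>- d/dy\<close> modulo constants, see
  \<open>sawconv_deriv\<close> and \<open>sawconv_of_deriv\<close>.\<close>

definition sawconv :: "(real \<Rightarrow> real) \<Rightarrow> real \<Rightarrow> real" where
  "sawconv f y = integral {0..1} (\<lambda>t. (1/2 - t) * f (y + t))"

lemma antiderivative_real:
  fixes f :: "real \<Rightarrow> real"
  assumes "continuous_on UNIV f"
  obtains F where "\<And>x. (F has_real_derivative f x) (at x)"
proof -
  have "\<exists>F. \<forall>x. -\<infinity> < ereal x \<longrightarrow> ereal x < \<infinity> \<longrightarrow> (F has_vector_derivative f x) (at x)"
    using assms by (intro einterval_antiderivative) (auto simp: continuous_on_eq_continuous_at)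
  then show ?thesis using that by (auto simp: has_real_derivative_iff_has_vector_derivative)
qed

lemma has_integral_FTC:
  assumes "\<And>x. (F has_real_derivative f x) (at x)" "a \<le> b"
  shows "(f has_integral (F b - F a)) {a..b}"
  using assms by (intro fundamental_theorem_of_calculus)
    (auto simp: has_real_derivative_iff_has_vector_derivative intro: has_vector_derivative_at_within)

lemma integral_FTC:
  assumes "\<And>x. (F has_real_derivative f x) (at x)" "a \<le> b"
  shows "integral {a..b} f = F b - F a"
  using has_integral_FTC[OF assms] by (rule integral_unique)

lemma DERIV_shift_left:
  fixes F :: "real \<Rightarrow> real"
  assumes "(F has_real_derivative d) (at (y + x))"
  shows "((\<lambda>x. F (y + x)) has_real_derivative d) (at x)"
proof -
  have "((\<lambda>x. y + x) has_real_derivative 1) (at x)" by (auto intro!: derivative_eq_intros)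
  from DERIV_chain2[OF assms this] show ?thesis by simp
qed

lemma integral_per1_shift:
  assumes f: "continuous_on UNIV f" "per1 f"
  shows "integral {0..1} (\<lambda>t. f (y + t)) = integral {0..1} f"
proof -
  obtain F where F: "\<And>x. (F has_real_derivative f x) (at x)" using antiderivative_real[OF f(1)] by blast
  have Fs: "((\<lambda>x. F (y + x)) has_real_derivative f (y + x)) (at x)" for x y
    by (intro DERIV_shift_left F)
  have "((\<lambda>x. F (1 + x) - F x) has_real_derivative 0) (at x)" for x
    using DERIV_diff[OF Fs[of 1 x] F[of x]] f(2)[unfolded per1_def, rule_format, of x] by (simp add: add.commute[of x 1])
  then have "F (1 + y) - F y = F (1 + 0) - F 0"
    using DERIV_isconst_all[of "\<lambda>x. F (1 + x) - F x"] by metis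
  then show ?thesis
    using integral_FTC[OF Fs[of y], of 0 1] integral_FTC[OF F, of 0 1] by (simp add: add.commute[of y 1])
qed

text \<open>As \<open>f\<close> is merely continuous, the derivative cannot be taken under the
  integral. Primitives of \<open>f\<close> and of \<open>x * f x\<close> turn the convolution into
  an explicit differentiable expression.\<close>

lemma sawconv_deriv:
  assumes f: "continuous_on UNIV f" "per1 f"
  shows "(sawconv f has_real_derivative (integral {0..1} f - f y)) (at y)"
proof -
  obtain F where F: "\<And>x. (F has_real_derivative f x) (at x)" using antiderivative_real[OF f(1)] by blast
  obtain G where G: "\<And>x. (G has_real_derivative x * f x) (at x)"
    by (rule antiderivative_real[of "\<lambda>x. x * f x"]) (use f(1) in \<open>auto intro: continuous_intros\<close>)
  have Fs: "((\<lambda>x. F (y + x)) has_real_derivative f (y + x)) (at x)" for x y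
    by (intro DERIV_shift_left F)
  have Gs: "((\<lambda>x. G (y + x)) has_real_derivative (y + x) * f (y + x)) (at x)" for x y
    by (intro DERIV_shift_left G)
  have eq: "sawconv f = (\<lambda>y. (1/2 + y) * (F (1 + y) - F y) - (G (1 + y) - G y))"
  proof
    fix y
    have "((\<lambda>t. (1/2 + y) * F (y + t) - G (y + t)) has_real_derivative (1/2 - t) * f (y + t)) (at t)" for t
      using DERIV_diff[OF DERIV_cmult[OF Fs[of y t], of "1/2 + y"] Gs[of y t]] by (simp add: algebra_simps)
    from integral_FTC[OF this, of 0 1]
    show "sawconv f y = (1/2 + y) * (F (1 + y) - F y) - (G (1 + y) - G y)"
      by (simp add: sawconv_def algebra_simps)
  qed
  have I: "integral {0..1} f = F (1 + y) - F y"
    using integral_per1_shift[OF f, of y] integral_FTC[OF Fs[of y], of 0 1] by (simp add: add.commute[of y 1])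
  have p: "f (1 + y) = f y" using f(2) by (simp add: per1_def add.commute[of 1])
  show ?thesis unfolding eq
    by (rule derivative_eq_intros Fs F Gs G refl)+ (simp add: I p algebra_simps)
qed

lemma sawconv_cont: "continuous_on UNIV f \<Longrightarrow> per1 f \<Longrightarrow> continuous_on A (sawconv f)"
  by (meson DERIV_isCont continuous_at_imp_continuous_on sawconv_deriv)

lemma sawconv_per1: "per1 f \<Longrightarrow> per1 (sawconv f)"
proof -
  assume "per1 f"
  then have "f (y + 1 + t) = f (y + t)" for y t
    unfolding per1_def by (metis add.assoc add.commute)
  then show ?thesis by (simp add: per1_def sawconv_def)
qed

text \<open>Integration by parts: the kernel has the values \<open>1/2\<close> and
  \<open>-1/2\<close> at the two ends of the period, and the boundary terms add up to
  \<open>- f y\<close>.\<close>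

lemma sawconv_of_deriv:
  assumes d: "\<And>x. (f has_real_derivative f' x) (at x)" and f: "per1 f"
  shows "sawconv f' y = integral {0..1} f - f y"
proof -
  have c: "continuous_on UNIV f"
    using d by (meson DERIV_isCont continuous_at_imp_continuous_on)
  have ds: "((\<lambda>x. f (y + x)) has_real_derivative f' (y + x)) (at x)" for x
    by (intro DERIV_shift_left d)
  have "((\<lambda>t. (1/2 - t) * f (y + t)) has_real_derivative (- f (y + t) + (1/2 - t) * f' (y + t))) (at t)" for t
    by (rule derivative_eq_intros ds refl)+ simp
  then have "((\<lambda>t. - f (y + t) + (1/2 - t) * f' (y + t)) has_integral (1/2 - 1) * f (y + 1) - (1/2 - 0) * f (y + 0)) {0..1}"
    by (rule has_integral_FTC) simp
  moreover have "((\<lambda>t. f (y + t)) has_integral integral {0..1} f) {0..1}"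
    using integral_per1_shift[OF c f, of y]
    by (intro has_integral_integrable_integral[THEN iffD2] conjI integrable_continuous_interval continuous_on_compose2[OF c] continuous_intros) auto
  ultimately have "((\<lambda>t. (- f (y + t) + (1/2 - t) * f' (y + t)) + f (y + t)) has_integral ((1/2 - 1) * f (y + 1) - (1/2 - 0) * f (y + 0)) + integral {0..1} f) {0..1}"
    by (rule has_integral_add)
  then have "((\<lambda>t. (1/2 - t) * f' (y + t)) has_integral integral {0..1} f - f y) {0..1}"
    using f by (simp add: per1_def)
  then show ?thesis unfolding sawconv_def by (rule integral_unique)
qed

text \<open>The kernel is at most \<open>1/2\<close> in modulus. Taking a constant for
  \<open>g\<close> yields a sup bound, and \<open>g = f\<close> for nonnegative \<open>f\<close> a
  bound by the integral of \<open>f\<close>; both are used.\<close>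

lemma sawconv_bound:
  assumes "continuous_on UNIV f" "\<And>t. \<bar>f t\<bar> \<le> g t" "continuous_on UNIV g" "per1 g"
  shows "\<bar>sawconv f y\<bar> \<le> integral {0..1} g / 2"
proof -
  have "\<bar>sawconv f y\<bar> \<le> integral {0..1} (\<lambda>t. 1/2 * g (y + t))"
    unfolding sawconv_def real_norm_def[symmetric]
  proof (rule integral_norm_bound_integral)
    show "norm ((1/2 - t) * f (y + t)) \<le> 1/2 * g (y + t)" if "t \<in> {0..1}" for t
    proof -
      have "\<bar>1/2 - t\<bar> \<le> 1/2" using that by (auto simp: abs_if)
      then show ?thesis unfolding norm_mult using assms(2)[of "y + t"] by (intro mult_mono) auto
    qed
  qed (intro integrable_continuous_interval continuous_intros continuous_on_compose2[OF assms(1)] continuous_on_compose2[OF assms(3)]; simp)+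
  also have "\<dots> = integral {0..1} g / 2"
    using integral_per1_shift[OF assms(3,4), of y] by simp
  finally show ?thesis .
qed

lemma sawconv_cmult: "sawconv (\<lambda>t. c * f t) y = c * sawconv f y"
  unfolding sawconv_def by (simp add: mult.left_commute)

lemma sawconv_add:
  assumes "continuous_on UNIV f" "continuous_on UNIV g"
  shows "sawconv (\<lambda>t. f t + g t) y = sawconv f y + sawconv g y"
  unfolding sawconv_def distrib_left
  by (intro integral_add integrable_continuous_interval continuous_intros continuous_on_compose2[OF assms(1)] continuous_on_compose2[OF assms(2)]) auto

section \<open>Averages and sawtooth convolution along vertical lines\<close>

definition vmean :: "(real \<times> real \<Rightarrow> real) \<Rightarrow> real \<Rightarrow> real" where
  "vmean \<phi> a = integral {0..1} (\<lambda>r. \<phi> (a, r))"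

definition vsaw :: "(real \<times> real \<Rightarrow> real) \<Rightarrow> real \<times> real \<Rightarrow> real" where
  "vsaw \<phi> y = sawconv (\<lambda>r. \<phi> (fst y, r)) (snd y)"

lemma slice_cont: "continuous_on UNIV \<phi> \<Longrightarrow> continuous_on A (\<lambda>r. \<phi> (a, r))" "continuous_on UNIV \<phi> \<Longrightarrow> continuous_on A (\<lambda>r. \<phi> (r, a))"
  for \<phi> :: "real \<times> real \<Rightarrow> real"
  by (rule continuous_on_compose2[where t=UNIV], assumption, (auto intro!: continuous_intros)[2])+

lemma slice_per1: "periodic \<phi> \<Longrightarrow> per1 (\<lambda>r. \<phi> (a, r))" "periodic \<phi> \<Longrightarrow> per1 (\<lambda>r. \<phi> (r, a))"
  unfolding periodic_def per1_def by (metis add_Pair add.right_neutral)+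

lemma vmean_cont:
  assumes "continuous_on UNIV \<phi>" shows "continuous_on A (vmean \<phi>)"
proof -
  have "continuous_on (UNIV \<times> cbox 0 1) (\<lambda>(a, r). \<phi> (a, r :: real))"
    using continuous_on_subset[OF assms] by (simp add: case_prod_unfold)
  from integral_continuous_on_param[OF this] show ?thesis
    unfolding vmean_def by (auto intro: continuous_on_subset)
qed

lemma vmean_per1: "periodic \<phi> \<Longrightarrow> per1 (vmean \<phi>)"
  using slice_per1(2)[of \<phi>] by (simp add: per1_def vmean_def)

lemma vsaw_cont:
  assumes "continuous_on UNIV \<phi>" shows "continuous_on A (vsaw \<phi>)"
proof -
  have "continuous_on (UNIV \<times> cbox 0 1) (\<lambda>(y, t). (1/2 - t) * \<phi> (fst y, snd y + t))"
    unfolding case_prod_unfold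
    by (intro continuous_intros continuous_on_compose2[OF assms]) auto
  from integral_continuous_on_param[OF this] show ?thesis
    unfolding vsaw_def sawconv_def by (auto intro: continuous_on_subset)
qed

lemma vsaw_periodic:
  assumes "periodic \<phi>" shows "periodic (vsaw \<phi>)"
proof -
  have "(\<lambda>r. \<phi> (a + 1, r)) = (\<lambda>r. \<phi> (a, r))" for a
    using slice_per1(2)[OF assms] by (auto simp: per1_def)
  moreover have "per1 (sawconv (\<lambda>r. \<phi> (a, r)))" for a
    by (intro sawconv_per1 slice_per1 assms)
  ultimately show ?thesis by (simp add: periodic_def vsaw_def per1_def)
qed

lemma vmean_deriv:
  assumes "C1grad \<psi> \<psi>1 \<psi>2"
  shows "(vmean \<psi> has_real_derivative vmean \<psi>1 a) (at a)"
proof -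
  note c = C1grad_cont[OF assms]
  have c1: "continuous_on UNIV \<psi>1" using assms by (simp add: C1grad_def)
  have "((\<lambda>x. integral (cbox 0 1) (\<lambda>t. \<psi> (x, t))) has_real_derivative integral (cbox 0 1) (\<lambda>t. \<psi>1 (a, t))) (at a within UNIV)"
  proof (rule leibniz_rule_field_derivative)
    show "((\<lambda>x. \<psi> (x, t)) has_real_derivative \<psi>1 (x, t)) (at x within UNIV)" for x t
      using C1grad_partial(1)[OF assms] by simp
    show "(\<lambda>t. \<psi> (x, t)) integrable_on cbox 0 1" for x
      by (intro integrable_continuous slice_cont c)
    show "continuous_on (UNIV \<times> cbox 0 1) (\<lambda>(x, t). \<psi>1 (x, t :: real))"
      using continuous_on_subset[OF c1] by (simp add: case_prod_unfold)
  qed auto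
  then show ?thesis by (simp add: vmean_def[abs_def])
qed

text \<open>The test function for \<open>stream_fun_deriv1\<close>: inserted in
  \<open>divergence_free\<close> it trades \<open>vsaw \<psi>1\<close> against the first component
  of \<open>b\<close> for \<open>\<psi> - vmean \<psi>\<close> against the second.\<close>

lemma vsaw_C1grad:
  assumes "C1grad \<psi> \<psi>1 \<psi>2"
  shows "C1grad (vsaw \<psi>) (vsaw \<psi>1) (\<lambda>y. vmean \<psi> (fst y) - \<psi> y)"
proof (rule C1gradI)
  note c = C1grad_cont[OF assms]
  have p: "periodic \<psi>" and c1: "continuous_on UNIV \<psi>1" using assms by (simp_all add: C1grad_def)
  show "periodic (vsaw \<psi>)" by (rule vsaw_periodic[OF p])
  show "continuous_on UNIV (vsaw \<psi>1)" by (rule vsaw_cont[OF c1])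
  show "continuous_on UNIV (\<lambda>y. vmean \<psi> (fst y) - \<psi> y)"
    by (intro continuous_intros c continuous_on_compose2[OF vmean_cont[OF c]]) auto
  fix a r
  show "((\<lambda>t. vsaw \<psi> (a, t)) has_real_derivative vmean \<psi> (fst (a, r)) - \<psi> (a, r)) (at r)"
    using sawconv_deriv[OF slice_cont(1)[OF c] slice_per1(1)[OF p]] by (simp add: vsaw_def vmean_def)
  have "((\<lambda>x. integral (cbox 0 1) (\<lambda>t. (1/2 - t) * \<psi> (x, r + t))) has_real_derivative integral (cbox 0 1) (\<lambda>t. (1/2 - t) * \<psi>1 (a, r + t))) (at a within UNIV)"
  proof (rule leibniz_rule_field_derivative)
    show "((\<lambda>x. (1/2 - t) * \<psi> (x, r + t)) has_real_derivative (1/2 - t) * \<psi>1 (x, r + t)) (at x within UNIV)" for x t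
      using DERIV_cmult[OF C1grad_partial(1)[OF assms]] by simp
    show "(\<lambda>t. (1/2 - t) * \<psi> (x, r + t)) integrable_on cbox 0 1" for x
      by (intro integrable_continuous continuous_intros continuous_on_compose2[OF c]) auto
    show "continuous_on (UNIV \<times> cbox 0 1) (\<lambda>(x, t). (1/2 - t) * \<psi>1 (x, r + t))"
      unfolding case_prod_unfold by (intro continuous_intros continuous_on_compose2[OF c1]) auto
  qed auto
  then show "((\<lambda>t. vsaw \<psi> (t, r)) has_real_derivative vsaw \<psi>1 (a, r)) (at a)"
    by (simp add: vsaw_def sawconv_def)
qed

lemma integral_unif_sq_iterated:
  assumes "continuous_on UNIV \<phi>"
  shows "(\<integral>x. \<phi> x \<partial>unif_sq) = integral {0..1} (vmean \<phi>)"
proof -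
  let ?K = "cbox (0,0) (1,1) :: (real \<times> real) set"
  have m: "\<phi> \<in> borel_measurable borel" by (rule borel_measurable_continuous_onI[OF assms])
  have "emeasure lborel (?K - unit_sq) = 0"
    using emeasure_Diff[of lborel unit_sq ?K] unit_sq_subset emeasure_unit_sq
    by (simp add: emeasure_lborel_cbox_eq Basis_prod_def)
  then have "?K - unit_sq \<in> null_sets lborel" by (auto simp: null_sets_def)
  then have "AE x in lborel. x \<notin> ?K - unit_sq" by (rule AE_not_in)
  then have "(LINT x:unit_sq|lborel. \<phi> x) = (LINT x:?K|lborel. \<phi> x)"
    unfolding set_lebesgue_integral_def
    by (intro integral_cong_AE) (use m unit_sq_subset in \<open>auto simp: indicator_def\<close>)
  also have "\<dots> = integral ?K \<phi>"
    by (intro set_borel_integral_eq_integral, unfold set_integrable_def)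
       (intro borel_integrable_compact compact_cbox continuous_on_subset[OF assms] subset_UNIV)
  also have "\<dots> = integral (cbox 0 1) (\<lambda>a. integral (cbox 0 1) (\<lambda>r. \<phi> (a, r)))"
    by (intro integral_prod_continuous continuous_on_subset[OF assms]) auto
  finally show ?thesis by (simp add: integral_unif_sq[OF m] vmean_def[abs_def])
qed

section \<open>The stream functional\<close>

lemma periodic_mult: "periodic f \<Longrightarrow> periodic g \<Longrightarrow> periodic (\<lambda>x. f x * g x)"
  by (simp add: periodic_def)

lemma lift1_cont: "continuous_on UNIV f \<Longrightarrow> continuous_on UNIV (\<lambda>y::real\<times>real. f (fst y))"
  "continuous_on UNIV f \<Longrightarrow> continuous_on UNIV (\<lambda>y::real\<times>real. f (snd y))"
  by (rule continuous_on_compose2[where t=UNIV], assumption, (auto intro!: continuous_intros)[2])+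

lemma lift1_periodic: "per1 f \<Longrightarrow> periodic (\<lambda>y. f (fst y))" "per1 f \<Longrightarrow> periodic (\<lambda>y. f (snd y))"
  by (simp_all add: per1_def periodic_def)

lemma sawconv_lift_C1grad:
  assumes "continuous_on UNIV f" "per1 f"
  shows "C1grad (\<lambda>y. sawconv f (fst y)) (\<lambda>y. integral {0..1} f - f (fst y)) (\<lambda>y. 0)"
    and "C1grad (\<lambda>y. sawconv f (snd y)) (\<lambda>y. 0) (\<lambda>y. integral {0..1} f - f (snd y))"
  using sawconv_deriv[OF assms]
  by (intro C1gradI continuous_intros lift1_cont lift1_periodic sawconv_per1 assms; simp)+

lemma vmean_deriv2_zero:
  assumes "C1grad \<psi> \<psi>1 \<psi>2" shows "vmean \<psi>2 a = 0"
  using integral_FTC[OF C1grad_partial(2)[OF assms], of 0 1] slice_per1(1)[of \<psi> a] assms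
  by (simp add: vmean_def per1_def C1grad_def) (metis add_0)

lemma vsaw_deriv2:
  assumes "C1grad \<psi> \<psi>1 \<psi>2" shows "vsaw \<psi>2 y = vmean \<psi> (fst y) - \<psi> y"
  using sawconv_of_deriv[OF C1grad_partial(2)[OF assms] slice_per1(1), of "fst y" "snd y"] assms
  by (simp add: vsaw_def vmean_def C1grad_def)

lemma vmean_add:
  "continuous_on UNIV \<phi> \<Longrightarrow> continuous_on UNIV \<psi> \<Longrightarrow> vmean (\<lambda>x. \<phi> x + \<psi> x) a = vmean \<phi> a + vmean \<psi> a"
  unfolding vmean_def by (intro integral_add integrable_continuous_interval slice_cont)

lemma vmean_cmult: "vmean (\<lambda>x. c * \<phi> x) a = c * vmean \<phi> a"
  by (simp add: vmean_def)

locale invariant_flow = torus_flow +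
  fixes \<mu> :: "(real \<times> real) measure"
  assumes \<mu>: "torus_prob \<mu>" and inv: "invariant_measure X \<mu>"
begin

sublocale prob_space \<mu>
  using torus_probD[OF \<mu>] by simp

lemma b_comp_bound: "\<bar>fst (b x)\<bar> \<le> M" "\<bar>snd (b x)\<bar> \<le> M"
  using b_bound[of x] norm_fst_le[of "fst (b x)" "snd (b x)"] norm_snd_le[of "snd (b x)" "fst (b x)"] by simp_all

lemma periodic_b_comp: "periodic (\<lambda>x. fst (b x))" "periodic (\<lambda>x. snd (b x))"
  using b_per by (simp_all add: periodic_def)

lemma integrable_b:
  assumes "continuous_on UNIV g" "periodic g"
  shows "integrable \<mu> (\<lambda>y. g y * fst (b y))" "integrable \<mu> (\<lambda>y. g y * snd (b y))"
  by (intro integrable_cont_periodic[OF \<mu>] continuous_intros b_cont assms periodic_mult periodic_b_comp)+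

lemma integrable_lift_b:
  assumes "continuous_on UNIV f" "per1 f"
  shows "integrable \<mu> (\<lambda>y. f (fst y) * fst (b y))" "integrable \<mu> (\<lambda>y. f (fst y) * snd (b y))"
    "integrable \<mu> (\<lambda>y. f (snd y) * fst (b y))" "integrable \<mu> (\<lambda>y. f (snd y) * snd (b y))"
  by (intro integrable_b lift1_cont lift1_periodic assms)+

lemma integrable_mean_b: "integrable \<mu> (\<lambda>y. fst (b y))" "integrable \<mu> (\<lambda>y. snd (b y))"
  using integrable_b[of "\<lambda>_. 1"] by (simp_all add: periodic_def)

lemma mean_comp: "(\<integral>y. fst (b y) \<partial>\<mu>) = fst (mean \<mu> b)" "(\<integral>y. snd (b y) \<partial>\<mu>) = snd (mean \<mu> b)"
  using integrable_cont_periodic[OF \<mu> b_cont b_per] by (simp_all add: mean_def)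

text \<open>The flux of \<open>b \<mu>\<close> through vertical lines does not depend on the line: a
  primitive of \<open>f\<close> minus its mean, depending on the first coordinate alone, is an
  admissible test function.\<close>

lemma integral_lift_fst:
  assumes "continuous_on UNIV f" "per1 f"
  shows "(\<integral>y. f (fst y) * fst (b y) \<partial>\<mu>) = fst (mean \<mu> b) * integral {0..1} f"
  using divergence_free[OF \<mu> inv sawconv_lift_C1grad(1)[OF assms]] integrable_lift_b(1)[OF assms] integrable_mean_b
  by (simp add: left_diff_distrib mean_comp mult.commute[of "fst (mean \<mu> b)"])

text \<open>The value at \<open>\<phi>\<close> of the stream function as a distribution: its convolution kernel is the sawtooth
  \<open>1/2 - t\<close>, whose derivative on the circle is \<open>\<delta>\<^sub>0 - 1\<close>, on vertical lines for \<open>b\<^sub>1 \<mu>\<close> and spread over the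
  torus for \<open>b\<^sub>2 \<mu>\<close>.\<close>
definition stream_fun :: "(real \<times> real \<Rightarrow> real) \<Rightarrow> real" where
  "stream_fun \<phi> = (\<integral>y. vsaw \<phi> y * fst (b y) \<partial>\<mu>) - (\<integral>y. sawconv (vmean \<phi>) (fst y) * snd (b y) \<partial>\<mu>)"

text \<open>A derivative in the vertical direction has zero vertical means, so the second term drops
  out, and the vertical sawtooth undoes the derivative up to \<open>vmean \<psi>\<close>, whose
  integral is a constant flux.\<close>

lemma stream_fun_deriv2:
  assumes "C1grad \<psi> \<psi>1 \<psi>2"
  shows "stream_fun \<psi>2 = fst (mean \<mu> b) * (\<integral>x. \<psi> x \<partial>unif_sq) - (\<integral>y. \<psi> y * fst (b y) \<partial>\<mu>)"
proof -
  note c = C1grad_cont[OF assms]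
  have p: "periodic \<psi>" using assms by (simp add: C1grad_def)
  have z: "vmean \<psi>2 = (\<lambda>a. 0)" using vmean_deriv2_zero[OF assms] by auto
  have "sawconv (\<lambda>a. 0) r = 0" for r by (simp add: sawconv_def)
  then have "stream_fun \<psi>2 = (\<integral>y. vmean \<psi> (fst y) * fst (b y) - \<psi> y * fst (b y) \<partial>\<mu>)"
    unfolding stream_fun_def z vsaw_deriv2[OF assms] by (simp add: left_diff_distrib)
  also have "\<dots> = (\<integral>y. vmean \<psi> (fst y) * fst (b y) \<partial>\<mu>) - (\<integral>y. \<psi> y * fst (b y) \<partial>\<mu>)"
    by (intro Bochner_Integration.integral_diff integrable_lift_b integrable_b c p vmean_cont vmean_per1)
  finally show ?thesis
    by (simp add: integral_lift_fst[OF vmean_cont[OF c] vmean_per1[OF p]] integral_unif_sq_iterated[OF c])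
qed

text \<open>Divergence freeness turns the vertical term into one with the second component of
  \<open>b\<close>; the vertical means arising there cancel against those of the horizontal
  term.\<close>

lemma stream_fun_deriv1:
  assumes "C1grad \<psi> \<psi>1 \<psi>2"
  shows "stream_fun \<psi>1 = (\<integral>y. \<psi> y * snd (b y) \<partial>\<mu>) - snd (mean \<mu> b) * (\<integral>x. \<psi> x \<partial>unif_sq)"
proof -
  note c = C1grad_cont[OF assms]
  have p: "periodic \<psi>" "periodic \<psi>1" and c1: "continuous_on UNIV \<psi>1"
    using assms C1grad_periodic[OF assms] by (simp_all add: C1grad_def)
  note i1 = integrable_b[OF vsaw_cont[OF c1] vsaw_periodic[OF p(2)]]
  note i2 = integrable_lift_b[OF vmean_cont[OF c] vmean_per1[OF p(1)]]
  note i3 = integrable_b[OF c p(1)]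
  have "(\<integral>y. vsaw \<psi>1 y * fst (b y) \<partial>\<mu>) + (\<integral>y. vmean \<psi> (fst y) * snd (b y) \<partial>\<mu>) - (\<integral>y. \<psi> y * snd (b y) \<partial>\<mu>) = 0"
    using divergence_free[OF \<mu> inv vsaw_C1grad[OF assms]] i1 i2 i3 by (simp add: left_diff_distrib)
  moreover have "(\<integral>y. sawconv (vmean \<psi>1) (fst y) * snd (b y) \<partial>\<mu>) =
      integral {0..1} (vmean \<psi>) * snd (mean \<mu> b) - (\<integral>y. vmean \<psi> (fst y) * snd (b y) \<partial>\<mu>)"
    unfolding sawconv_of_deriv[OF vmean_deriv[OF assms] vmean_per1[OF p(1)]]
    using i2 integrable_mean_b by (simp add: left_diff_distrib mean_comp)
  ultimately show ?thesis
    unfolding stream_fun_def integral_unif_sq_iterated[OF c] by (simp add: algebra_simps)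
qed

lemma stream_fun_add:
  assumes "continuous_on UNIV \<phi>" "periodic \<phi>" "continuous_on UNIV \<psi>" "periodic \<psi>"
  shows "stream_fun (\<lambda>x. \<phi> x + \<psi> x) = stream_fun \<phi> + stream_fun \<psi>"
proof -
  have v: "vsaw (\<lambda>x. \<phi> x + \<psi> x) y = vsaw \<phi> y + vsaw \<psi> y" for y
    unfolding vsaw_def by (intro sawconv_add slice_cont assms)
  have h: "sawconv (vmean (\<lambda>x. \<phi> x + \<psi> x)) r = sawconv (vmean \<phi>) r + sawconv (vmean \<psi>) r" for r
    unfolding vmean_add[OF assms(1,3), abs_def] by (intro sawconv_add vmean_cont assms)
  have s: "continuous_on UNIV (sawconv (vmean \<phi>))" "per1 (sawconv (vmean \<phi>))" if "continuous_on UNIV \<phi>" "periodic \<phi>" for \<phi>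
    by (intro sawconv_cont sawconv_per1 vmean_cont vmean_per1 that)+
  show ?thesis unfolding stream_fun_def v h distrib_right
    using integrable_b(1)[OF vsaw_cont[OF assms(1)] vsaw_periodic[OF assms(2)]]
      integrable_b(1)[OF vsaw_cont[OF assms(3)] vsaw_periodic[OF assms(4)]]
      integrable_lift_b(2)[OF s[OF assms(1,2)]] integrable_lift_b(2)[OF s[OF assms(3,4)]]
    by simp
qed

lemma stream_fun_cmult: "stream_fun (\<lambda>x. c * \<phi> x) = c * stream_fun \<phi>"
  by (simp add: stream_fun_def vsaw_def sawconv_cmult vmean_cmult[abs_def] mult.assoc right_diff_distrib)

lemma abs_integral_b_le:
  assumes "continuous_on UNIV g" "periodic g" "continuous_on UNIV h" "periodic h" "\<And>y. \<bar>g y\<bar> \<le> h y"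
  shows "\<bar>\<integral>y. g y * fst (b y) \<partial>\<mu>\<bar> \<le> M * (\<integral>y. h y \<partial>\<mu>)" "\<bar>\<integral>y. g y * snd (b y) \<partial>\<mu>\<bar> \<le> M * (\<integral>y. h y \<partial>\<mu>)"
proof -
  have h0: "0 \<le> h y" for y using assms(5)[of y] by linarith
  have ih: "integrable \<mu> (\<lambda>y. M * h y)" using integrable_cont_periodic[OF \<mu> assms(3,4)] by simp
  have pt: "\<bar>g y * c\<bar> \<le> M * h y" if "\<bar>c\<bar> \<le> M" for y c
    unfolding abs_mult using assms(5)[of y] h0[of y] that M_pos by (subst mult.commute) (intro mult_mono, auto)
  have "\<bar>\<integral>y. g y * fst (b y) \<partial>\<mu>\<bar> \<le> (\<integral>y. M * h y \<partial>\<mu>)"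
    by (intro integral_abs_bound[THEN order_trans] integral_mono integrable_abs integrable_b assms ih pt b_comp_bound)
  then show "\<bar>\<integral>y. g y * fst (b y) \<partial>\<mu>\<bar> \<le> M * (\<integral>y. h y \<partial>\<mu>)" by simp
  have "\<bar>\<integral>y. g y * snd (b y) \<partial>\<mu>\<bar> \<le> (\<integral>y. M * h y \<partial>\<mu>)"
    by (intro integral_abs_bound[THEN order_trans] integral_mono integrable_abs integrable_b assms ih pt b_comp_bound)
  then show "\<bar>\<integral>y. g y * snd (b y) \<partial>\<mu>\<bar> \<le> M * (\<integral>y. h y \<partial>\<mu>)" by simp
qed

text \<open>Continuity in the sup norm, which allows a test function to be replaced by its grid
  approximation.\<close>

lemma stream_fun_sup_bound:
  assumes "continuous_on UNIV \<phi>" "periodic \<phi>" "\<And>x. \<bar>\<phi> x\<bar> \<le> e"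
  shows "\<bar>stream_fun \<phi>\<bar> \<le> M * e"
proof -
  have v: "\<bar>vsaw \<phi> y\<bar> \<le> e / 2" for y
    using sawconv_bound[of "\<lambda>r. \<phi> (fst y, r)" "\<lambda>_. e"] slice_cont(1)[OF assms(1)] assms(3)
    by (simp add: vsaw_def per1_def)
  have vm: "\<bar>vmean \<phi> a\<bar> \<le> e" for a
  proof -
    have "norm (integral {0..1} (\<lambda>r. \<phi> (a, r))) \<le> integral {0..1} (\<lambda>r::real. e)"
      by (rule Henstock_Kurzweil_Integration.integral_norm_bound_integral)
        (use assms(3) in \<open>auto intro!: integrable_continuous_interval slice_cont assms(1)\<close>)
    then show ?thesis by (simp add: vmean_def)
  qed
  have h: "\<bar>sawconv (vmean \<phi>) r\<bar> \<le> e / 2" for r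
    using sawconv_bound[of "vmean \<phi>" "\<lambda>_. e" r] vmean_cont[OF assms(1)] vm by (simp add: per1_def)
  have "\<bar>\<integral>y. vsaw \<phi> y * fst (b y) \<partial>\<mu>\<bar> \<le> M * (\<integral>y. e / 2 \<partial>\<mu>)"
    by (intro abs_integral_b_le vsaw_cont vsaw_periodic assms v) (auto simp: periodic_def per1_def)
  moreover have "\<bar>\<integral>y. sawconv (vmean \<phi>) (fst y) * snd (b y) \<partial>\<mu>\<bar> \<le> M * (\<integral>y. e / 2 \<partial>\<mu>)"
    by (intro abs_integral_b_le lift1_cont lift1_periodic sawconv_cont sawconv_per1 vmean_cont vmean_per1 assms h) (auto simp: periodic_def per1_def)
  ultimately show ?thesis unfolding stream_fun_def by (simp add: prob_space)
qed

text \<open>The second formula has the singular kernel in the other coordinate. The difference of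
  the two is the integral of \<open>b\<close> against the gradient of
  \<open>sawconv f \<otimes> sawconv g\<close>, which vanishes by divergence freeness.\<close>

lemma stream_fun_prod:
  assumes f: "continuous_on UNIV f" "per1 f" and g: "continuous_on UNIV g" "per1 g"
  shows "stream_fun (\<lambda>x. f (fst x) * g (snd x)) =
      (\<integral>y. f (fst y) * sawconv g (snd y) * fst (b y) \<partial>\<mu>)
      - integral {0..1} g * (\<integral>y. sawconv f (fst y) * snd (b y) \<partial>\<mu>)" (is "_ = ?A")
    and "stream_fun (\<lambda>x. f (fst x) * g (snd x)) =
      integral {0..1} f * (\<integral>y. sawconv g (snd y) * fst (b y) \<partial>\<mu>)
      - (\<integral>y. sawconv f (fst y) * g (snd y) * snd (b y) \<partial>\<mu>)" (is "_ = ?B")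
proof -
  let ?\<phi> = "\<lambda>x. f (fst x) * g (snd x)"
  have v: "vsaw ?\<phi> y = f (fst y) * sawconv g (snd y)" for y
    unfolding vsaw_def by (simp add: sawconv_cmult)
  have h: "vmean ?\<phi> = (\<lambda>a. integral {0..1} g * f a)" by (auto simp: vmean_def)
  show A: "stream_fun ?\<phi> = ?A"
    unfolding stream_fun_def v h by (simp add: sawconv_cmult mult.assoc)
  let ?W = "\<lambda>y. sawconv f (fst y) * sawconv g (snd y)"
  note Sf = sawconv_cont[OF f, of UNIV] sawconv_per1[OF f(2)]
  note Sg = sawconv_cont[OF g, of UNIV] sawconv_per1[OF g(2)]
  have W: "C1grad ?W (\<lambda>y. (integral {0..1} f - f (fst y)) * sawconv g (snd y))
     (\<lambda>y. sawconv f (fst y) * (integral {0..1} g - g (snd y)))"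
    by (intro C1gradI continuous_intros lift1_cont lift1_periodic periodic_mult f g Sf Sg)
      (auto intro!: derivative_eq_intros sawconv_deriv[OF f] sawconv_deriv[OF g])
  have p: "periodic (\<lambda>y. f (fst y))" "periodic (\<lambda>y. g (snd y))" "periodic (\<lambda>y. sawconv f (fst y))" "periodic (\<lambda>y. sawconv g (snd y))"
    by (intro lift1_periodic f g Sf Sg)+
  have c: "continuous_on UNIV (\<lambda>y::real\<times>real. f (fst y))" "continuous_on UNIV (\<lambda>y::real\<times>real. g (snd y))"
    "continuous_on UNIV (\<lambda>y::real\<times>real. sawconv f (fst y))" "continuous_on UNIV (\<lambda>y::real\<times>real. sawconv g (snd y))"
    by (intro lift1_cont f g Sf Sg)+
  have i: "integrable \<mu> (\<lambda>y. sawconv g (snd y) * fst (b y))" "integrable \<mu> (\<lambda>y. f (fst y) * sawconv g (snd y) * fst (b y))"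
    "integrable \<mu> (\<lambda>y. sawconv f (fst y) * snd (b y))" "integrable \<mu> (\<lambda>y. sawconv f (fst y) * g (snd y) * snd (b y))"
    by (intro integrable_b p c periodic_mult continuous_intros)+
  have "integral {0..1} f * (\<integral>y. sawconv g (snd y) * fst (b y) \<partial>\<mu>) - (\<integral>y. f (fst y) * sawconv g (snd y) * fst (b y) \<partial>\<mu>)
      + (integral {0..1} g * (\<integral>y. sawconv f (fst y) * snd (b y) \<partial>\<mu>) - (\<integral>y. sawconv f (fst y) * g (snd y) * snd (b y) \<partial>\<mu>))
     = (\<integral>y. (integral {0..1} f * (sawconv g (snd y) * fst (b y)) - f (fst y) * sawconv g (snd y) * fst (b y))
      + (integral {0..1} g * (sawconv f (fst y) * snd (b y)) - sawconv f (fst y) * g (snd y) * snd (b y)) \<partial>\<mu>)"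
    using i by simp
  also have "\<dots> = (\<integral>y. (integral {0..1} f - f (fst y)) * sawconv g (snd y) * fst (b y)
      + sawconv f (fst y) * (integral {0..1} g - g (snd y)) * snd (b y) \<partial>\<mu>)"
    by (rule Bochner_Integration.integral_cong) (simp_all add: algebra_simps)
  also have "\<dots> = 0"
    by (rule divergence_free[OF \<mu> inv W])
  finally show "stream_fun ?\<phi> = ?B" using A by linarith
qed

text \<open>In the first form of \<open>stream_fun_prod\<close> the factor \<open>g\<close> enters
  through its sawtooth and its integral only, hence through its integral; in the second form
  \<open>f\<close> does. What remains of \<open>\<mu>\<close> is one marginal in each case.\<close>

lemma stream_fun_prod_bound:
  assumes f: "continuous_on UNIV f" "per1 f" "\<And>t. f t \<ge> 0" and g: "continuous_on UNIV g" "per1 g" "\<And>t. g t \<ge> 0"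
  shows "\<bar>stream_fun (\<lambda>x. f (fst x) * g (snd x))\<bar> \<le> M / 2 * integral {0..1} g * ((\<integral>y. f (fst y) \<partial>\<mu>) + integral {0..1} f)"
    and "\<bar>stream_fun (\<lambda>x. f (fst x) * g (snd x))\<bar> \<le> M / 2 * integral {0..1} f * ((\<integral>y. g (snd y) \<partial>\<mu>) + integral {0..1} g)"
proof -
  note Sf = sawconv_cont[OF f(1,2), of UNIV] sawconv_per1[OF f(2)]
  note Sg = sawconv_cont[OF g(1,2), of UNIV] sawconv_per1[OF g(2)]
  have bf: "\<bar>sawconv f y\<bar> \<le> integral {0..1} f / 2" for y using sawconv_bound[OF f(1) _ f(1,2)] f(3) by simp
  have bg: "\<bar>sawconv g y\<bar> \<le> integral {0..1} g / 2" for y using sawconv_bound[OF g(1) _ g(1,2)] g(3) by simp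
  have I0: "integral {0..1} f \<ge> 0" "integral {0..1} g \<ge> 0" using bf[of 0] bg[of 0] by linarith+
  have pc: "periodic (\<lambda>_. c)" for c :: real by (simp add: periodic_def)
  have "\<bar>f (fst y) * sawconv g (snd y)\<bar> \<le> f (fst y) * (integral {0..1} g / 2)" for y
    using mult_left_mono[OF bg[of "snd y"] f(3)[of "fst y"]] f(3)[of "fst y"] by (simp add: abs_mult)
  then have 1: "\<bar>\<integral>y. f (fst y) * sawconv g (snd y) * fst (b y) \<partial>\<mu>\<bar> \<le> M * (\<integral>y. f (fst y) * (integral {0..1} g / 2) \<partial>\<mu>)"
    by (intro abs_integral_b_le continuous_intros lift1_cont periodic_mult pc lift1_periodic f g Sf Sg)
  have 2: "\<bar>\<integral>y. sawconv f (fst y) * snd (b y) \<partial>\<mu>\<bar> \<le> M * (\<integral>y. integral {0..1} f / 2 \<partial>\<mu>)"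
    using bf by (intro abs_integral_b_le continuous_intros lift1_cont lift1_periodic periodic_mult f g Sf Sg)
      (auto simp: periodic_def per1_def)
  have "\<bar>integral {0..1} g * (\<integral>y. sawconv f (fst y) * snd (b y) \<partial>\<mu>)\<bar> \<le> integral {0..1} g * (M * (\<integral>y. integral {0..1} f / 2 \<partial>\<mu>))"
    unfolding abs_mult using 2 I0 by (intro mult_mono) auto
  then show "\<bar>stream_fun (\<lambda>x. f (fst x) * g (snd x))\<bar> \<le> M / 2 * integral {0..1} g * ((\<integral>y. f (fst y) \<partial>\<mu>) + integral {0..1} f)"
    using 1 unfolding stream_fun_prod(1)[OF f(1,2) g(1,2)] by (simp add: prob_space algebra_simps)
  have "\<bar>sawconv f (fst y) * g (snd y)\<bar> \<le> (integral {0..1} f / 2) * g (snd y)" for y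
    using mult_right_mono[OF bf[of "fst y"] g(3)[of "snd y"]] g(3)[of "snd y"] by (simp add: abs_mult)
  then have 1: "\<bar>\<integral>y. sawconv f (fst y) * g (snd y) * snd (b y) \<partial>\<mu>\<bar> \<le> M * (\<integral>y. (integral {0..1} f / 2) * g (snd y) \<partial>\<mu>)"
    by (intro abs_integral_b_le continuous_intros lift1_cont periodic_mult pc lift1_periodic f g Sf Sg)
  have 2: "\<bar>\<integral>y. sawconv g (snd y) * fst (b y) \<partial>\<mu>\<bar> \<le> M * (\<integral>y. integral {0..1} g / 2 \<partial>\<mu>)"
    using bg by (intro abs_integral_b_le continuous_intros lift1_cont lift1_periodic periodic_mult f g Sf Sg)
      (auto simp: periodic_def per1_def)
  have "\<bar>integral {0..1} f * (\<integral>y. sawconv g (snd y) * fst (b y) \<partial>\<mu>)\<bar> \<le> integral {0..1} f * (M * (\<integral>y. integral {0..1} g / 2 \<partial>\<mu>))"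
    unfolding abs_mult using 2 I0 by (intro mult_mono) auto
  then show "\<bar>stream_fun (\<lambda>x. f (fst x) * g (snd x))\<bar> \<le> M / 2 * integral {0..1} f * ((\<integral>y. g (snd y) \<partial>\<mu>) + integral {0..1} g)"
    using 1 unfolding stream_fun_prod(2)[OF f(1,2) g(1,2)] by (simp add: prob_space algebra_simps)
qed

end

section \<open>Partition of unity on the torus and the square-integrable bound\<close>

text \<open>\<open>arccos (cos (2 * pi * t)) / (2 * pi)\<close> is the distance from
  \<open>t\<close> to the nearest integer. Writing it through the cosine makes the hat periodic and
  continuous at once, and later open to polynomial approximation in \<open>cos\<close>.\<close>

definition tent :: "nat \<Rightarrow> real \<Rightarrow> real" where
  "tent N t = max 0 (1 - real N * (arccos (cos (2 * pi * t)) / (2 * pi)))"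

lemma tent_nonneg: "tent N t \<ge> 0"
  by (simp add: tent_def)

lemma tent_cont: "continuous_on A (tent N)"
  unfolding tent_def
  by (rule continuous_intros continuous_on_compose2[OF continuous_on_arccos'] | simp)+

lemma cos_2pi_int: "cos (2 * pi * (t + of_int n)) = cos (2 * pi * t)"
proof -
  have "2 * pi * (t + of_int n) = 2 * pi * t + (2 * pi) * of_int n" by (simp add: algebra_simps)
  then show ?thesis by (simp add: cos_add)
qed

lemma tent_int: "tent N (t + of_int n) = tent N t"
  by (simp only: tent_def cos_2pi_int)

lemma tent_per1: "per1 (\<lambda>t. tent N (t - c))"
  unfolding per1_def
proof
  fix t show "tent N (t + 1 - c) = tent N (t - c)"
    using tent_int[of N "t - c" 1] by (simp add: algebra_simps)
qed

lemma tent_small: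
  assumes "\<bar>t\<bar> \<le> 1/2" shows "tent N t = max 0 (1 - real N * \<bar>t\<bar>)"
proof -
  have "cos (2 * pi * t) = cos (2 * pi * \<bar>t\<bar>)" by (simp add: abs_if)
  moreover have "2 * pi * \<bar>t\<bar> \<le> pi" using assms mult_left_mono[of "\<bar>t\<bar>" "1/2" "2*pi"] by simp
  ultimately have "arccos (cos (2 * pi * t)) = 2 * pi * \<bar>t\<bar>" by (simp add: arccos_cos)
  then show ?thesis by (simp add: tent_def)
qed

lemma tent_near:
  assumes "tent N t \<noteq> 0" "N > 0"
  obtains n :: int where "\<bar>t - of_int n\<bar> < 1 / real N"
proof -
  have "tent N (t - of_int (round t)) = tent N t" using tent_int[of N t "- round t"] by simp
  moreover have "\<bar>t - of_int (round t)\<bar> \<le> 1/2" using of_int_round_abs_le[of t] by (simp add: abs_minus_commute)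
  ultimately have "1 - real N * \<bar>t - of_int (round t)\<bar> > 0"
    using tent_small[of "t - of_int (round t)" N] assms(1) by (auto simp: max_def split: if_splits)
  then show ?thesis using that[of "round t"] assms(2) by (simp add: field_simps)
qed

text \<open>The sum has period \<open>1 / N\<close>, so it suffices to look at
  \<open>[0, 1 / N)\<close>, where only the hats at nodes 0 and 1 are active, with values
  \<open>1 - N * t\<close> and \<open>N * t\<close>.\<close>

lemma tent_sum:
  assumes "N \<ge> 2"
  shows "(\<Sum>i<N. tent N (t - real i / real N)) = 1"
proof -
  define f where "f t = (\<Sum>i<N. tent N (t - real i / real N))" for t
  obtain m where m: "N = Suc m" using assms by (cases N) auto
  have set: "{..<N} = {..<Suc m}" by (simp add: m)
  have N0: "real N > 0" using assms by simp
  have f1: "f (t + 1 / real N) = f t" for t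
  proof -
    have "f (t + 1 / real N) = tent N (t + 1 / real N) + (\<Sum>i<m. tent N (t + 1 / real N - real (Suc i) / real N))"
      unfolding f_def set sum.lessThan_Suc_shift by simp
    \<comment> \<open>Shifting by one mesh width permutes the nodes cyclically: the first hat
      becomes the last one, up to the period 1.\<close>
    also have "tent N (t + 1 / real N) = tent N (t - real m / real N)"
    proof -
      have "t - real m / real N + of_int 1 = t + 1 / real N" using N0 m by (simp add: field_simps)
      then show ?thesis using tent_int[of N "t - real m / real N" 1] by metis
    qed
    also have "(\<Sum>i<m. tent N (t + 1 / real N - real (Suc i) / real N)) = (\<Sum>i<m. tent N (t - real i / real N))"
      by (simp add: add_divide_distrib)
    finally show ?thesis unfolding f_def set by simp
  qed
  have fk: "f (t + of_int k / real N) = f t" for k :: int and t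
  proof (induction k rule: int_induct[where k=0])
    case base then show ?case by simp
  next
    case (step1 i)
    have "t + of_int (i + 1) / real N = (t + of_int i / real N) + 1 / real N" by (simp add: add_divide_distrib)
    then show ?case using f1 step1 by metis
  next
    case (step2 i)
    have "(t + of_int (i - 1) / real N) + 1 / real N = t + of_int i / real N" by (simp add: diff_divide_distrib)
    then show ?case using f1 step2 by metis
  qed
  have base: "f t = 1" if t: "0 \<le> t" "t < 1 / real N" for t
  proof -
    have N2: "1 / real N \<le> 1/2" using assms by (simp add: field_simps)
    \<comment> \<open>If such a hat were active, the integer \<open>n\<close> near
      \<open>t - i / N\<close> would lie strictly between -1 and 0.\<close>
    have z: "tent N (t - real i / real N) = 0" if i: "i \<in> {2..<N}" for i
    proof (rule ccontr)
      assume "tent N (t - real i / real N) \<noteq> 0"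
      then obtain n :: int where n: "\<bar>t - real i / real N - of_int n\<bar> < 1 / real N"
        using tent_near assms by (metis zero_less_numeral order_less_le_trans)
      have a: "real i / real N \<ge> 2 / real N" using i N0 by (intro divide_right_mono) auto
      have "real i + 1 \<le> real N" using i by auto
      then have "(real i + 1) / real N \<le> real N / real N" using N0 by (intro divide_right_mono) auto
      then have b: "real i / real N + 1 / real N \<le> 1" using N0 by (simp add: add_divide_distrib)
      have "of_int n < (0::real)" using n t a by (auto simp: abs_less_iff add_divide_distrib)
      moreover have "of_int n > (-1::real)" using n t b by (simp add: abs_less_iff)
      moreover from this have "of_int (-1) < (of_int n :: real)" by simp
      ultimately show False by (simp only: of_int_less_iff of_int_less_0_iff)
    qed
    have "{..<N} = {0, 1} \<union> {2..<N}" using assms by auto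
    then have "f t = tent N t + tent N (t - 1 / real N) + (\<Sum>i\<in>{2..<N}. tent N (t - real i / real N))"
      unfolding f_def by (simp add: sum.union_disjoint)
    also have "(\<Sum>i\<in>{2..<N}. tent N (t - real i / real N)) = 0" using z by (intro sum.neutral) auto
    also have "tent N t = 1 - real N * t"
    proof -
      have "\<bar>t\<bar> \<le> 1/2" using t N2 by linarith
      moreover have "real N * \<bar>t\<bar> \<le> 1" using t N0 by (simp add: field_simps)
      ultimately show ?thesis using t by (simp add: tent_small max_def)
    qed
    also have "tent N (t - 1 / real N) = real N * t"
    proof -
      have a: "\<bar>t - 1 / real N\<bar> = 1 / real N - t" using t by linarith
      have "\<bar>t - 1 / real N\<bar> \<le> 1/2" unfolding a using t N2 by linarith
      moreover have "1 - real N * \<bar>t - 1 / real N\<bar> = real N * t" unfolding a using N0 by (simp add: field_simps)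
      ultimately show ?thesis using t N0 by (simp add: tent_small)
    qed
    finally show ?thesis by simp
  qed
  let ?k = "\<lfloor>t * real N\<rfloor>"
  have "f t = f (t - of_int ?k / real N + of_int ?k / real N)" by simp
  also have "\<dots> = f (t - of_int ?k / real N)" by (rule fk)
  also have "\<dots> = 1"
  proof (rule base)
    have "of_int ?k \<le> t * real N" "t * real N < of_int ?k + 1" by linarith+
    then have "of_int ?k / real N \<le> t" "t < (of_int ?k + 1) / real N"
      using N0 by (simp_all only: pos_divide_le_eq pos_less_divide_eq)
    then show "0 \<le> t - of_int ?k / real N" "t - of_int ?k / real N < 1 / real N"
      unfolding add_divide_distrib by linarith+
  qed
  finally show ?thesis by (simp add: f_def)
qed

definition nodefun :: "nat \<Rightarrow> nat \<Rightarrow> real \<Rightarrow> real" where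
  "nodefun N i t = tent N (t - real i / real N)"

lemma nodefun_cont: "continuous_on A (nodefun N i)"
  unfolding nodefun_def by (intro continuous_on_compose2[OF tent_cont[of UNIV]] continuous_intros) auto

lemma nodefun_per1: "per1 (nodefun N i)"
  using tent_per1 by (simp add: nodefun_def[abs_def])

lemma nodefun_nonneg: "nodefun N i t \<ge> 0"
  by (simp add: nodefun_def tent_nonneg)

lemma nodefun_sum: "N \<ge> 2 \<Longrightarrow> (\<Sum>i<N. nodefun N i t) = 1"
  by (simp add: nodefun_def tent_sum)

text \<open>All hats are translates and have the same integral; the \<open>N\<close> of them sum to
  1.\<close>

lemma nodefun_integral:
  assumes "N \<ge> 2" shows "integral {0..1} (nodefun N i) = 1 / real N"
proof -
  have eq: "integral {0..1} (nodefun N i) = integral {0..1} (tent N)" for i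
    using integral_per1_shift[OF tent_cont, of N "- (real i / real N)"] tent_per1[of N 0]
    by (simp add: nodefun_def[abs_def])
  have "(\<Sum>i<N. integral {0..1} (nodefun N i)) = integral {0..1} (\<lambda>t. \<Sum>i<N. nodefun N i t)"
    by (intro Henstock_Kurzweil_Integration.integral_sum[symmetric] integrable_continuous_interval nodefun_cont) auto
  also have "\<dots> = 1" using nodefun_sum[OF assms] by simp
  finally have "real N * integral {0..1} (tent N) = 1" by (simp add: eq)
  then show ?thesis using assms by (simp add: eq field_simps)
qed

definition cellfun :: "nat \<Rightarrow> nat \<times> nat \<Rightarrow> real \<times> real \<Rightarrow> real" where
  "cellfun N k x = nodefun N (fst k) (fst x) * nodefun N (snd k) (snd x)"

abbreviation cells :: "nat \<Rightarrow> (nat \<times> nat) set" where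
  "cells N \<equiv> {..<N} \<times> {..<N}"

lemma cellfun_cont: "continuous_on A (cellfun N k)"
  unfolding cellfun_def by (intro continuous_intros continuous_on_compose2[OF nodefun_cont[of UNIV]]) auto

lemma cellfun_periodic: "periodic (cellfun N k)"
  using nodefun_per1[of N] by (simp add: periodic_def per1_def cellfun_def)

lemma cellfun_nonneg: "cellfun N k x \<ge> 0"
  by (simp add: cellfun_def nodefun_nonneg)

lemma sum_cells: "(\<Sum>k\<in>cells N. f (fst k) * g (snd k)) = (\<Sum>i<N. f i) * (\<Sum>j<N. g j)" for f g :: "nat \<Rightarrow> real"
  by (simp add: sum_product sum.cartesian_product case_prod_unfold)

lemma cellfun_sum: "N \<ge> 2 \<Longrightarrow> (\<Sum>k\<in>cells N. cellfun N k x) = 1"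
  using sum_cells[where f = "\<lambda>i. nodefun N i (fst x)" and g = "\<lambda>j. nodefun N j (snd x)" and N = N]
  by (simp add: cellfun_def nodefun_sum)

lemma cellfun_integral: "N \<ge> 2 \<Longrightarrow> (\<integral>x. cellfun N k x \<partial>unif_sq) = 1 / (real N)\<^sup>2"
  by (subst integral_unif_sq_iterated[OF cellfun_cont])
    (simp add: vmean_def[abs_def] cellfun_def nodefun_integral power2_eq_square)

text \<open>Each factor vanishes outside distance \<open>1 / N\<close> from its node modulo
  integers, so two points of one cell differ by less than \<open>2 / N\<close> in each coordinate,
  modulo the lattice.\<close>

lemma cellfun_near:
  assumes "cellfun N k x \<noteq> 0" "cellfun N k z \<noteq> 0" "N \<ge> 2"
  obtains m n :: int where "norm (x - (z + (of_int m, of_int n))) < 4 / real N"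
proof -
  have N0: "N > 0" using assms(3) by simp
  have "\<exists>m::int. \<bar>s - t - of_int m\<bar> < 2 / real N" if nz: "nodefun N i s \<noteq> 0" "nodefun N i t \<noteq> 0" for i s t
  proof -
    obtain p where p: "\<bar>s - real i / real N - of_int p\<bar> < 1 / real N"
      using tent_near[OF nz(1)[unfolded nodefun_def] N0] by blast
    obtain q where q: "\<bar>t - real i / real N - of_int q\<bar> < 1 / real N"
      using tent_near[OF nz(2)[unfolded nodefun_def] N0] by blast
    have "\<bar>s - t - of_int (p - q)\<bar> < 1 / real N + 1 / real N" using p q by (simp add: abs_less_iff)
    then show ?thesis by (intro exI[of _ "p - q"]) simp
  qed
  then obtain m n :: int where "\<bar>fst x - fst z - of_int m\<bar> < 2 / real N" "\<bar>snd x - snd z - of_int n\<bar> < 2 / real N"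
    using assms(1,2) unfolding cellfun_def by (metis mult_zero_left mult_zero_right)
  moreover have "norm (x - (z + (of_int m, of_int n))) \<le> \<bar>fst x - fst z - of_int m\<bar> + \<bar>snd x - snd z - of_int n\<bar>"
    using norm_Pair_le[of "fst x - fst z - of_int m" "snd x - snd z - of_int n"]
    by (cases x, cases z) (simp add: diff_diff_eq)
  ultimately show ?thesis using that[of m n] by simp
qed

text \<open>The average of \<open>\<phi>\<close> with weight \<open>cellfun N k\<close>: the factor
  is the inverse of the mass computed in \<open>cellfun_integral\<close>.\<close>

definition cellcoef :: "nat \<Rightarrow> (real \<times> real \<Rightarrow> real) \<Rightarrow> nat \<times> nat \<Rightarrow> real" where
  "cellcoef N \<phi> k = (real N)\<^sup>2 * (\<integral>x. \<phi> x * cellfun N k x \<partial>unif_sq)"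

definition cellapprox :: "nat \<Rightarrow> (real \<times> real \<Rightarrow> real) \<Rightarrow> real \<times> real \<Rightarrow> real" where
  "cellapprox N \<phi> x = (\<Sum>k\<in>cells N. cellcoef N \<phi> k * cellfun N k x)"

lemma integrable_cell:
  assumes "continuous_on UNIV \<phi>" "periodic \<phi>"
  shows "integrable unif_sq (\<lambda>x. \<phi> x * cellfun N k x)"
  using assms cellfun_periodic[of N k]
  by (intro integrable_cont_periodic[OF torus_prob_unif_sq] continuous_intros cellfun_cont) (auto simp: periodic_def)

text \<open>Each coefficient is an average over one cell modulo the lattice, where
  \<open>\<phi>\<close> varies by at most \<open>e\<close>, and the cells sum to 1.\<close>

lemma cellapprox_close:
  assumes \<phi>: "continuous_on UNIV \<phi>" "periodic \<phi>" and N: "N \<ge> 2" "4 / real N \<le> d"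
    and d: "\<And>x y. norm (x - y) < d \<Longrightarrow> \<bar>\<phi> x - \<phi> y\<bar> \<le> e"
  shows "\<bar>\<phi> x - cellapprox N \<phi> x\<bar> \<le> e"
proof -
  have N0: "real N > 0" using N by simp
  have d0: "d > 0" using N N0 by (smt (verit) divide_pos_pos)
  have e0: "e \<ge> 0" using d[of 0 0] d0 by simp
  have one: "integrable unif_sq (\<lambda>z. c * cellfun N k z)" for c k
    using integrable_cell[of "\<lambda>_. c" N k] by (simp add: periodic_def)
  have coef: "\<bar>\<phi> x - cellcoef N \<phi> k\<bar> \<le> e" if nz: "cellfun N k x \<noteq> 0" for k
  proof -
    have "\<phi> x = (real N)\<^sup>2 * (\<integral>z. \<phi> x * cellfun N k z \<partial>unif_sq)"
      using N0 by (simp add: cellfun_integral[OF N(1)])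
    then have "\<phi> x - cellcoef N \<phi> k = (real N)\<^sup>2 * (\<integral>z. \<phi> x * cellfun N k z - \<phi> z * cellfun N k z \<partial>unif_sq)"
      unfolding cellcoef_def using one integrable_cell[OF \<phi>] by (simp add: right_diff_distrib)
    then have "\<bar>\<phi> x - cellcoef N \<phi> k\<bar> = (real N)\<^sup>2 * \<bar>\<integral>z. \<phi> x * cellfun N k z - \<phi> z * cellfun N k z \<partial>unif_sq\<bar>"
      by (simp add: abs_mult)
    also have "\<dots> \<le> (real N)\<^sup>2 * (\<integral>z. e * cellfun N k z \<partial>unif_sq)"
    proof (intro mult_left_mono integral_abs_bound[THEN order_trans] integral_mono integrable_abs Bochner_Integration.integrable_diff one integrable_cell \<phi>)
      fix z
      show "\<bar>\<phi> x * cellfun N k z - \<phi> z * cellfun N k z\<bar> \<le> e * cellfun N k z"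
      proof (cases "cellfun N k z = 0")
        case False
        obtain m n :: int where mn: "norm (x - (z + (of_int m, of_int n))) < 4 / real N"
          using cellfun_near[OF nz False N(1)] by metis
        have "\<bar>\<phi> x - \<phi> (z + (of_int m, of_int n))\<bar> \<le> e" using mn N(2) by (intro d) simp
        then have "\<bar>\<phi> x - \<phi> z\<bar> \<le> e" using periodic_int[OF \<phi>(2)] by simp
        then show ?thesis using cellfun_nonneg[of N k z] by (simp add: abs_mult mult_right_mono flip: left_diff_distrib)
      qed simp
    qed simp
    also have "\<dots> = e" using N0 by (simp add: cellfun_integral[OF N(1)])
    finally show ?thesis .
  qed
  have "\<phi> x = (\<Sum>k\<in>cells N. \<phi> x * cellfun N k x)"
    by (simp add: cellfun_sum[OF N(1)] flip: sum_distrib_left)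
  then have "\<phi> x - cellapprox N \<phi> x = (\<Sum>k\<in>cells N. (\<phi> x - cellcoef N \<phi> k) * cellfun N k x)"
    unfolding cellapprox_def by (simp add: left_diff_distrib sum_subtractf)
  also have "\<bar>\<dots>\<bar> \<le> (\<Sum>k\<in>cells N. e * cellfun N k x)"
  proof (rule sum_abs[THEN order_trans], rule sum_mono)
    fix k
    show "\<bar>(\<phi> x - cellcoef N \<phi> k) * cellfun N k x\<bar> \<le> e * cellfun N k x"
      using coef[of k] cellfun_nonneg[of N k x] by (cases "cellfun N k x = 0") (auto simp: abs_mult mult_right_mono)
  qed
  also have "\<dots> = e" by (simp add: cellfun_sum[OF N(1)] flip: sum_distrib_left)
  finally show ?thesis .
qed

lemma cellapprox_uniform:
  assumes \<phi>: "continuous_on UNIV \<phi>" "periodic \<phi>" and e: "e > 0"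
  obtains N where "N \<ge> 2" "\<And>x. \<bar>\<phi> x - cellapprox N \<phi> x\<bar> \<le> e"
proof -
  obtain d where d: "d > 0" "\<And>x y. dist y x < d \<Longrightarrow> dist (\<phi> y) (\<phi> x) < e"
    using periodic_uniformly_continuous[OF \<phi>(2,1), unfolded uniformly_continuous_on_def, rule_format, OF e] by blast
  obtain n :: nat where n: "4 / d < real n" using reals_Archimedean2 by blast
  define N where "N = max 2 n"
  have "4 / d < real N" using n by (simp add: N_def)
  then have "4 / real N \<le> d" using d(1) by (simp add: field_simps N_def)
  moreover have "\<bar>\<phi> x - \<phi> y\<bar> \<le> e" if "norm (x - y) < d" for x y
    using d(2)[of x y] that by (simp add: dist_norm)
  ultimately have "\<bar>\<phi> x - cellapprox N \<phi> x\<bar> \<le> e" for x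
    by (intro cellapprox_close[OF \<phi>]) (auto simp: N_def)
  then show ?thesis using that[of N] by (auto simp: N_def)
qed

lemma cellapprox_cont: "continuous_on A (cellapprox N \<phi>)"
  unfolding cellapprox_def by (intro continuous_intros cellfun_cont)

lemma cellapprox_periodic: "periodic (cellapprox N \<phi>)"
  using cellfun_periodic[of N] by (simp add: periodic_def cellapprox_def)

text \<open>Jensen's inequality on each cell, obtained from nonnegativity of the weighted variance
  about the coefficient; summation uses that the cells form a partition of unity.\<close>

lemma cellcoef_square_sum:
  assumes \<phi>: "continuous_on UNIV \<phi>" "periodic \<phi>" and N: "N \<ge> 2"
  shows "(\<Sum>k\<in>cells N. (cellcoef N \<phi> k)\<^sup>2) \<le> (real N)\<^sup>2 * (\<integral>x. (\<phi> x)\<^sup>2 \<partial>unif_sq)"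
proof -
  have N0: "real N > 0" using N by simp
  have p2: "continuous_on UNIV (\<lambda>x. (\<phi> x)\<^sup>2)" "periodic (\<lambda>x. (\<phi> x)\<^sup>2)"
    using \<phi> by (auto intro!: continuous_intros simp: periodic_def)
  have one: "integrable unif_sq (\<lambda>z. c * cellfun N k z)" for c k
    using integrable_cell[of "\<lambda>_. c" N k] by (simp add: periodic_def)
  have "(cellcoef N \<phi> k)\<^sup>2 \<le> (real N)\<^sup>2 * (\<integral>x. (\<phi> x)\<^sup>2 * cellfun N k x \<partial>unif_sq)" for k
  proof -
    let ?c = "cellcoef N \<phi> k"
    have "0 \<le> (\<integral>x. (\<phi> x - ?c)\<^sup>2 * cellfun N k x \<partial>unif_sq)"
      by (intro integral_nonneg_AE) (simp add: cellfun_nonneg)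
    also have "\<dots> = (\<integral>x. (\<phi> x)\<^sup>2 * cellfun N k x - 2 * ?c * (\<phi> x * cellfun N k x) + ?c\<^sup>2 * cellfun N k x \<partial>unif_sq)"
      by (rule Bochner_Integration.integral_cong) (simp_all add: power2_eq_square algebra_simps)
    also have "\<dots> = (\<integral>x. (\<phi> x)\<^sup>2 * cellfun N k x \<partial>unif_sq) - 2 * ?c * (\<integral>x. \<phi> x * cellfun N k x \<partial>unif_sq) + ?c\<^sup>2 * (1 / (real N)\<^sup>2)"
      using integrable_cell[OF \<phi>, of N k] integrable_cell[OF p2, of N k] one by (simp add: cellfun_integral[OF N])
    also have "(\<integral>x. \<phi> x * cellfun N k x \<partial>unif_sq) = ?c / (real N)\<^sup>2" using N0 by (simp add: cellcoef_def)
    finally have "?c\<^sup>2 / (real N)\<^sup>2 \<le> (\<integral>x. (\<phi> x)\<^sup>2 * cellfun N k x \<partial>unif_sq)"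
      by (simp add: power2_eq_square)
    then show ?thesis using N0 by (simp add: field_simps)
  qed
  then have "(\<Sum>k\<in>cells N. (cellcoef N \<phi> k)\<^sup>2) \<le> (\<Sum>k\<in>cells N. (real N)\<^sup>2 * (\<integral>x. (\<phi> x)\<^sup>2 * cellfun N k x \<partial>unif_sq))"
    by (intro sum_mono)
  also have "\<dots> = (real N)\<^sup>2 * (\<integral>x. (\<Sum>k\<in>cells N. (\<phi> x)\<^sup>2 * cellfun N k x) \<partial>unif_sq)"
    using integrable_cell[OF p2] by (simp add: sum_distrib_left Bochner_Integration.integral_sum)
  also have "(\<lambda>x. \<Sum>k\<in>cells N. (\<phi> x)\<^sup>2 * cellfun N k x) = (\<lambda>x. (\<phi> x)\<^sup>2)"
    by (simp add: cellfun_sum[OF N] flip: sum_distrib_left)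
  finally show ?thesis .
qed

section \<open>The bound for the stream functional in mean square\<close>

context invariant_flow begin

lemma stream_fun_sum:
  assumes "finite K" "\<And>k. k \<in> K \<Longrightarrow> continuous_on UNIV (f k)" "\<And>k. k \<in> K \<Longrightarrow> periodic (f k)"
  shows "stream_fun (\<lambda>x. \<Sum>k\<in>K. c k * f k x) = (\<Sum>k\<in>K. c k * stream_fun (f k))"
  using assms
proof (induction K rule: finite_induct)
  case empty
  show ?case using stream_fun_cmult[of 0 "\<lambda>_. 0"] by simp
next
  case (insert k K)
  have "stream_fun (\<lambda>x. c k * f k x + (\<Sum>k\<in>K. c k * f k x)) = stream_fun (\<lambda>x. c k * f k x) + stream_fun (\<lambda>x. \<Sum>k\<in>K. c k * f k x)"
    using insert.prems by (intro stream_fun_add continuous_intros) (auto simp: periodic_def)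
  then show ?case using insert by (simp add: stream_fun_cmult)
qed

lemma nodefun_expectation_sum:
  assumes "N \<ge> 2"
  shows "(\<Sum>i<N. expectation (\<lambda>y. nodefun N i (fst y))) = 1" "(\<Sum>i<N. expectation (\<lambda>y. nodefun N i (snd y))) = 1"
proof -
  have i: "integrable \<mu> (\<lambda>y. nodefun N i (fst y))" "integrable \<mu> (\<lambda>y. nodefun N i (snd y))" for i
    by (intro integrable_cont_periodic[OF \<mu>] lift1_cont lift1_periodic nodefun_cont nodefun_per1)+
  show "(\<Sum>i<N. expectation (\<lambda>y. nodefun N i (fst y))) = 1"
    by (subst Bochner_Integration.integral_sum[symmetric]) (use i nodefun_sum[OF assms] in \<open>auto simp: prob_space\<close>)
  show "(\<Sum>i<N. expectation (\<lambda>y. nodefun N i (snd y))) = 1"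
    by (subst Bochner_Integration.integral_sum[symmetric]) (use i nodefun_sum[OF assms] in \<open>auto simp: prob_space\<close>)
qed

text \<open>The discrete Gagliardo--Nirenberg argument: the value at a cell is bounded both by a function of its
  column and by a function of its row.\<close>
lemma stream_fun_cell_square_sum:
  assumes N: "N \<ge> 2"
  shows "(\<Sum>k\<in>cells N. (stream_fun (cellfun N k))\<^sup>2) \<le> M\<^sup>2 / (real N)\<^sup>2"
proof -
  \<comment> \<open>Column weight: a marginal mass of \<open>\<mu>\<close> plus a Lebesgue mass.
    Both families of masses have total 1, so the weights sum to 2.\<close>
  define p where "p i = expectation (\<lambda>y. nodefun N i (fst y)) + 1 / real N" for i
  define q where "q j = expectation (\<lambda>y. nodefun N j (snd y)) + 1 / real N" for j
  have N0: "real N > 0" using N by simp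
  have sums: "(\<Sum>i<N. p i) = 2" "(\<Sum>j<N. q j) = 2"
    unfolding p_def q_def sum.distrib nodefun_expectation_sum[OF N] using N0 by auto
  have "(stream_fun (cellfun N k))\<^sup>2 \<le> (M / 2 / real N)\<^sup>2 * (p (fst k) * q (snd k))" for k
  proof -
    let ?a = "\<bar>stream_fun (cellfun N k)\<bar>"
    note B = stream_fun_prod_bound[OF nodefun_cont[of UNIV N "fst k"] nodefun_per1 nodefun_nonneg
        nodefun_cont[of UNIV N "snd k"] nodefun_per1 nodefun_nonneg, unfolded nodefun_integral[OF N]]
    have c: "cellfun N k = (\<lambda>x. nodefun N (fst k) (fst x) * nodefun N (snd k) (snd x))" by (auto simp: cellfun_def)
    have 1: "?a \<le> M / 2 / real N * p (fst k)" unfolding c using B(1) by (simp add: p_def)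
    have 2: "?a \<le> M / 2 / real N * q (snd k)" unfolding c using B(2) by (simp add: q_def)
    have "?a * ?a \<le> (M / 2 / real N * p (fst k)) * (M / 2 / real N * q (snd k))"
      by (rule mult_mono[OF 1 2]) (use 1 in \<open>auto intro: order_trans[of _ ?a]\<close>)
    then show ?thesis by (simp add: power2_eq_square mult_ac)
  qed
  then have "(\<Sum>k\<in>cells N. (stream_fun (cellfun N k))\<^sup>2) \<le> (\<Sum>k\<in>cells N. (M / 2 / real N)\<^sup>2 * (p (fst k) * q (snd k)))"
    by (intro sum_mono)
  \<comment> \<open>The factorised double sum is \<open>2 * 2\<close>, which cancels the two factors
    \<open>1/2\<close> from the sawtooth.\<close>
  also have "\<dots> = (M / 2 / real N)\<^sup>2 * (2 * 2)"
    unfolding sum_distrib_left[symmetric] sum_cells sums by simp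
  finally show ?thesis by (simp add: power2_eq_square)
qed

text \<open>The factor \<open>N\<^sup>2\<close> in the sum of squared coefficients cancels
  \<open>1 / N\<^sup>2\<close> in the sum of squared cell values. The estimate is thus uniform in
  the mesh, and the sup bound carries it over to \<open>\<phi>\<close>.\<close>

lemma stream_fun_L2_bound:
  assumes \<phi>: "continuous_on UNIV \<phi>" "periodic \<phi>"
  shows "\<bar>stream_fun \<phi>\<bar> \<le> M * sqrt (\<integral>x. (\<phi> x)\<^sup>2 \<partial>unif_sq)"
proof (rule field_le_epsilon)
  fix e :: real assume "e > 0"
  define I where "I = (\<integral>x. (\<phi> x)\<^sup>2 \<partial>unif_sq)"
  have I0: "I \<ge> 0" unfolding I_def by simp
  obtain N where N: "N \<ge> 2" "\<And>x. \<bar>\<phi> x - cellapprox N \<phi> x\<bar> \<le> e / M"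
    using cellapprox_uniform[OF \<phi>, of "e / M"] \<open>e > 0\<close> M_pos by (metis divide_pos_pos)
  have N0: "real N > 0" using N by simp
  have "(stream_fun (cellapprox N \<phi>))\<^sup>2 = (\<Sum>k\<in>cells N. cellcoef N \<phi> k * stream_fun (cellfun N k))\<^sup>2"
    unfolding cellapprox_def by (subst stream_fun_sum) (auto intro: cellfun_cont cellfun_periodic)
  also have "\<dots> \<le> (\<Sum>k\<in>cells N. (cellcoef N \<phi> k)\<^sup>2) * (\<Sum>k\<in>cells N. (stream_fun (cellfun N k))\<^sup>2)"
    by (rule Cauchy_Schwarz_ineq_sum)
  also have "\<dots> \<le> ((real N)\<^sup>2 * I) * (M\<^sup>2 / (real N)\<^sup>2)"
    unfolding I_def using I0 
    by (intro mult_mono cellcoef_square_sum[OF \<phi> N(1)] stream_fun_cell_square_sum[OF N(1)] sum_nonneg) (auto simp: I_def)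
  also have "\<dots> = (M * sqrt I)\<^sup>2" using I0 N0 by (simp add: power_mult_distrib)
  finally have 1: "\<bar>stream_fun (cellapprox N \<phi>)\<bar> \<le> M * sqrt I"
    using M_pos I0 power2_le_imp_le[of "\<bar>stream_fun (cellapprox N \<phi>)\<bar>" "M * sqrt I"] by simp
  let ?d = "\<lambda>x. \<phi> x + (-1) * cellapprox N \<phi> x"
  have pc: "periodic (\<lambda>x. (-1) * cellapprox N \<phi> x)" using cellapprox_periodic[of N \<phi>] by (simp add: periodic_def)
  have "stream_fun ?d = stream_fun \<phi> + (-1) * stream_fun (cellapprox N \<phi>)"
    by (subst stream_fun_add, intro \<phi>, intro \<phi>, intro continuous_intros cellapprox_cont, rule pc) (simp only: stream_fun_cmult)
  moreover have "\<bar>stream_fun ?d\<bar> \<le> M * (e / M)"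
  proof (rule stream_fun_sup_bound)
    show "continuous_on UNIV ?d" by (intro continuous_intros \<phi> cellapprox_cont)
    show "periodic ?d" using \<phi>(2) pc by (simp add: periodic_def)
  qed (use N(2) in simp)
  ultimately show "\<bar>stream_fun \<phi>\<bar> \<le> M * sqrt (\<integral>x. (\<phi> x)\<^sup>2 \<partial>unif_sq) + e"
    using 1 M_pos unfolding I_def by simp
qed

end

section \<open>Riesz representation\<close>

text \<open>Replaces the Cauchy-Schwarz inequality for integrals; a weight \<open>k\<close> adapted
  to the sizes of both factors loses only a constant.\<close>

lemma abs_le_scaled_squares: "\<bar>a * c\<bar> \<le> (k * a\<^sup>2 + c\<^sup>2 / k) / 2" if "k > 0" for a c k :: real
proof -
  have "0 \<le> (k * \<bar>a\<bar> - \<bar>c\<bar>)\<^sup>2 / k" using that by simp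
  also have "\<dots> = k * a\<^sup>2 + c\<^sup>2 / k - 2 * \<bar>a * c\<bar>" using that by (simp add: power2_eq_square abs_mult field_simps)
  finally show ?thesis by simp
qed

lemma integrable_mult_L2:
  fixes f g :: "'a \<Rightarrow> real"
  assumes [measurable]: "f \<in> borel_measurable M" "g \<in> borel_measurable M"
    and "integrable M (\<lambda>x. (f x)\<^sup>2)" "integrable M (\<lambda>x. (g x)\<^sup>2)"
  shows "integrable M (\<lambda>x. f x * g x)"
proof (rule Bochner_Integration.integrable_bound)
  show "integrable M (\<lambda>x. (f x)\<^sup>2 + (g x)\<^sup>2)" using assms by simp
  have "norm (a * c) \<le> norm (a\<^sup>2 + c\<^sup>2)" for a c :: real
  proof -
    have half: "t / 2 \<le> t" if "t \<ge> 0" for t :: real using that by simp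
    have "norm (a * c) \<le> (a\<^sup>2 + c\<^sup>2) / 2"
      using abs_le_scaled_squares[OF zero_less_one, of a c] unfolding real_norm_def div_by_1 mult_1 .
    also have "\<dots> \<le> a\<^sup>2 + c\<^sup>2" by (rule half) simp
    also have "\<dots> \<le> norm (a\<^sup>2 + c\<^sup>2)" unfolding real_norm_def by (rule abs_ge_self)
    finally show ?thesis .
  qed
  then show "AE x in M. norm (f x * g x) \<le> norm ((f x)\<^sup>2 + (g x)\<^sup>2)" by simp
qed measurable

text \<open>The sum of all moduli of increments has finite integral, hence is finite almost
  everywhere, and the telescoping series converges there.\<close>

lemma AE_convergent_of_summable_L1:
  fixes f :: "nat \<Rightarrow> 'a \<Rightarrow> real"
  assumes i: "\<And>n. integrable M (\<lambda>x. f (Suc n) x - f n x)"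
    and s: "\<And>n. (\<integral>x. \<bar>f (Suc n) x - f n x\<bar> \<partial>M) \<le> c n" "summable c"
  shows "AE x in M. convergent (\<lambda>n. f n x)"
proof -
  have c0: "c n \<ge> 0" for n by (rule order_trans[OF _ s(1)]) simp
  have m: "(\<lambda>x. ennreal \<bar>f (Suc n) x - f n x\<bar>) \<in> borel_measurable M" for n
    using borel_measurable_integrable[OF i] by simp
  have "(\<integral>\<^sup>+x. (\<Sum>n. ennreal \<bar>f (Suc n) x - f n x\<bar>) \<partial>M) = (\<Sum>n. \<integral>\<^sup>+x. ennreal \<bar>f (Suc n) x - f n x\<bar> \<partial>M)"
    by (rule nn_integral_suminf[OF m])
  also have "\<dots> \<le> (\<Sum>n. ennreal (c n))"
    using s(1) i by (intro suminf_le) (auto simp: nn_integral_eq_integral ennreal_leI)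
  also have "\<dots> = ennreal (suminf c)" using c0 s(2) by (intro suminf_ennreal2) auto
  finally have "(\<integral>\<^sup>+x. (\<Sum>n. ennreal \<bar>f (Suc n) x - f n x\<bar>) \<partial>M) \<noteq> \<infinity>" by (auto simp: top_unique)
  then have "AE x in M. (\<Sum>n. ennreal \<bar>f (Suc n) x - f n x\<bar>) \<noteq> \<infinity>"
    by (intro nn_integral_PInf_AE borel_measurable_suminf_order m)
  then show ?thesis
  proof eventually_elim
    case (elim x)
    then have "summable (\<lambda>n. \<bar>f (Suc n) x - f n x\<bar>)" by (intro summable_suminf_not_top) auto
    then have "summable (\<lambda>n. f (Suc n) x - f n x)" by (rule summable_rabs_cancel)
    then have "convergent (\<lambda>n. \<Sum>k<n. f (Suc k) x - f k x)" by (simp add: summable_iff_convergent)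
    then have "convergent (\<lambda>n. f n x - f 0 x)" by (simp only: sum_lessThan_telescope[of "\<lambda>n. f n x"])
    then have "convergent (\<lambda>n. (f n x - f 0 x) + f 0 x)" by (intro convergent_add convergent_const)
    then show ?case by simp
  qed
qed

text \<open>Riesz representation on the closure of \<open>V\<close> in \<open>L\<^sup>2\<close>, by minimising \<open>\<parallel>f\<parallel>\<^sup>2 - 2 A f\<close> over \<open>V\<close>.\<close>
lemma (in prob_space) riesz_L2:
  fixes V :: "('a \<Rightarrow> real) set"
  assumes V_meas: "\<And>f. f \<in> V \<Longrightarrow> f \<in> borel_measurable M"
    and V_sq: "\<And>f. f \<in> V \<Longrightarrow> integrable M (\<lambda>x. (f x)\<^sup>2)"
    and V_add: "\<And>f g. f \<in> V \<Longrightarrow> g \<in> V \<Longrightarrow> (\<lambda>x. f x + g x) \<in> V"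
    and V_scale: "\<And>c f. f \<in> V \<Longrightarrow> (\<lambda>x. c * f x) \<in> V"
    and V_ne: "V \<noteq> {}"
    and A_add: "\<And>f g. f \<in> V \<Longrightarrow> g \<in> V \<Longrightarrow> A (\<lambda>x. f x + g x) = A f + A g"
    and A_scale: "\<And>c f. f \<in> V \<Longrightarrow> A (\<lambda>x. c * f x) = c * A f"
    and A_bound: "\<And>f. f \<in> V \<Longrightarrow> \<bar>A f\<bar> \<le> C * sqrt (\<integral>x. (f x)\<^sup>2 \<partial>M)"
  obtains u where "u \<in> borel_measurable M" "integrable M (\<lambda>x. (u x)\<^sup>2)"
    "\<And>f. f \<in> V \<Longrightarrow> A f = (\<integral>x. u x * f x \<partial>M)"
proof -
  have V_mult: "integrable M (\<lambda>x. f x * g x)" if "f \<in> V" "g \<in> V" for f g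
    using that by (intro integrable_mult_L2 V_meas V_sq)
  define Q where "Q f = (\<integral>x. (f x)\<^sup>2 \<partial>M)" for f :: "'a \<Rightarrow> real"
  define J where "J f = Q f - 2 * A f" for f
  define d where "d = Inf (J ` V)"
  have Q0: "Q f \<ge> 0" for f by (simp add: Q_def)
  \<comment> \<open>Completing the square in \<open>sqrt (Q f)\<close>; this is where the bound on
    \<open>A\<close> enters.\<close>
  have J_ge: "J f \<ge> - C\<^sup>2" if "f \<in> V" for f
  proof -
    have "0 \<le> (sqrt (Q f) - C)\<^sup>2" by simp
    then have "2 * (C * sqrt (Q f)) \<le> Q f + C\<^sup>2" using Q0[of f] by (simp add: power2_diff mult_ac)
    then show ?thesis using A_bound[OF that] by (simp add: J_def Q_def)
  qed
  have bdd: "bdd_below (J ` V)" using J_ge by (intro bdd_belowI[of _ "- C\<^sup>2"]) auto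
  have d_le: "d \<le> J f" if "f \<in> V" for f unfolding d_def using that bdd by (intro cInf_lower) auto
  have Q_add: "Q (\<lambda>x. f x + g x) = Q f + 2 * (\<integral>x. f x * g x \<partial>M) + Q g" if "f \<in> V" "g \<in> V" for f g
    unfolding Q_def using V_sq[OF that(1)] V_sq[OF that(2)] V_mult[OF that]
    by (simp add: power2_sum mult.assoc)
  have Q_scale: "Q (\<lambda>x. c * f x) = c\<^sup>2 * Q f" for c f by (simp add: Q_def power_mult_distrib)
  have J_var: "J (\<lambda>x. f x + t * g x) = J f + 2 * t * ((\<integral>x. f x * g x \<partial>M) - A g) + t\<^sup>2 * Q g" if "f \<in> V" "g \<in> V" for f g t
  proof -
    have "(\<integral>x. f x * (t * g x) \<partial>M) = t * (\<integral>x. f x * g x \<partial>M)" by (simp add: mult.left_commute)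
    then show ?thesis
      unfolding J_def using Q_add[OF that(1) V_scale[OF that(2), of t]] A_add[OF that(1) V_scale[OF that(2), of t]]
      by (simp add: Q_scale A_scale[OF that(2)] algebra_simps)
  qed
  \<comment> \<open>Parallelogram identity: the midpoint of two near minimisers cannot fall below
    the infimum, so they are close to each other.\<close>
  have para: "Q (\<lambda>x. f x - g x) \<le> 2 * (J f - d) + 2 * (J g - d)" if fg: "f \<in> V" "g \<in> V" for f g
  proof -
    let ?I = "\<integral>x. f x * g x \<partial>M"
    have "d \<le> J (\<lambda>x. 1/2 * (f x + g x))" using fg by (intro d_le V_scale V_add)
    also have "\<dots> = 1/4 * (Q f + 2 * ?I + Q g) - (A f + A g)"
      unfolding J_def Q_scale Q_add[OF fg] A_scale[OF V_add[OF fg]] A_add[OF fg] by (simp add: power2_eq_square field_simps)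
    finally have "4 * d \<le> Q f + 2 * ?I + Q g - 4 * (A f + A g)" by (simp add: field_simps)
    moreover have "Q (\<lambda>x. f x - g x) = Q f - 2 * ?I + Q g"
      using Q_add[OF fg(1) V_scale[OF fg(2), of "-1"]] Q_scale[of "-1" g] by simp
    ultimately show ?thesis by (simp add: J_def)
  qed
  \<comment> \<open>The rate is chosen for the later weight \<open>4^n\<close> in
    \<open>abs_le_scaled_squares\<close>: squared distances of order \<open>16^-n\<close> yield
    integrals of increments of order \<open>4^-n\<close>, which are summable.\<close>
  have "\<exists>f\<in>V. J f < d + (1/16)^n" for n :: nat
  proof -
    have "Inf (J ` V) < d + (1/16)^n" by (simp add: d_def)
    then show ?thesis using V_ne by (auto simp: cInf_less_iff[OF _ bdd])
  qed
  then obtain f where f: "\<And>n::nat. f n \<in> V" "\<And>n. J (f n) < d + (1/16)^n" by metis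
  have fm: "f n \<in> borel_measurable M" for n by (rule V_meas[OF f(1)])
  have Qf: "Q (\<lambda>x. f m x - f n x) \<le> 4 * (1/16)^n" if "n \<le> m" for m n
  proof -
    have "(1/16::real)^m \<le> (1/16)^n" using that by (intro power_decreasing) auto
    then show ?thesis using para[OF f(1) f(1), of m n] f(2)[of m] f(2)[of n]
      unfolding right_diff_distrib by linarith
  qed
  have fdV: "(\<lambda>x. f m x - f n x) \<in> V" for m n
    using V_add[OF f(1)[of m] V_scale[OF f(1)[of n], of "-1"]] by simp
  note fd_sq = V_sq[OF fdV]
  have fd_int: "integrable M (\<lambda>x. f m x - f n x)" for m n
    using integrable_mult_L2[OF V_meas[OF fdV] _ V_sq[OF fdV], of "\<lambda>_. 1"] by simp
  have "(\<integral>x. \<bar>f (Suc n) x - f n x\<bar> \<partial>M) \<le> 3 * (1/4)^n" for n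
  proof -
    have "(\<integral>x. \<bar>f (Suc n) x - f n x\<bar> \<partial>M) \<le> (\<integral>x. (4^n * (f (Suc n) x - f n x)\<^sup>2 + 1 / 4^n) / 2 \<partial>M)"
    proof (rule integral_mono)
      show "\<bar>f (Suc n) x - f n x\<bar> \<le> (4^n * (f (Suc n) x - f n x)\<^sup>2 + 1 / 4^n) / 2" for x
        using abs_le_scaled_squares[of "4^n" "f (Suc n) x - f n x" 1] by simp
    qed (use fd_int fd_sq in simp_all)
    also have "\<dots> = (4^n * Q (\<lambda>x. f (Suc n) x - f n x) + 1 / 4^n) / 2"
      using fd_sq by (simp add: Q_def prob_space)
    also have "\<dots> \<le> (4^n * (4 * (1/16)^n) + 1 / 4^n) / 2"
      by (intro divide_right_mono add_mono mult_left_mono Qf) auto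
    also have "4^n * (4 * (1/16)^n) = 4 * (1/4::real)^n"
      by (simp add: power_mult_distrib[symmetric] mult.left_commute)
    also have "(4 * (1/4::real)^n + 1 / 4^n) / 2 = 5/2 * (1/4)^n" by (simp add: power_one_over)
    also have "\<dots> \<le> 3 * (1/4)^n" by (intro mult_right_mono) auto
    finally show ?thesis .
  qed
  then have conv: "AE x in M. convergent (\<lambda>n. f n x)"
    by (intro AE_convergent_of_summable_L1[where c = "\<lambda>n. 3 * (1/4)^n"] fd_int summable_mult) auto
  define u where "u x = lim (\<lambda>n. f n x)" for x
  have um [measurable]: "u \<in> borel_measurable M" unfolding u_def by (intro borel_measurable_lim_metric fm)
  have lim: "AE x in M. (\<lambda>n. f n x) \<longlonglongrightarrow> u x" using conv by eventually_elim (simp add: u_def convergent_LIMSEQ_iff)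
  \<comment> \<open>So far \<open>u\<close> is only an almost everywhere limit; Fatou's lemma shows
    that it is also the limit in mean square, at the same rate.\<close>
  have fat: "(\<integral>\<^sup>+x. ennreal ((u x - f n x)\<^sup>2) \<partial>M) \<le> ennreal (4 * (1/16)^n)" for n
  proof -
    have "(\<integral>\<^sup>+x. ennreal ((u x - f n x)\<^sup>2) \<partial>M) = (\<integral>\<^sup>+x. liminf (\<lambda>m. ennreal ((f m x - f n x)\<^sup>2)) \<partial>M)"
    proof (rule nn_integral_cong_AE)
      show "AE x in M. ennreal ((u x - f n x)\<^sup>2) = liminf (\<lambda>m. ennreal ((f m x - f n x)\<^sup>2))"
        using lim
      proof eventually_elim
        case (elim x)
        then have L: "(\<lambda>m. ennreal ((f m x - f n x)\<^sup>2)) \<longlonglongrightarrow> ennreal ((u x - f n x)\<^sup>2)"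
          by (intro tendsto_ennrealI tendsto_intros)
        show ?case by (rule lim_imp_Liminf[OF trivial_limit_sequentially L, symmetric])
      qed
    qed
    also have "\<dots> \<le> liminf (\<lambda>m. \<integral>\<^sup>+x. ennreal ((f m x - f n x)\<^sup>2) \<partial>M)"
      using fm by (intro nn_integral_liminf) auto
    also have "\<dots> \<le> ennreal (4 * (1/16)^n)"
    proof (rule Liminf_le)
      show "\<forall>\<^sub>F m in sequentially. (\<integral>\<^sup>+x. ennreal ((f m x - f n x)\<^sup>2) \<partial>M) \<le> ennreal (4 * (1/16)^n)"
        using eventually_ge_at_top[of n]
      proof eventually_elim
        case (elim m)
        show ?case using Qf[OF elim] fd_sq by (simp add: nn_integral_eq_integral Q_def ennreal_leI)
      qed
    qed simp
    finally show ?thesis .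
  qed
  have ud_sq: "integrable M (\<lambda>x. (u x - f n x)\<^sup>2)" for n
    using fm[of n] fat[of n] by (intro integrableI_nonneg) (auto simp: less_top[symmetric] top_unique intro: le_less_trans)
  have Qu: "Q (\<lambda>x. u x - f n x) \<le> 4 * (1/16)^n" for n
    using fat[of n] nn_integral_eq_integral[OF ud_sq[of n]] by (simp add: Q_def)
  have u_sq: "integrable M (\<lambda>x. (u x)\<^sup>2)"
  proof (rule Bochner_Integration.integrable_bound)
    show "integrable M (\<lambda>x. 2 * (u x - f 0 x)\<^sup>2 + 2 * (f 0 x)\<^sup>2)" using ud_sq[of 0] V_sq[OF f(1)[of 0]] by simp
    have "c\<^sup>2 \<le> 2 * (c - a)\<^sup>2 + 2 * a\<^sup>2" for a c :: real
      using zero_le_power2[of "c - 2 * a"] by (simp add: power2_eq_square algebra_simps)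
    then show "AE x in M. norm ((u x)\<^sup>2) \<le> norm (2 * (u x - f 0 x)\<^sup>2 + 2 * (f 0 x)\<^sup>2)" by simp
  qed measurable
  have "A g = (\<integral>x. u x * g x \<partial>M)" if g: "g \<in> V" for g
  proof -
    define D where "D = (\<integral>x. u x * g x \<partial>M) - A g"
    have ug: "integrable M (\<lambda>x. u x * g x)" by (rule integrable_mult_L2[OF um V_meas[OF g] u_sq V_sq[OF g]])
    have close: "\<bar>(\<integral>x. f n x * g x \<partial>M) - (\<integral>x. u x * g x \<partial>M)\<bar> \<le> (4 + Q g) / 2 * (1/4)^n" for n
    proof -
      have um': "(\<lambda>x. u x - f n x) \<in> borel_measurable M" using fm by simp
      note udg = integrable_mult_L2[OF um' V_meas[OF g] ud_sq V_sq[OF g]]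
      have "(\<integral>x. f n x * g x \<partial>M) - (\<integral>x. u x * g x \<partial>M) = - (\<integral>x. (u x - f n x) * g x \<partial>M)"
        using ug V_mult[OF f(1)[of n] g] by (simp add: left_diff_distrib)
      then have "\<bar>(\<integral>x. f n x * g x \<partial>M) - (\<integral>x. u x * g x \<partial>M)\<bar> \<le> (\<integral>x. \<bar>(u x - f n x) * g x\<bar> \<partial>M)"
        using integral_abs_bound[of M "\<lambda>x. (u x - f n x) * g x"] by simp
      also have "\<dots> \<le> (\<integral>x. (4^n * (u x - f n x)\<^sup>2 + (g x)\<^sup>2 / 4^n) / 2 \<partial>M)"
        using ud_sq V_sq[OF g] udg by (intro integral_mono integrable_abs abs_le_scaled_squares) auto
      also have "\<dots> = (4^n * Q (\<lambda>x. u x - f n x) + Q g / 4^n) / 2"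
        using ud_sq V_sq[OF g] by (simp add: Q_def)
      also have "\<dots> \<le> (4^n * (4 * (1/16)^n) + Q g / 4^n) / 2"
        by (intro divide_right_mono add_mono mult_left_mono Qu) auto
      also have "4^n * (4 * (1/16)^n) = 4 * (1/4::real)^n"
        by (simp add: power_mult_distrib[symmetric] mult.left_commute)
      finally show ?thesis by (simp add: power_one_over field_simps)
    qed
    have Tz: "(\<lambda>n. (1/4::real)^n) \<longlonglongrightarrow> 0" "(\<lambda>n. (1/16::real)^n) \<longlonglongrightarrow> 0" by (intro LIMSEQ_power_zero; simp)+
    have "(\<lambda>n. (\<integral>x. f n x * g x \<partial>M) - (\<integral>x. u x * g x \<partial>M)) \<longlonglongrightarrow> 0"
    proof (rule Lim_null_comparison)
      show "\<forall>\<^sub>F n in sequentially. norm ((\<integral>x. f n x * g x \<partial>M) - (\<integral>x. u x * g x \<partial>M)) \<le> (4 + Q g) / 2 * (1/4)^n"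
        using close by simp
      show "(\<lambda>n. (4 + Q g) / 2 * (1/4)^n) \<longlonglongrightarrow> 0" using tendsto_mult_right_zero[OF Tz(1)] .
    qed
    then have lim_ip: "(\<lambda>n. \<integral>x. f n x * g x \<partial>M) \<longlonglongrightarrow> (\<integral>x. u x * g x \<partial>M)" by (simp add: LIM_zero_iff)
    \<comment> \<open>First variation at the limit: along \<open>f n + t g\<close> the functional
      cannot fall below \<open>d\<close>, and \<open>f n\<close> is minimising up to
      \<open>(1/16)^n\<close>.\<close>
    have var: "0 \<le> 2 * t * D + t\<^sup>2 * Q g" for t
    proof (rule LIMSEQ_le_const)
      show "(\<lambda>n. 2 * t * ((\<integral>x. f n x * g x \<partial>M) - A g) + t\<^sup>2 * Q g + (1/16)^n) \<longlonglongrightarrow> 2 * t * D + t\<^sup>2 * Q g"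
        unfolding D_def by (rule tendsto_eq_intros lim_ip Tz refl | simp)+
      have "0 \<le> 2 * t * ((\<integral>x. f n x * g x \<partial>M) - A g) + t\<^sup>2 * Q g + (1/16)^n" for n
        using d_le[OF V_add[OF f(1)[of n] V_scale[OF g, of t]]] J_var[OF f(1) g, of n t] f(2)[of n] by simp
      then show "\<exists>N. \<forall>n\<ge>N. 0 \<le> 2 * t * ((\<integral>x. f n x * g x \<partial>M) - A g) + t\<^sup>2 * Q g + (1/16)^n" by blast
    qed
    define q where "q = Q g + 1"
    have q: "q > 0" using Q0[of g] by (simp add: q_def)
    \<comment> \<open>The variation is tested at \<open>t = - r\<close>. Dividing by
      \<open>Q g + 1\<close> instead of \<open>Q g\<close> also covers a direction of norm
      zero.\<close>
    define r where "r = D / q"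
    have D: "D = r * (Q g + 1)" using q by (simp add: r_def q_def)
    have "0 \<le> 2 * (- r) * D + (- r)\<^sup>2 * Q g" by (rule var)
    also have "\<dots> = - (r\<^sup>2 * (Q g + 2))" unfolding D by (simp add: power2_eq_square algebra_simps)
    finally have "r\<^sup>2 * (Q g + 2) \<le> 0" by simp
    then have "r = 0" using Q0[of g] by (simp add: mult_le_0_iff)
    then have "D = 0" using D by simp
    then show ?thesis by (simp add: D_def)
  qed
  then show ?thesis using that[OF um u_sq] by blast
qed

lemma AE_unif_sq_in: "AE x in unif_sq. x \<in> unit_sq"
  by (subst unif_sq_def, subst AE_density) (auto simp: indicator_def)

lemma (in invariant_flow) stream_fun_represented:
  obtains u where "periodic u" "u \<in> borel_measurable borel" "integrable unif_sq (\<lambda>x. (u x)\<^sup>2)"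
    "\<And>\<phi>. continuous_on UNIV \<phi> \<Longrightarrow> periodic \<phi> \<Longrightarrow> stream_fun \<phi> = (\<integral>x. u x * \<phi> x \<partial>unif_sq)"
proof -
  interpret S: prob_space unif_sq by (rule prob_space_unif_sq)
  let ?V = "{\<phi> :: real \<times> real \<Rightarrow> real. continuous_on UNIV \<phi> \<and> periodic \<phi>}"
  obtain u where u: "u \<in> borel_measurable unif_sq" "integrable unif_sq (\<lambda>x. (u x)\<^sup>2)"
    "\<And>\<phi>. \<phi> \<in> ?V \<Longrightarrow> stream_fun \<phi> = (\<integral>x. u x * \<phi> x \<partial>unif_sq)"
  proof (rule S.riesz_L2[of ?V stream_fun M])
    show "\<phi> \<in> borel_measurable unif_sq" if "\<phi> \<in> ?V" for \<phi>
      using borel_measurable_continuous_onI[of \<phi>] that by (simp cong: measurable_cong_sets)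
    show "integrable unif_sq (\<lambda>x. (\<phi> x)\<^sup>2)" if "\<phi> \<in> ?V" for \<phi>
      using that by (intro integrable_cont_periodic[OF torus_prob_unif_sq]) (auto intro!: continuous_intros simp: periodic_def)
    show "(\<lambda>x. \<phi> x + \<psi> x) \<in> ?V" if "\<phi> \<in> ?V" "\<psi> \<in> ?V" for \<phi> \<psi>
      using that by (auto intro!: continuous_intros simp: periodic_def)
    show "(\<lambda>x. c * \<phi> x) \<in> ?V" if "\<phi> \<in> ?V" for c \<phi>
      using that by (auto intro!: continuous_intros simp: periodic_def)
    show "?V \<noteq> {}" by (auto simp: periodic_def intro!: exI[of _ "\<lambda>_. 0"])
  qed (use stream_fun_add stream_fun_cmult stream_fun_L2_bound in auto)
  \<comment> \<open>The Riesz representative is determined on the cell only; copying the cell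
    periodically changes it on a null set of \<open>unif_sq\<close>.\<close>
  define u' where "u' x = u (fract x)" for x
  have um: "u \<in> borel_measurable borel" using u(1) by (simp cong: measurable_cong_sets)
  have eq: "AE x in unif_sq. u x = u' x" using AE_unif_sq_in by eventually_elim (simp add: u'_def fract_id)
  have m': "u' \<in> borel_measurable borel" unfolding u'_def using um by measurable
  show ?thesis
  proof (rule that[of u'])
    show "periodic u'" unfolding u'_def by (rule periodic_comp_fract)
    show "integrable unif_sq (\<lambda>x. (u' x)\<^sup>2)"
      using eq um m' by (subst integrable_cong_AE[where g = "\<lambda>x. (u x)\<^sup>2"]) (auto intro!: u(2) cong: measurable_cong_sets)
    fix \<phi> :: "real \<times> real \<Rightarrow> real" assume \<phi>: "continuous_on UNIV \<phi>" "periodic \<phi>"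
    have "\<phi> \<in> borel_measurable borel" by (rule borel_measurable_continuous_onI[OF \<phi>(1)])
    then have "(\<integral>x. u x * \<phi> x \<partial>unif_sq) = (\<integral>x. u' x * \<phi> x \<partial>unif_sq)"
      using eq um m' by (intro integral_cong_AE) (auto cong: measurable_cong_sets)
    then show "stream_fun \<phi> = (\<integral>x. u' x * \<phi> x \<partial>unif_sq)" using u(3) \<phi> by simp
  qed (rule m')
qed

section \<open>Functions orthogonal to all cosine waves\<close>

lemma C1grad_integral_zero:
  assumes "C1grad f f1 f2"
  shows "(\<integral>x. f1 x \<partial>unif_sq) = 0" "(\<integral>x. f2 x \<partial>unif_sq) = 0"
proof -
  have c: "continuous_on UNIV f1" "continuous_on UNIV f2" and p: "periodic f" using assms by (auto simp: C1grad_def)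
  show "(\<integral>x. f2 x \<partial>unif_sq) = 0"
  proof -
    have "vmean f2 = (\<lambda>_. 0)" using vmean_deriv2_zero[OF assms] by auto
    then show ?thesis by (simp add: integral_unif_sq_iterated[OF c(2)])
  qed
  show "(\<integral>x. f1 x \<partial>unif_sq) = 0"
    using integral_FTC[OF vmean_deriv[OF assms], of 0 1] vmean_per1[OF p, unfolded per1_def, rule_format, of 0]
    by (simp add: integral_unif_sq_iterated[OF c(1)])
qed

section \<open>Cosine waves with arbitrary phase\<close>

definition phase :: "int \<times> int \<Rightarrow> real \<times> real \<Rightarrow> real" where
  "phase k x = 2 * pi * (of_int (fst k) * fst x + of_int (snd k) * snd x)"

lemma phase_cont: "continuous_on A (phase k)"
  unfolding phase_def by (intro continuous_intros)

lemma phase_add: "phase k (x + y) = phase k x + phase k y"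
  by (simp add: phase_def algebra_simps)

lemma phase_scale: "phase k (t *\<^sub>R x) = t * phase k x"
  by (simp add: phase_def algebra_simps)

lemma cos_phase_periodic: "periodic (\<lambda>x. f (cos (phase k x + c)))"
proof -
  have "cos (phase k (x + (1, 0)) + c) = cos (phase k x + c)" for x
    using cos_2pi_int[of "phase k x / (2 * pi) + c / (2 * pi)" "fst k"]
    by (simp add: phase_add phase_def[of k "(1,0)"] algebra_simps)
  moreover have "cos (phase k (x + (0, 1)) + c) = cos (phase k x + c)" for x
    using cos_2pi_int[of "phase k x / (2 * pi) + c / (2 * pi)" "snd k"]
    by (simp add: phase_add phase_def[of k "(0,1)"] algebra_simps)
  ultimately show ?thesis by (simp add: periodic_def)
qed

text \<open>The free phase \<open>c\<close> includes the sines and closes the family under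
  differentiation, which shifts \<open>c\<close> by \<open>pi / 2\<close>. The value
  \<open>v\<close> may be a scalar or a vector, so test fields are covered.\<close>

definition wave :: "int \<times> int \<Rightarrow> real \<Rightarrow> 'b \<Rightarrow> real \<times> real \<Rightarrow> 'b::real_normed_vector" where
  "wave k c v x = cos (phase k x + c) *\<^sub>R v"

lemma wave_deriv:
  "((\<lambda>t. wave k c v (x + t *\<^sub>R i)) has_vector_derivative wave k (c + pi / 2) (phase k i *\<^sub>R v) x) (at 0)"
proof -
  have "((\<lambda>t. cos (phase k x + t * phase k i + c)) has_real_derivative - sin (phase k x + c) * phase k i) (at 0)"
    by (auto intro!: derivative_eq_intros)
  then have "((\<lambda>t. cos (phase k x + t * phase k i + c) *\<^sub>R v) has_vector_derivative (- sin (phase k x + c) * phase k i) *\<^sub>R v) (at 0)"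
    by (auto simp: has_real_derivative_iff_has_vector_derivative intro!: derivative_eq_intros)
  moreover have "cos (phase k x + (c + pi / 2)) = - sin (phase k x + c)"
    using minus_sin_cos_eq[of "phase k x + c"] by (simp add: add.assoc)
  ultimately show ?thesis by (simp add: wave_def phase_add phase_scale)
qed

lemma partial_wave: "partial i (wave k c v) = wave k (c + pi / 2) (phase k i *\<^sub>R v)"
  unfolding partial_def using wave_deriv vector_derivative_at by blast

lemma Ck_wave: "Ck n (wave k c v)"
proof (induction n arbitrary: c v)
  case 0
  show ?case unfolding wave_def by (simp, intro continuous_intros phase_cont)
next
  case (Suc n)
  have "continuous_on UNIV (wave k c v)" unfolding wave_def by (intro continuous_intros phase_cont)
  moreover have "(\<lambda>t. wave k c v (x + t *\<^sub>R i)) differentiable (at 0)" for x i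
    using wave_deriv[of k c v x i] by (auto simp: has_vector_derivative_def differentiable_def)
  ultimately show ?case using Suc by (simp add: partial_wave)
qed

lemma smooth_wave: "smooth (wave k c v)"
  by (simp add: smooth_def Ck_wave)

lemma periodic_wave: "periodic (wave k c v)"
  unfolding wave_def by (rule cos_phase_periodic)

lemma Rperp_wave: "Rperp (wave k c v y) = wave k c (Rperp v) y"
  by (simp add: Rperp_def wave_def)

lemma divg_Rperp_wave:
  "divg (\<lambda>y. Rperp (wave k c v y)) x
     = 2 * pi * (of_int (fst k) * snd v - of_int (snd k) * fst v) * cos (phase k x + (c + pi / 2))"
  unfolding Rperp_wave divg_def partial_wave
  by (simp add: wave_def phase_def Rperp_def algebra_simps)

text \<open>A function orthogonal to all cosine waves is orthogonal to every product of bumps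
  \<open>g(cos 2\<pi>(x\<^sub>1 - a\<^sub>1)) g(cos 2\<pi>(x\<^sub>2 - a\<^sub>2))\<close> by Weierstrass approximation of \<open>g\<close>, in particular to the cells of
  the partition of unity.\<close>
locale wave_orthogonal =
  fixes w :: "real \<times> real \<Rightarrow> real"
  assumes w_meas: "w \<in> borel_measurable borel" and w_int: "integrable unif_sq w"
    and orth: "\<And>k c. (\<integral>x. w x * cos (phase k x + c) \<partial>unif_sq) = 0"
begin

lemma integrable_w:
  assumes "\<phi> \<in> borel_measurable borel" "\<And>x. \<bar>\<phi> x\<bar> \<le> C"
  shows "integrable unif_sq (\<lambda>x. w x * \<phi> x)"
proof (rule Bochner_Integration.integrable_bound)
  show "integrable unif_sq (\<lambda>x. \<bar>w x\<bar> * C)" using w_int by simp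
  have "C \<ge> 0" using assms(2)[of 0] by linarith
  then show "AE x in unif_sq. norm (w x * \<phi> x) \<le> norm (\<bar>w x\<bar> * C)"
    using assms(2) by (intro AE_I2) (simp add: abs_mult mult_left_mono)
qed (use w_meas assms(1) in \<open>simp cong: measurable_cong_sets\<close>)

lemma integrable_w_cont:
  assumes "continuous_on UNIV \<phi>" "periodic \<phi>"
  shows "integrable unif_sq (\<lambda>x. w x * \<phi> x)"
  using periodic_bounded[OF assms(2,1)] borel_measurable_continuous_onI[OF assms(1)] integrable_w by (metis real_norm_def)

definition ann :: "(real \<times> real \<Rightarrow> real) \<Rightarrow> bool" where
  "ann \<phi> \<longleftrightarrow> continuous_on UNIV \<phi> \<and> periodic \<phi> \<and> (\<integral>x. w x * \<phi> x \<partial>unif_sq) = 0"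

lemma ann_wave: "ann (\<lambda>x. cos (phase k x + c))"
  unfolding ann_def using orth cos_phase_periodic[of "\<lambda>t. t"] by (auto intro!: continuous_intros phase_cont)

lemma ann_add: "ann \<phi> \<Longrightarrow> ann \<psi> \<Longrightarrow> ann (\<lambda>x. \<phi> x + \<psi> x)"
  using integrable_w_cont unfolding ann_def by (auto intro!: continuous_intros simp: periodic_def distrib_left)

lemma ann_scale: "ann \<phi> \<Longrightarrow> ann (\<lambda>x. a * \<phi> x)"
  unfolding ann_def by (auto intro!: continuous_intros simp: periodic_def mult.left_commute)

lemma ann_zero: "ann (\<lambda>x. 0)"
  by (simp add: ann_def periodic_def)

lemma ann_sum: "finite I \<Longrightarrow> (\<And>i. i \<in> I \<Longrightarrow> ann (f i)) \<Longrightarrow> ann (\<lambda>x. \<Sum>i\<in>I. f i x)"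
  by (induction I rule: finite_induct) (auto simp: ann_zero ann_add)

lemma ann_limit:
  assumes \<phi>: "continuous_on UNIV \<phi>" "periodic \<phi>"
    and lim: "\<And>e. e > 0 \<Longrightarrow> \<exists>\<psi>. ann \<psi> \<and> (\<forall>x. \<bar>\<phi> x - \<psi> x\<bar> \<le> e)"
  shows "ann \<phi>"
proof -
  define W where "W = (\<integral>x. \<bar>w x\<bar> \<partial>unif_sq)"
  have W: "W \<ge> 0" by (simp add: W_def)
  have "\<bar>\<integral>x. w x * \<phi> x \<partial>unif_sq\<bar> \<le> 0 + e" if "e > 0" for e
  proof -
    obtain \<psi> where \<psi>: "ann \<psi>" "\<And>x. \<bar>\<phi> x - \<psi> x\<bar> \<le> e / (W + 1)"
      using lim[of "e / (W + 1)"] \<open>e > 0\<close> W by (metis add_nonneg_pos divide_pos_pos zero_less_one)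
    have i: "integrable unif_sq (\<lambda>x. w x * \<phi> x)" "integrable unif_sq (\<lambda>x. w x * \<psi> x)"
      using \<phi> \<psi>(1) by (auto simp: ann_def intro: integrable_w_cont)
    have "(\<integral>x. w x * \<phi> x \<partial>unif_sq) = (\<integral>x. w x * \<phi> x - w x * \<psi> x \<partial>unif_sq)"
      using i \<psi>(1) by (simp add: ann_def)
    also have "\<bar>\<dots>\<bar> \<le> (\<integral>x. \<bar>w x\<bar> * (e / (W + 1)) \<partial>unif_sq)"
    proof (intro integral_abs_bound[THEN order_trans] integral_mono integrable_abs Bochner_Integration.integrable_diff i)
      show "integrable unif_sq (\<lambda>x. \<bar>w x\<bar> * (e / (W + 1)))" using w_int by simp
      show "\<bar>w x * \<phi> x - w x * \<psi> x\<bar> \<le> \<bar>w x\<bar> * (e / (W + 1))" for x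
        using mult_left_mono[OF \<psi>(2)[of x] abs_ge_zero[of "w x"]] by (simp add: abs_mult flip: right_diff_distrib)
    qed
    also have "\<dots> = W * (e / (W + 1))" by (simp add: W_def)
    also have "\<dots> \<le> e" using W \<open>e > 0\<close> by (simp add: field_simps)
    finally show ?thesis by simp
  qed
  then have "\<bar>\<integral>x. w x * \<phi> x \<partial>unif_sq\<bar> \<le> 0" by (rule field_le_epsilon)
  then show ?thesis using \<phi> by (simp add: ann_def)
qed

text \<open>The product-to-sum formula absorbs one cosine factor at a time into the last wave. The
  induction therefore has to keep frequency and phase of that wave arbitrary.\<close>

lemma ann_cos_power:
  "ann (\<lambda>x. cos (phase l x + a) ^ m * cos (phase l' x + a') ^ n * cos (phase k x + c))"
proof -
  have pc: "cos (phase l x + a) * cos (phase k x + c)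
      = 1/2 * cos (phase (l - k) x + (a - c)) + 1/2 * cos (phase (l + k) x + (a + c))" for l k a c x
    by (simp add: cos_times_cos phase_def algebra_simps add_divide_distrib)
  have 1: "ann (\<lambda>x. cos (phase l' x + a') ^ n * cos (phase k x + c))" for k c
  proof (induction n arbitrary: k c)
    case 0 then show ?case by (simp add: ann_wave)
  next
    case (Suc n)
    have eq: "cos (phase l' x + a') ^ Suc n * cos (phase k x + c) =
        1/2 * (cos (phase l' x + a') ^ n * cos (phase (l' - k) x + (a' - c)))
      + 1/2 * (cos (phase l' x + a') ^ n * cos (phase (l' + k) x + (a' + c)))" for x
      unfolding power_Suc2 mult.assoc pc by (simp only: distrib_left mult.left_commute)
    show ?case unfolding eq by (intro ann_add ann_scale Suc)
  qed
  show ?thesis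
  proof (induction m arbitrary: k c)
    case 0 then show ?case by (simp add: 1)
  next
    case (Suc m)
    have eq: "cos (phase l x + a) ^ Suc m * cos (phase l' x + a') ^ n * cos (phase k x + c) =
        1/2 * (cos (phase l x + a) ^ m * cos (phase l' x + a') ^ n * cos (phase (l - k) x + (a - c)))
      + 1/2 * (cos (phase l x + a) ^ m * cos (phase l' x + a') ^ n * cos (phase (l + k) x + (a + c)))" for x
    proof -
      have "cos (phase l x + a) ^ Suc m * cos (phase l' x + a') ^ n * cos (phase k x + c)
        = cos (phase l x + a) ^ m * cos (phase l' x + a') ^ n * (cos (phase l x + a) * cos (phase k x + c))" by simp
      then show ?thesis unfolding pc by (simp only: distrib_left mult.left_commute)
    qed
    show ?case unfolding eq by (intro ann_add ann_scale Suc)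
  qed
qed

lemma ann_polynomial:
  assumes "real_polynomial_function p"
  shows "ann (\<lambda>x. p (cos (phase l x + a)) * p (cos (phase l' x + a')))"
proof -
  obtain q n where p: "p = (\<lambda>x. \<Sum>i\<le>n. q i * x ^ i)" using assms real_polynomial_function_iff_sum by blast
  \<comment> \<open>The wave of frequency 0 and phase 0 is the constant 1 and supplies the last
    factor demanded by \<open>ann_cos_power\<close>.\<close>
  have eq: "p (cos (phase l x + a)) * p (cos (phase l' x + a')) =
     (\<Sum>i\<le>n. \<Sum>j\<le>n. (q i * q j) * (cos (phase l x + a) ^ i * cos (phase l' x + a') ^ j * cos (phase 0 x + 0)))" for x
    unfolding p sum_product by (simp add: phase_def mult_ac)
  show ?thesis unfolding eq by (intro ann_sum ann_scale ann_cos_power) auto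
qed

lemma ann_cellfun: "ann (cellfun N k)"
proof (rule ann_limit[OF cellfun_cont cellfun_periodic])
  fix e :: real assume "e > 0"
  \<comment> \<open>The profile for which \<open>tent N t = g (cos (2 * pi * t))\<close>.\<close>
  define g where "g s = max 0 (1 - real N * (arccos s / (2 * pi)))" for s
  have g1: "\<bar>g s\<bar> \<le> 1" if "s \<in> {-1..1}" for s
    using that arccos_lbound[of s] by (simp add: g_def)
  have "continuous_on {-1..1} g" unfolding g_def by (intro continuous_intros continuous_on_arccos') auto
  \<comment> \<open>The bound 1 keeps \<open>p\<close> below 2 in modulus; the errors of the product
    are then at most \<open>2 * (e / 3)\<close> and \<open>e / 3\<close>.\<close>
  then obtain p where p: "real_polynomial_function p" "\<And>s. s \<in> {-1..1} \<Longrightarrow> \<bar>g s - p s\<bar> < min 1 (e / 3)"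
    using Stone_Weierstrass_real_polynomial_function[of "{-1..1::real}" g "min 1 (e / 3)"] \<open>e > 0\<close> by auto
  have prod: "\<bar>g s * g t - p s * p t\<bar> \<le> e" if "s \<in> {-1..1}" "t \<in> {-1..1}" for s t
  proof -
    have "\<bar>p s\<bar> \<le> 2" using p(2)[OF that(1)] g1[OF that(1)] by linarith
    then have "\<bar>p s\<bar> * \<bar>g t - p t\<bar> \<le> 2 * (e / 3)" using p(2)[OF that(2)] by (intro mult_mono) auto
    moreover have "\<bar>g s - p s\<bar> * \<bar>g t\<bar> \<le> (e / 3) * 1" using p(2)[OF that(1)] g1[OF that(2)] \<open>e > 0\<close> by (intro mult_mono) auto
    moreover have "g s * g t - p s * p t = (g s - p s) * g t + p s * (g t - p t)" by (simp add: algebra_simps)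
    ultimately show ?thesis using abs_triangle_ineq[of "(g s - p s) * g t" "p s * (g t - p t)"] by (simp add: abs_mult)
  qed
  define a where "a i = - (2 * pi * (real i / real N))" for i
  have t1: "nodefun N i (fst x) = g (cos (phase (1,0) x + a i))" and t2: "nodefun N i (snd x) = g (cos (phase (0,1) x + a i))" for i x
    by (simp_all add: nodefun_def tent_def g_def phase_def a_def algebra_simps)
  have "\<bar>cellfun N k x - p (cos (phase (1,0) x + a (fst k))) * p (cos (phase (0,1) x + a (snd k)))\<bar> \<le> e" for x
    unfolding cellfun_def t1 t2 by (intro prod) auto
  then show "\<exists>\<psi>. ann \<psi> \<and> (\<forall>x. \<bar>cellfun N k x - \<psi> x\<bar> \<le> e)"
    using ann_polynomial[OF p(1)] by blast
qed

lemma ann_all: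
  assumes "continuous_on UNIV \<phi>" "periodic \<phi>" shows "ann \<phi>"
proof (rule ann_limit[OF assms])
  fix e :: real assume "e > 0"
  obtain N where N: "\<And>x. \<bar>\<phi> x - cellapprox N \<phi> x\<bar> \<le> e" using cellapprox_uniform[OF assms \<open>e > 0\<close>] by metis
  have "ann (cellapprox N \<phi>)" unfolding cellapprox_def[abs_def] by (intro ann_sum ann_scale ann_cellfun) auto
  then show "\<exists>\<psi>. ann \<psi> \<and> (\<forall>x. \<bar>\<phi> x - \<psi> x\<bar> \<le> e)" using N by blast
qed

end

section \<open>From orthogonality to vanishing almost everywhere\<close>

text \<open>A periodic weight that is positive inside the cell and zero on the lattice lines, where
  \<open>fract\<close> jumps.\<close>

definition sinweight :: "real \<times> real \<Rightarrow> real" where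
  "sinweight x = (sin (pi * fst x) * sin (pi * snd x))\<^sup>2"

lemma sinweight_zero:
  assumes "fst x \<in> \<int> \<or> snd x \<in> \<int>" shows "sinweight x = 0"
proof -
  have "sin (pi * t) = 0" if "t \<in> \<int>" for t :: real
    using that sin_integer_2pi[of t] by (auto elim!: Ints_cases simp: sin_zero_iff_int2 mult.commute)
  then show ?thesis using assms by (auto simp: sinweight_def)
qed

lemma sinweight_le: "0 \<le> sinweight x" "sinweight x \<le> 1"
proof -
  show "0 \<le> sinweight x" by (simp add: sinweight_def)
  have "\<bar>sin (pi * fst x) * sin (pi * snd x)\<bar> \<le> 1 * 1" unfolding abs_mult by (intro mult_mono) auto
  then show "sinweight x \<le> 1" by (simp add: sinweight_def abs_square_le_1)
qed

lemma sinweight_cont: "continuous_on A sinweight"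
  unfolding sinweight_def by (intro continuous_intros)

lemma sinweight_periodic: "periodic sinweight"
  by (simp add: periodic_def sinweight_def distrib_left power_mult_distrib)

text \<open>Off the lattice lines \<open>fract\<close> is continuous; on them the weight vanishes
  and the bounded factor cannot matter. This produces continuous periodic test functions from
  arbitrary bounded continuous \<open>h\<close>.\<close>

lemma fract_weight_cont:
  assumes h: "continuous_on UNIV h" "\<And>x. \<bar>h x\<bar> \<le> 1"
  shows "continuous_on UNIV (\<lambda>x. h (fract x) * sinweight x)"
proof (intro continuous_at_imp_continuous_on ballI)
  fix x :: "real \<times> real"
  show "isCont (\<lambda>x. h (fract x) * sinweight x) x"
  proof (cases "fst x \<in> \<int> \<or> snd x \<in> \<int>")
    case True
    have "((\<lambda>y. h (fract y) * sinweight y) \<longlongrightarrow> 0) (at x)"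
    proof (rule Lim_null_comparison)
      show "\<forall>\<^sub>F y in at x. norm (h (fract y) * sinweight y) \<le> sinweight y"
      proof (rule always_eventually, rule allI)
        fix y show "norm (h (fract y) * sinweight y) \<le> sinweight y"
          using mult_right_mono[OF h(2)[of "fract y"] sinweight_le(1)[of y]] sinweight_le(1)[of y] by (simp add: abs_mult)
      qed
      have "isCont sinweight x" using sinweight_cont[of UNIV] by (simp add: continuous_on_eq_continuous_at)
      then show "(sinweight \<longlongrightarrow> 0) (at x)" using sinweight_zero[OF True] by (simp add: isCont_def)
    qed
    then show ?thesis using sinweight_zero[OF True] by (simp add: isCont_def)
  next
    case False
    have "isCont fst x" "isCont snd x" by (intro continuous_intros)+
    then have "isCont (\<lambda>y. frac (fst y)) x" "isCont (\<lambda>y. frac (snd y)) x"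
      using False isCont_o2[of x fst frac] isCont_o2[of x snd frac] continuous_frac by blast+
    then have "isCont fract x" unfolding fract_def[abs_def] by (intro continuous_intros)
    moreover have "isCont h (fract x)" "isCont sinweight x" using h(1) sinweight_cont[of UNIV] by (simp_all add: continuous_on_eq_continuous_at)
    ultimately show ?thesis using isCont_mult[OF isCont_o2[of x fract h]] by blast
  qed
qed

lemma AE_unif_sq_open: "AE x in unif_sq. x \<in> box (0,0) (1,1)"
proof -
  let ?B = "box (0,0) (1,1) :: (real \<times> real) set"
  have sub: "?B \<subseteq> unit_sq" by (auto simp: unit_sq_def box_def Basis_prod_def)
  have "emeasure lborel (unit_sq - ?B) = 0"
    using emeasure_Diff[of lborel ?B unit_sq] sub emeasure_unit_sq by (simp add: emeasure_lborel_box_eq Basis_prod_def)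
  then have "unit_sq - ?B \<in> null_sets lborel" by (auto simp: null_sets_def)
  then have "AE x in lborel. x \<notin> unit_sq - ?B" by (rule AE_not_in)
  then show ?thesis unfolding unif_sq_def by (subst AE_density) (auto simp: indicator_def elim!: eventually_mono)
qed

text \<open>The sign of \<open>w\<close> is approximated by continuous functions. Truncated,
  periodized and weighted, they are test functions annihilated by \<open>w\<close>, and in the limit
  the integral of \<open>\<bar>w\<bar> * sinweight\<close> is zero.\<close>

lemma (in wave_orthogonal) AE_zero: "AE x in unif_sq. w x = 0"
proof -
  define f where "f x = sgn (w x)" for x
  have "f \<in> borel_measurable borel" unfolding f_def using w_meas by measurable
  then have "f \<in> borel_measurable lebesgue" by (simp add: measurable_completion)
  then have "f measurable_on UNIV" by (intro lebesgue_measurable_imp_measurable_on) auto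
  then obtain S g where S: "negligible S" "\<And>n. continuous_on UNIV (g n)" "\<And>x. x \<notin> S \<Longrightarrow> (\<lambda>n. g n x) \<longlonglongrightarrow> f x"
    unfolding measurable_on_def by auto
  \<comment> \<open>Truncation to \<open>[-1, 1]\<close> keeps the limit, since \<open>sgn\<close>
    takes values there, and gives the majorant \<open>\<bar>w\<bar>\<close>.\<close>
  define h where "h n x = max (-1) (min 1 (g n x))" for n :: nat and x
  have h: "continuous_on UNIV (h n)" "\<bar>h n x\<bar> \<le> 1" for n x
    unfolding h_def by (auto intro!: continuous_intros S(2))
  define \<phi> where "\<phi> n x = h n (fract x) * sinweight x" for n x
  have \<phi>c: "continuous_on UNIV (\<phi> n)" for n unfolding \<phi>_def by (intro fract_weight_cont h)
  have "periodic (\<lambda>x. h n (fract x))" for n by (rule periodic_comp_fract)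
  then have \<phi>p: "periodic (\<phi> n)" for n unfolding \<phi>_def using sinweight_periodic by (simp add: periodic_def)
  have \<phi>0: "(\<integral>x. w x * \<phi> n x \<partial>unif_sq) = 0" for n using ann_all[OF \<phi>c \<phi>p] by (simp add: ann_def)
  have \<phi>1: "\<bar>\<phi> n x\<bar> \<le> 1" for n x
    unfolding \<phi>_def abs_mult using mult_mono[OF h(2)[of n "fract x"] sinweight_le(2)[of x]] sinweight_le(1)[of x] by simp
  have "AE x in lebesgue. x \<notin> S" using S(1) by (simp add: negligible_iff_null_sets AE_not_in)
  then have "AE x in lborel. x \<notin> S" by (simp add: AE_completion_iff)
  then have SU: "AE x in unif_sq. x \<notin> S" unfolding unif_sq_def by (subst AE_density) (auto elim!: eventually_mono)
  have sm: "sinweight \<in> borel_measurable borel" by (rule borel_measurable_continuous_onI[OF sinweight_cont])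
  have "(\<lambda>n. \<integral>x. w x * \<phi> n x \<partial>unif_sq) \<longlonglongrightarrow> (\<integral>x. \<bar>w x\<bar> * sinweight x \<partial>unif_sq)"
  proof (rule integral_dominated_convergence[where w = "\<lambda>x. \<bar>w x\<bar>"])
    show "(\<lambda>x. \<bar>w x\<bar> * sinweight x) \<in> borel_measurable unif_sq"
      using w_meas sm by (simp cong: measurable_cong_sets)
    show "(\<lambda>x. w x * \<phi> n x) \<in> borel_measurable unif_sq" for n
      using w_meas borel_measurable_continuous_onI[OF \<phi>c[of n]] by (simp cong: measurable_cong_sets)
    show "integrable unif_sq (\<lambda>x. \<bar>w x\<bar>)" using w_int by simp
    show "AE x in unif_sq. norm (w x * \<phi> n x) \<le> \<bar>w x\<bar>" for n
      using mult_left_mono[OF \<phi>1] by (intro AE_I2) (simp add: abs_mult)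
    show "AE x in unif_sq. (\<lambda>n. w x * \<phi> n x) \<longlonglongrightarrow> \<bar>w x\<bar> * sinweight x"
      using SU AE_unif_sq_in
    proof eventually_elim
      case (elim x)
      have "(\<lambda>n. max (-1) (min 1 (g n x))) \<longlonglongrightarrow> max (-1) (min 1 (f x))"
        by (intro tendsto_intros S(3) elim)
      moreover have "max (-1) (min 1 (f x)) = f x" by (simp add: f_def sgn_real_def)
      ultimately have "(\<lambda>n. w x * (h n x * sinweight x)) \<longlonglongrightarrow> w x * (f x * sinweight x)"
        unfolding h_def by (intro tendsto_intros) simp
      moreover have "w x * (f x * sinweight x) = \<bar>w x\<bar> * sinweight x" by (simp add: f_def abs_sgn)
      ultimately show ?case using elim by (simp add: \<phi>_def fract_id)
    qed
  qed
  then have "(\<integral>x. \<bar>w x\<bar> * sinweight x \<partial>unif_sq) = 0" unfolding \<phi>0 using LIMSEQ_unique tendsto_const by blast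
  moreover have "integrable unif_sq (\<lambda>x. \<bar>w x\<bar> * sinweight x)"
    using integrable_abs[OF integrable_w[OF sm, of 1]] sinweight_le by (simp add: abs_mult)
  ultimately have "AE x in unif_sq. \<bar>w x\<bar> * sinweight x = 0"
    using sinweight_le(1) by (subst (asm) integral_nonneg_eq_0_iff_AE) auto
  then show ?thesis using AE_unif_sq_open
  proof eventually_elim
    case (elim x)
    then have "0 < fst x" "fst x < 1" "0 < snd x" "snd x < 1" by (auto simp: box_def Basis_prod_def inner_prod_def)
    then have "sin (pi * fst x) > 0" "sin (pi * snd x) > 0" by (auto intro!: sin_gt_zero)
    then show ?case using elim by (auto simp: sinweight_def)
  qed
qed

text \<open>The plane is covered by countably many translates of the cell, and Lebesgue measure is
  translation invariant.\<close>

lemma AE_lborel_of_unif_sq: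
  assumes ae: "AE x in unif_sq. P x" and P: "\<And>x. P (fract x) \<longleftrightarrow> P x" and m: "{x. P x} \<in> sets borel"
  shows "AE x in lborel. P x"
proof -
  have Pm: "Measurable.pred borel P" using m by (simp add: pred_def)
  have "AE x in lborel. x \<in> unit_sq \<longrightarrow> P x"
    using ae unfolding unif_sq_def by (subst (asm) AE_density) (auto simp: indicator_def elim!: eventually_mono)
  then have "AE x in lborel. x + k \<in> unit_sq \<longrightarrow> P (x + k)" for k :: "real \<times> real"
    using Pm by (subst (asm) lborel_distr_plus[of k, symmetric], subst (asm) AE_distr_iff) (auto simp: add.commute[of k])
  then have "AE x in lborel. \<forall>k :: int \<times> int. x + (of_int (fst k), of_int (snd k)) \<in> unit_sq \<longrightarrow> P (x + (of_int (fst k), of_int (snd k)))"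
    by (subst AE_all_countable) auto
  then show ?thesis
  proof eventually_elim
    case (elim x)
    have "x + (of_int (- \<lfloor>fst x\<rfloor>), of_int (- \<lfloor>snd x\<rfloor>)) = fract x"
      by (cases x) (simp add: fract_def frac_def)
    then have "fract x \<in> unit_sq \<longrightarrow> P (fract x)"
      using elim[rule_format, of "(- \<lfloor>fst x\<rfloor>, - \<lfloor>snd x\<rfloor>)"] by simp
    then show ?case using fract_in P by blast
  qed
qed

lemma integrable_unif_sq_of_square:
  fixes u :: "real \<times> real \<Rightarrow> real"
  assumes "u \<in> borel_measurable borel" "integrable unif_sq (\<lambda>x. (u x)\<^sup>2)"
  shows "integrable unif_sq u"
proof -
  interpret prob_space unif_sq by (rule prob_space_unif_sq)
  show ?thesis using integrable_mult_L2[of u unif_sq "\<lambda>_. 1"] assms by (simp cong: measurable_cong_sets)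
qed

text \<open>Every wave of nonzero frequency has the form
  \<open>divg (\<lambda>y. Rperp (\<Psi> y))\<close> for a smooth periodic field; frequency zero is
  removed by subtracting the mean \<open>c\<close>.\<close>

lemma weakly_constant:
  assumes m: "w \<in> borel_measurable borel" and per: "periodic w" and int: "integrable unif_sq w"
    and weak: "\<And>\<Psi>. smooth \<Psi> \<Longrightarrow> periodic \<Psi> \<Longrightarrow> (\<integral>x. divg (\<lambda>y. Rperp (\<Psi> y)) x * w x \<partial>unif_sq) = 0"
  shows "\<exists>c. AE x in lborel. w x = c"
proof -
  interpret prob_space unif_sq by (rule prob_space_unif_sq)
  define c where "c = (\<integral>x. w x \<partial>unif_sq)"
  have cosint: "integrable unif_sq (\<lambda>x. cos (phase k x + a))" for k a
    using cos_phase_periodic[of "\<lambda>t. t"] by (intro integrable_cont_periodic[OF torus_prob_unif_sq] continuous_intros phase_cont)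
  interpret W: wave_orthogonal "\<lambda>x. w x - c"
  proof
    show "(\<lambda>x. w x - c) \<in> borel_measurable borel" using m by simp
    show "integrable unif_sq (\<lambda>x. w x - c)" using int by simp
    fix k :: "int \<times> int" and a
    have "integrable unif_sq (\<lambda>x. w x * cos (phase k x + a))"
    proof (rule Bochner_Integration.integrable_bound[OF integrable_abs[OF int]])
      have "(\<lambda>x. cos (phase k x + a)) \<in> borel_measurable borel"
        by (intro borel_measurable_continuous_onI continuous_intros phase_cont)
      then show "(\<lambda>x. w x * cos (phase k x + a)) \<in> borel_measurable unif_sq"
        using m by (simp cong: measurable_cong_sets)
      have "\<bar>w x\<bar> * \<bar>cos (phase k x + a)\<bar> \<le> \<bar>w x\<bar> * 1" for x by (intro mult_left_mono) auto
      then show "AE x in unif_sq. norm (w x * cos (phase k x + a)) \<le> norm \<bar>w x\<bar>" by (simp add: abs_mult)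
    qed
    then have eq: "(\<integral>x. (w x - c) * cos (phase k x + a) \<partial>unif_sq)
        = (\<integral>x. w x * cos (phase k x + a) \<partial>unif_sq) - c * (\<integral>x. cos (phase k x + a) \<partial>unif_sq)"
      using cosint by (simp add: left_diff_distrib)
    show "(\<integral>x. (w x - c) * cos (phase k x + a) \<partial>unif_sq) = 0"
    proof (cases "k = 0")
      case True
      then show ?thesis unfolding eq by (simp add: phase_def c_def prob_space[simplified])
    next
      case False
      define r :: real where "r = 2 * pi * ((of_int (fst k))\<^sup>2 + (of_int (snd k))\<^sup>2)"
      have "r \<noteq> 0" using False by (auto simp: r_def prod_eq_iff)
      \<comment> \<open>The multiple of the rotated frequency for which the factor in
        \<open>divg_Rperp_wave\<close> becomes 1.\<close>
      define v :: "real \<times> real" where "v = (- of_int (snd k) / r, of_int (fst k) / r)"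
      have v: "2 * pi * (of_int (fst k) * snd v - of_int (snd k) * fst v) = 1"
      proof -
        have "2 * pi * (of_int (fst k) * snd v - of_int (snd k) * fst v) = 2 * pi * ((of_int (fst k))\<^sup>2 + (of_int (snd k))\<^sup>2) / r"
          unfolding v_def by (simp add: power2_eq_square add_divide_distrib distrib_left)
        also have "\<dots> = r / r" by (simp only: r_def)
        finally show ?thesis using \<open>r \<noteq> 0\<close> by simp
      qed
      \<comment> \<open>The phase shift by \<open>- pi / 2\<close> compensates the one produced by
        differentiation.\<close>
      let ?\<Psi> = "wave k (a - pi / 2) v"
      have d: "divg (\<lambda>y. Rperp (?\<Psi> y)) x = cos (phase k x + a)" for x
        unfolding divg_Rperp_wave v by simp
      have 1: "(\<integral>x. w x * cos (phase k x + a) \<partial>unif_sq) = 0"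
        using weak[OF smooth_wave[of k "a - pi/2" v] periodic_wave] unfolding d by (simp add: mult.commute)
      have C: "C1grad (wave k (a - pi / 2) v') (wave k a (phase k (1,0) * v')) (wave k a (phase k (0,1) * v'))" for v' :: real
        using Ck_C1grad[OF Ck_wave[of "Suc 0" k "a - pi/2" v'] periodic_wave] unfolding partial_wave by simp
      have "(\<integral>x. cos (phase k x + a) \<partial>unif_sq) = 0"
      proof (cases "fst k = 0")
        case True
        then have "snd k \<noteq> 0" using False by (simp add: prod_eq_iff)
        then show ?thesis using C1grad_integral_zero(2)[OF C, of 1] by (simp add: wave_def phase_def)
      next
        case False
        then show ?thesis using C1grad_integral_zero(1)[OF C, of 1] by (simp add: wave_def phase_def)
      qed
      with 1 show ?thesis unfolding eq by simp
    qed
  qed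
  have "AE x in unif_sq. w x = c" using W.AE_zero by simp
  then have "AE x in lborel. w x = c"
  proof (rule AE_lborel_of_unif_sq)
    show "(w (fract x) = c) \<longleftrightarrow> (w x = c)" for x using periodic_fract[OF per] by simp
    show "{x. w x = c} \<in> sets borel" using measurable_sets[OF m, of "{c}"] by (simp add: vimage_def)
  qed
  then show ?thesis by blast
qed

section \<open>Periodization and bounded variation\<close>

text \<open>The image under \<open>T\<close> of counting measure times \<open>P\<close>, weighted by
  \<open>W\<close>, is a countable sum of image measures. It is locally finite because a compact set
  is reached by finitely many indices, and for the same reason integrals reduce to finite
  sums.\<close>

lemma locally_finite_image_measure:
  fixes T :: "'j::countable \<Rightarrow> 'z \<Rightarrow> real \<times> real" and W :: "'j \<Rightarrow> 'z \<Rightarrow> real"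
  assumes "prob_space P" and T: "\<And>j. T j \<in> borel_measurable P" and W: "\<And>j. W j \<in> borel_measurable P"
    and W0: "\<And>j z. 0 \<le> W j z" and WC: "\<And>j z. W j z \<le> C"
    and fin': "\<forall>K. compact K \<longrightarrow> finite {j. \<exists>z. T j z \<in> K}"
  shows "\<exists>M. sets M = sets borel \<and> (\<forall>K. compact K \<longrightarrow> emeasure M K < \<infinity>) \<and>
    (\<forall>\<phi> B J. \<phi> \<in> borel_measurable borel \<longrightarrow> (\<forall>x. \<bar>\<phi> x\<bar> \<le> B) \<longrightarrow> finite J
      \<longrightarrow> (\<forall>j z. \<phi> (T j z) \<noteq> 0 \<longrightarrow> j \<in> J)
      \<longrightarrow> (\<integral>x. \<phi> x \<partial>M) = (\<Sum>j\<in>J. \<integral>z. \<phi> (T j z) * W j z \<partial>P))"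
proof -
  note fin = fin'[rule_format]
  interpret P: prob_space P by fact
  interpret N: pair_sigma_finite "count_space (UNIV :: 'j set)" P
    by (intro pair_sigma_finite.intro sigma_finite_measure_count_space_countable P.sigma_finite_measure_axioms) auto
  let ?N = "count_space (UNIV :: 'j set) \<Otimes>\<^sub>M P"
  have Tm: "case_prod T \<in> borel_measurable ?N" and Wm: "case_prod W \<in> borel_measurable ?N"
    by (intro measurable_pair_measure_countable1; use T W in simp)+
  define M where "M = distr (density ?N (\<lambda>z. ennreal (case_prod W z))) borel (case_prod T)"
  have Tm': "case_prod T \<in> borel_measurable (density ?N (\<lambda>z. ennreal (case_prod W z)))" using Tm by simp
  have C0: "C \<ge> 0" using W0 WC order_trans by blast
  have strip: "emeasure ?N (J \<times> space P) < \<infinity>" if "finite J" for J :: "'j set"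
    using that by (subst P.emeasure_pair_measure_Times) (auto simp: P.emeasure_space_1 emeasure_count_space of_nat_less_top)
  have stripm: "J \<times> space P \<in> sets ?N" for J :: "'j set" by (intro pair_measureI) auto
  show ?thesis
  proof (intro exI[of _ M] conjI allI impI)
    show "sets M = sets borel" by (simp add: M_def)
    fix K :: "(real \<times> real) set" assume K: "compact K"
    let ?J = "{j. \<exists>z. T j z \<in> K}"
    have Kb: "K \<in> sets borel" using K by (simp add: borel_closed compact_imp_closed)
    then have "emeasure M K = (\<integral>\<^sup>+z. ennreal (case_prod W z) * indicator (case_prod T -` K \<inter> space ?N) z \<partial>?N)"
      unfolding M_def using Tm Wm by (subst emeasure_distr[OF Tm']) (auto simp: emeasure_density measurable_sets[OF Tm])
    also have "\<dots> \<le> (\<integral>\<^sup>+z. ennreal C * indicator (?J \<times> space P) z \<partial>?N)"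
      using WC C0 by (intro nn_integral_mono) (auto simp: indicator_def space_pair_measure ennreal_leI)
    also have "\<dots> = ennreal C * emeasure ?N (?J \<times> space P)"
      by (rule nn_integral_cmult_indicator[OF stripm])
    also have "\<dots> < \<infinity>" using strip[OF fin[OF K]] by (simp add: ennreal_mult_less_top)
    finally show "emeasure M K < \<infinity>" .
  next
    fix \<phi> :: "real \<times> real \<Rightarrow> real" and B and J :: "'j set"
    assume \<phi>': "\<phi> \<in> borel_measurable borel" "\<forall>x. \<bar>\<phi> x\<bar> \<le> B" "finite J" "\<forall>j z. \<phi> (T j z) \<noteq> 0 \<longrightarrow> j \<in> J"
    note \<phi> = \<phi>'(1) \<phi>'(2)[rule_format] \<phi>'(3) \<phi>'(4)[rule_format]
    have B0: "B \<ge> 0" using \<phi>(2)[of 0] by linarith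
    let ?f = "\<lambda>z. \<phi> (case_prod T z) * case_prod W z"
    have fm: "?f \<in> borel_measurable ?N" using Tm Wm \<phi>(1) by (intro borel_measurable_times measurable_compose[OF Tm]) auto
    have "integrable ?N (\<lambda>z. B * C * indicator (J \<times> space P) z :: real)"
      using strip[OF \<phi>(3)] stripm by (intro integrable_mult_right integrable_real_indicator) auto
    then have int: "integrable ?N ?f"
    proof (rule Bochner_Integration.integrable_bound[OF _ fm])
      show "AE z in ?N. norm (?f z) \<le> norm (B * C * indicator (J \<times> space P) z :: real)"
      proof (rule AE_I2)
        fix z assume "z \<in> space ?N"
        then obtain j y where z: "z = (j, y)" "y \<in> space P" by (auto simp: space_pair_measure)
        have "\<bar>\<phi> (T j y) * W j y\<bar> \<le> B * C"
          unfolding abs_mult using \<phi>(2)[of "T j y"] W0[of j y] WC[of j y] B0 by (intro mult_mono) auto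
        then show "norm (?f z) \<le> norm (B * C * indicator (J \<times> space P) z :: real)"
          using z \<phi>(4)[of j y] B0 C0 by (auto simp: indicator_def)
      qed
    qed
    have "(\<integral>x. \<phi> x \<partial>M) = (\<integral>z. \<phi> (case_prod T z) \<partial>density ?N (\<lambda>z. ennreal (case_prod W z)))"
      unfolding M_def by (rule integral_distr[OF Tm' \<phi>(1)])
    also have "\<dots> = (\<integral>z. case_prod W z *\<^sub>R \<phi> (case_prod T z) \<partial>?N)"
      using W0 Wm measurable_compose[OF Tm \<phi>(1)] by (intro integral_density) auto
    also have "\<dots> = (\<integral>z. ?f z \<partial>?N)" by (simp add: mult.commute)
    also have "\<dots> = (\<integral>j. (\<integral>z. \<phi> (T j z) * W j z \<partial>P) \<partial>count_space UNIV)"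
      using N.integral_fst'[OF int] by simp
    also have "\<dots> = (\<Sum>j\<in>J. \<integral>z. \<phi> (T j z) * W j z \<partial>P)"
    proof -
      have "(\<integral>z. \<phi> (T j z) * W j z \<partial>P) = 0" if "j \<notin> J" for j
      proof -
        have "\<phi> (T j z) = 0" for z using \<phi>(4) that by blast
        then show ?thesis by simp
      qed
      then have sub: "{j. (\<integral>z. \<phi> (T j z) * W j z \<partial>P) \<noteq> 0} \<subseteq> J" by blast
      have "finite {j. (\<integral>z. \<phi> (T j z) * W j z \<partial>P) \<noteq> 0}" by (rule finite_subset[OF sub \<phi>(3)])
      then have "(\<integral>j. (\<integral>z. \<phi> (T j z) * W j z \<partial>P) \<partial>count_space UNIV) = (\<Sum>j | (\<integral>z. \<phi> (T j z) * W j z \<partial>P) \<noteq> 0. \<integral>z. \<phi> (T j z) * W j z \<partial>P)"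
        using lebesgue_integral_count_space_finite_support[of UNIV "\<lambda>j. \<integral>z. \<phi> (T j z) * W j z \<partial>P"] by simp
      also have "\<dots> = (\<Sum>j\<in>J. \<integral>z. \<phi> (T j z) * W j z \<partial>P)" using sub by (intro sum.mono_neutral_left \<phi>(3)) auto
      finally show ?thesis .
    qed
    finally show "(\<integral>x. \<phi> x \<partial>M) = (\<Sum>j\<in>J. \<integral>z. \<phi> (T j z) * W j z \<partial>P)" .
  qed
qed

section \<open>Lattice sums\<close>

definition lat :: "int \<times> int \<Rightarrow> real \<times> real" where
  "lat n = (of_int (fst n), of_int (snd n))"

lemma periodic_lat: "periodic f \<Longrightarrow> f (x + lat n) = f x"
  unfolding lat_def by (rule periodic_int)

lemma fract_lat: "x = fract x + lat (\<lfloor>fst x\<rfloor>, \<lfloor>snd x\<rfloor>)"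
  using fract_eq[of x] by (simp add: lat_def)

definition latball :: "real \<Rightarrow> (int \<times> int) set" where
  "latball r = {n. norm (lat n) \<le> r}"

lemma finite_latball: "finite (latball r)"
proof (rule finite_subset)
  show "latball r \<subseteq> {- \<lceil>r\<rceil>..\<lceil>r\<rceil>} \<times> {- \<lceil>r\<rceil>..\<lceil>r\<rceil>}"
  proof
    fix n assume "n \<in> latball r"
    then have "\<bar>of_int (fst n)\<bar> \<le> r" "\<bar>of_int (snd n)\<bar> \<le> r"
      using norm_fst_le[of "of_int (fst n) :: real" "of_int (snd n) :: real"] norm_snd_le[of "of_int (snd n) :: real" "of_int (fst n) :: real"]
      by (auto simp: latball_def lat_def)
    then have "\<bar>fst n\<bar> \<le> \<lceil>r\<rceil>" "\<bar>snd n\<bar> \<le> \<lceil>r\<rceil>" by (simp_all add: le_ceiling_iff)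
    then show "n \<in> {- \<lceil>r\<rceil>..\<lceil>r\<rceil>} \<times> {- \<lceil>r\<rceil>..\<lceil>r\<rceil>}" by (cases n) auto
  qed
qed auto

text \<open>Meant for functions of bounded support, where the index set is finite; over an infinite
  index set the sum would default to 0.\<close>

definition periodize :: "(real \<times> real \<Rightarrow> real) \<Rightarrow> real \<times> real \<Rightarrow> real" where
  "periodize f x = (\<Sum>n | f (x + lat n) \<noteq> 0. f (x + lat n))"

text \<open>On a ball the index set can be fixed independently of \<open>x\<close>, which makes
  continuity and differentiation termwise.\<close>

lemma periodize_eq:
  assumes f: "\<And>x. f x \<noteq> 0 \<Longrightarrow> norm x \<le> R" and x: "norm x \<le> r"
  shows "periodize f x = (\<Sum>n\<in>latball (R + r). f (x + lat n))"
  unfolding periodize_def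
proof (rule sum.mono_neutral_left[OF finite_latball])
  show "{n. f (x + lat n) \<noteq> 0} \<subseteq> latball (R + r)"
  proof
    fix n assume "n \<in> {n. f (x + lat n) \<noteq> 0}"
    then have "norm (x + lat n) \<le> R" using f by blast
    moreover have "norm (lat n) \<le> norm (x + lat n) + norm x" using norm_triangle_ineq4[of "x + lat n" x] by simp
    ultimately show "n \<in> latball (R + r)" using x by (simp add: latball_def)
  qed
qed auto

lemma periodize_periodic: "periodic (periodize f)"
proof -
  have "periodize f (x + lat k) = periodize f x" for x k
  proof -
    have l: "lat (n + k) = lat n + lat k" for n by (simp add: lat_def)
    have l': "lat (n - k) = lat n - lat k" for n by (simp add: lat_def)
    show ?thesis unfolding periodize_def
      by (rule sum.reindex_bij_witness[where i = "\<lambda>n. n - k" and j = "\<lambda>n. n + k"]) (auto simp: l l' add.commute add.left_commute)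
  qed
  from this[of _ "(1,0)"] this[of _ "(0,1)"] show ?thesis by (simp add: periodic_def lat_def)
qed

lemma periodize_cont:
  assumes f: "\<And>x. f x \<noteq> 0 \<Longrightarrow> norm x \<le> R" and c: "continuous_on UNIV f"
  shows "continuous_on UNIV (periodize f)"
proof (intro continuous_at_imp_continuous_on ballI)
  fix x :: "real \<times> real"
  let ?r = "norm x + 1"
  have "continuous_on (ball 0 ?r) (\<lambda>x. \<Sum>n\<in>latball (R + ?r). f (x + lat n))"
    by (intro continuous_intros continuous_on_compose2[OF c]) auto
  then have "continuous_on (ball 0 ?r) (periodize f)"
    by (rule continuous_on_cong[THEN iffD1, rotated 2]) (auto simp: periodize_eq[OF f, where r = ?r])
  then show "isCont (periodize f) x" by (rule continuous_on_interior) (simp add: interior_open)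
qed

lemma periodize_C1grad:
  assumes f: "\<And>x. f x \<noteq> 0 \<Longrightarrow> norm x \<le> R" "\<And>x. f1 x \<noteq> 0 \<Longrightarrow> norm x \<le> R" "\<And>x. f2 x \<noteq> 0 \<Longrightarrow> norm x \<le> R"
    and c: "continuous_on UNIV f1" "continuous_on UNIV f2"
    and d1: "\<And>a c. ((\<lambda>t. f (t, c)) has_real_derivative f1 (a, c)) (at a)"
    and d2: "\<And>a c. ((\<lambda>t. f (a, t)) has_real_derivative f2 (a, c)) (at c)"
  shows "C1grad (periodize f) (periodize f1) (periodize f2)"
proof (rule C1gradI[OF periodize_periodic periodize_cont[OF f(2) c(1)] periodize_cont[OF f(3) c(2)]])
  fix a s :: real
  \<comment> \<open>The margin 1 keeps one finite index set valid in a neighbourhood of the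
    point.\<close>
  let ?r = "\<bar>a\<bar> + \<bar>s\<bar> + 1"
  have nr: "norm (t, s') \<le> ?r" if "\<bar>t - a\<bar> + \<bar>s' - s\<bar> < 1" for t s'
    using norm_Pair_le[of t s'] that by simp
  have e1: "(a, s) + lat n = (a + of_int (fst n), s + of_int (snd n))" for a s n by (simp add: lat_def)
  have Da: "((\<lambda>t. \<Sum>n\<in>latball (R + ?r). f ((t, s) + lat n)) has_real_derivative (\<Sum>n\<in>latball (R + ?r). f1 ((a, s) + lat n))) (at a)"
    unfolding e1 by (intro DERIV_sum DERIV_shift[THEN iffD1] d1)
  have Ea: "(\<Sum>n\<in>latball (R + ?r). f1 ((a, s) + lat n)) = periodize f1 (a, s)"
    using periodize_eq[OF f(2), where x = "(a, s)" and r = ?r] nr by simp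
  show "((\<lambda>t. periodize f (t, s)) has_real_derivative periodize f1 (a, s)) (at a)"
  proof (rule has_field_derivative_transform_within_open[OF Da[unfolded Ea], of "ball a 1"])
    fix t assume "t \<in> ball a 1"
    then show "(\<Sum>n\<in>latball (R + ?r). f ((t, s) + lat n)) = periodize f (t, s)"
      by (intro periodize_eq[OF f(1), symmetric] nr) (auto simp: dist_real_def)
  qed auto
  have Ds: "((\<lambda>t. \<Sum>n\<in>latball (R + ?r). f ((a, t) + lat n)) has_real_derivative (\<Sum>n\<in>latball (R + ?r). f2 ((a, s) + lat n))) (at s)"
    unfolding e1 by (intro DERIV_sum DERIV_shift[THEN iffD1] d2)
  have Es: "(\<Sum>n\<in>latball (R + ?r). f2 ((a, s) + lat n)) = periodize f2 (a, s)"
    using periodize_eq[OF f(3), where x = "(a, s)" and r = ?r] nr by simp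
  show "((\<lambda>t. periodize f (a, t)) has_real_derivative periodize f2 (a, s)) (at s)"
  proof (rule has_field_derivative_transform_within_open[OF Ds[unfolded Es], of "ball s 1"])
    fix t assume "t \<in> ball s 1"
    then show "(\<Sum>n\<in>latball (R + ?r). f ((a, t) + lat n)) = periodize f (a, t)"
      by (intro periodize_eq[OF f(1), symmetric] nr) (auto simp: dist_real_def)
  qed auto
qed

lemma norm_unit_sq: "x \<in> unit_sq \<Longrightarrow> norm x \<le> 2"
  using norm_fract_le[of x] fract_id[of x] by simp

text \<open>Unfolding over the tiles of the plane: points of the cell have norm at most 2, so only
  tiles shifted by at most \<open>R + 2\<close> meet the support.\<close>

lemma integral_lborel_lattice:
  fixes f :: "real \<times> real \<Rightarrow> real"
  assumes m: "f \<in> borel_measurable borel" and supp: "\<And>x. f x \<noteq> 0 \<Longrightarrow> norm x \<le> R"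
    and int: "\<And>n. integrable unif_sq (\<lambda>x. f (x + lat n))"
  shows "(\<integral>x. f x \<partial>lborel) = (\<Sum>n\<in>latball (R + 2). \<integral>x. f (x + lat n) \<partial>unif_sq)"
proof -
  let ?g = "\<lambda>n x. f x * indicator unit_sq (x - lat n)"
  have dist: "lborel = distr lborel borel ((+) (lat n))" for n by (rule lborel_distr_plus[symmetric])
  have gm: "?g n \<in> borel_measurable borel" for n
    by (intro borel_measurable_times m measurable_compose[OF _ borel_measurable_indicator[OF unit_sq_borel]]) measurable
  have sh: "(\<lambda>x. ?g n (lat n + x)) = (\<lambda>x. indicator unit_sq x *\<^sub>R f (x + lat n))" for n
    by (auto simp: add.commute)
  have fm: "(\<lambda>x. f (x + lat n)) \<in> borel_measurable borel" for n using m by measurable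
  have gi: "integrable lborel (?g n)" for n
  proof -
    have "integrable lborel (\<lambda>x. ?g n (lat n + x))"
      unfolding sh using int[of n] integrable_unif_sq[OF fm[of n]] by (simp add: set_integrable_def)
    then have "integrable (distr lborel borel ((+) (lat n))) (?g n)"
      by (subst integrable_distr_eq) (auto intro: gm)
    then show ?thesis using dist[of n] by simp
  qed
  have gI: "(\<integral>x. ?g n x \<partial>lborel) = (\<integral>x. f (x + lat n) \<partial>unif_sq)" for n
  proof -
    have "(\<integral>x. ?g n x \<partial>lborel) = (\<integral>x. ?g n x \<partial>distr lborel borel ((+) (lat n)))" using dist[of n] by simp
    also have "\<dots> = (\<integral>x. ?g n (lat n + x) \<partial>lborel)" by (intro integral_distr gm) simp
    also have "\<dots> = (LINT x:unit_sq|lborel. f (x + lat n))" unfolding sh set_lebesgue_integral_def ..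
    finally show ?thesis by (simp add: integral_unif_sq[OF fm])
  qed
  have "f x = (\<Sum>n\<in>latball (R + 2). ?g n x)" for x
  proof (cases "f x = 0")
    case False
    let ?n = "(\<lfloor>fst x\<rfloor>, \<lfloor>snd x\<rfloor>)"
    have xl: "x - lat ?n = fract x" using fract_lat[of x] by (simp add: algebra_simps)
    have uniq: "n = ?n" if "x - lat n \<in> unit_sq" for n
      using that by (cases x, cases n) (auto simp: lat_def unit_sq_def intro!: floor_unique[symmetric])
    have "norm (lat ?n) \<le> norm x + norm (fract x)" using xl norm_triangle_ineq4[of x "fract x"] by (metis add_diff_cancel_left' fract_lat)
    then have "?n \<in> latball (R + 2)" using supp[OF False] norm_fract_le[of x] by (simp add: latball_def)
    then have "(\<Sum>n\<in>latball (R + 2). ?g n x) = (\<Sum>n\<in>{?n}. ?g n x)"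
      by (intro sum.mono_neutral_right finite_latball) (auto simp: indicator_def dest: uniq)
    then show ?thesis using xl fract_in[of x] by simp
  qed simp
  then have "(\<integral>x. f x \<partial>lborel) = (\<integral>x. (\<Sum>n\<in>latball (R + 2). ?g n x) \<partial>lborel)" by simp
  also have "\<dots> = (\<Sum>n\<in>latball (R + 2). \<integral>x. ?g n x \<partial>lborel)" by (intro Bochner_Integration.integral_sum gi)
  finally show ?thesis by (simp add: gI)
qed

lemma (in pair_prob_space) integral_pair_component:
  fixes f :: "'a \<Rightarrow> real" and g :: "'b \<Rightarrow> real"
  assumes "f \<in> borel_measurable M1" "g \<in> borel_measurable M2"
  shows "(\<integral>z. f (fst z) \<partial>(M1 \<Otimes>\<^sub>M M2)) = (\<integral>x. f x \<partial>M1)"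
    and "(\<integral>z. g (snd z) \<partial>(M1 \<Otimes>\<^sub>M M2)) = (\<integral>y. g y \<partial>M2)"
proof -
  show "(\<integral>z. f (fst z) \<partial>(M1 \<Otimes>\<^sub>M M2)) = (\<integral>x. f x \<partial>M1)"
    using integral_distr[of fst "M1 \<Otimes>\<^sub>M M2" M1 f] assms(1) M2.distr_pair_fst[of M1] by simp
  have "(\<integral>z. g (snd z) \<partial>(M1 \<Otimes>\<^sub>M M2)) = (\<integral>z. g (fst z) \<partial>(M2 \<Otimes>\<^sub>M M1))"
    using integral_product_swap[of "\<lambda>z. g (snd z)"] assms(2) by (simp add: case_prod_unfold)
  also have "\<dots> = (\<integral>y. g y \<partial>M2)"
    using integral_distr[of fst "M2 \<Otimes>\<^sub>M M1" M2 g] assms(2) M1.distr_pair_fst[of M2] by simp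
  finally show "(\<integral>z. g (snd z) \<partial>(M1 \<Otimes>\<^sub>M M2)) = (\<integral>y. g y \<partial>M2)" .
qed

text \<open>The periodic extension of \<open>c \<mu> + q dx\<close>, written as a difference of two
  locally finite measures by splitting \<open>c\<close> and \<open>q\<close> into positive and
  negative parts. Testing it against \<open>\<phi>\<close> on the plane is testing the torus measure
  against \<open>periodize \<phi>\<close>.\<close>

lemma periodized_measures:
  assumes \<mu>: "torus_prob \<mu>" and c: "continuous_on UNIV c" "periodic c"
  obtains Mp Mn where "sets Mp = sets borel" "sets Mn = sets borel"
    "\<And>K. compact K \<Longrightarrow> emeasure Mp K < \<infinity> \<and> emeasure Mn K < \<infinity>"
    "\<And>\<phi> R. continuous_on UNIV \<phi> \<Longrightarrow> (\<And>x. \<phi> x \<noteq> 0 \<Longrightarrow> norm x \<le> R) \<Longrightarrow>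
       (\<integral>x. \<phi> x \<partial>Mp) - (\<integral>x. \<phi> x \<partial>Mn) = (\<integral>x. periodize \<phi> x * c x \<partial>\<mu>) + q * (\<integral>x. periodize \<phi> x \<partial>unif_sq)"
proof -
  interpret mu: prob_space \<mu> using torus_probD[OF \<mu>] by simp
  interpret U: prob_space unif_sq by (rule prob_space_unif_sq)
  interpret PU: pair_prob_space \<mu> unif_sq ..
  let ?P = "\<mu> \<Otimes>\<^sub>M unif_sq"
  have setsP: "sets ?P = sets (borel \<Otimes>\<^sub>M borel)" using torus_probD(1)[OF \<mu>] by (intro sets_pair_measure_cong) auto
  \<comment> \<open>The Boolean selects whether the \<open>\<mu>\<close> coordinate or the Lebesgue
    coordinate of the product space is placed in the tile; this way both summands come from one
    probability space.\<close>
  define T :: "(int \<times> int) \<times> bool \<Rightarrow> (real \<times> real) \<times> (real \<times> real) \<Rightarrow> real \<times> real"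
    where "T j z = fract (if snd j then fst z else snd z) + lat (fst j)" for j z
  have Tm: "T j \<in> borel_measurable ?P" for j
    unfolding T_def by (cases "snd j") (simp_all add: measurable_cong_sets[OF setsP refl])
  have fin: "finite {j. \<exists>z. T j z \<in> K}" if "compact K" for K
  proof -
    obtain B where B: "\<And>x. x \<in> K \<Longrightarrow> norm x \<le> B" using compact_imp_bounded[OF \<open>compact K\<close>] by (auto simp: bounded_iff)
    have "fst j \<in> latball (B + 2)" if "T j z \<in> K" for j z
    proof -
      let ?y = "fract (if snd j then fst z else snd z)"
      have "norm (lat (fst j)) \<le> norm (T j z) + norm ?y" using norm_triangle_ineq4[of "T j z" ?y] by (simp add: T_def)
      then show ?thesis using B[OF that] norm_fract_le[of "if snd j then fst z else snd z"] by (simp add: latball_def)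
    qed
    then have "{j. \<exists>z. T j z \<in> K} \<subseteq> latball (B + 2) \<times> UNIV" by auto
    then show ?thesis by (rule finite_subset) (simp add: finite_latball)
  qed
  \<comment> \<open>The construction for nonnegative density \<open>p\<close> and constant
    \<open>r\<close>; it is used once for the positive and once for the negative parts.\<close>
  have half: "\<exists>M. sets M = sets borel \<and> (\<forall>K. compact K \<longrightarrow> emeasure M K < \<infinity>) \<and>
     (\<forall>\<phi> R. continuous_on UNIV \<phi> \<longrightarrow> (\<forall>x. \<phi> x \<noteq> 0 \<longrightarrow> norm x \<le> R) \<longrightarrow>
       (\<integral>x. \<phi> x \<partial>M) = (\<integral>x. periodize \<phi> x * p x \<partial>\<mu>) + r * (\<integral>x. periodize \<phi> x \<partial>unif_sq))"
    if p: "continuous_on UNIV p" "periodic p" "\<And>x. p x \<ge> 0" and r: "r \<ge> (0::real)" for p r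
  proof -
    obtain C where C: "\<And>x. norm (p x) \<le> C" using periodic_bounded[OF p(2,1)] by blast
    define W :: "(int \<times> int) \<times> bool \<Rightarrow> (real \<times> real) \<times> (real \<times> real) \<Rightarrow> real"
      where "W j z = (if snd j then p (fst z) else r)" for j z
    have pm: "p \<in> borel_measurable borel" by (rule borel_measurable_continuous_onI[OF p(1)])
    have Wm: "W j \<in> borel_measurable ?P" for j
      unfolding W_def using pm by (cases "snd j") (simp_all add: measurable_cong_sets[OF setsP refl])
    have W0: "0 \<le> W j z" "W j z \<le> max C r" for j z
      using p(3)[of "fst z"] C[of "fst z"] r by (auto simp: W_def)
    have fin': "\<forall>K. compact K \<longrightarrow> finite {j. \<exists>z. T j z \<in> K}" using fin by blast
    from locally_finite_image_measure[of ?P T W "max C r", OF PU.prob_space_axioms Tm Wm W0 fin']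
    obtain M where M0: "sets M = sets borel \<and> (\<forall>K. compact K \<longrightarrow> emeasure M K < \<infinity>) \<and>
      (\<forall>\<phi> B J. \<phi> \<in> borel_measurable borel \<longrightarrow> (\<forall>x. \<bar>\<phi> x\<bar> \<le> B) \<longrightarrow> finite J
        \<longrightarrow> (\<forall>j z. \<phi> (T j z) \<noteq> 0 \<longrightarrow> j \<in> J)
        \<longrightarrow> (\<integral>x. \<phi> x \<partial>M) = (\<Sum>j\<in>J. \<integral>z. \<phi> (T j z) * W j z \<partial>?P))"
      by (rule exE)
    note M = M0[THEN conjunct1] M0[THEN conjunct2, THEN conjunct1, rule_format] M0[THEN conjunct2, THEN conjunct2, rule_format]
    have "(\<integral>x. \<phi> x \<partial>M) = (\<integral>x. periodize \<phi> x * p x \<partial>\<mu>) + r * (\<integral>x. periodize \<phi> x \<partial>unif_sq)"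
      if \<phi>: "continuous_on UNIV \<phi>" "\<And>x. \<phi> x \<noteq> 0 \<Longrightarrow> norm x \<le> R" for \<phi> R
    proof -
      have m\<phi>: "\<phi> \<in> borel_measurable borel" by (rule borel_measurable_continuous_onI[OF \<phi>(1)])
      have "bounded (\<phi> ` cball 0 R)"
        by (intro compact_imp_bounded compact_continuous_image continuous_on_subset[OF \<phi>(1)]) auto
      then obtain B0 where B0: "B0 > 0" "\<And>x. x \<in> cball 0 R \<Longrightarrow> \<bar>\<phi> x\<bar> \<le> B0" by (force simp: bounded_pos)
      have B: "\<bar>\<phi> x\<bar> \<le> B0" for x using B0 \<phi>(2)[of x] by (cases "\<phi> x = 0") auto
      let ?F = "latball (R + 2)"
      have pe: "periodize \<phi> x = (\<Sum>n\<in>?F. \<phi> (fract x + lat n))" for x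
        using periodize_eq[OF \<phi>(2) norm_fract_le] periodic_fract[OF periodize_periodic[of \<phi>], of x] by simp
      have inJ: "j \<in> ?F \<times> UNIV" if "\<phi> (T j z) \<noteq> 0" for j z
      proof -
        let ?y = "fract (if snd j then fst z else snd z)"
        have "norm (lat (fst j)) \<le> norm (T j z) + norm ?y" using norm_triangle_ineq4[of "T j z" ?y] by (simp add: T_def)
        then show ?thesis using \<phi>(2)[OF that] norm_fract_le[of "if snd j then fst z else snd z"] by (cases j) (simp add: latball_def)
      qed
      have fm: "(\<lambda>x. \<phi> (fract x + lat n)) \<in> borel_measurable borel" for n
        by (intro measurable_compose[OF _ m\<phi>] borel_measurable_add fract_measurable) simp
      have i1: "integrable \<mu> (\<lambda>x. \<phi> (fract x + lat n) * p x)" for n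
      proof (rule mu.integrable_const_bound[of _ "B0 * C"])
        show "AE x in \<mu>. norm (\<phi> (fract x + lat n) * p x) \<le> B0 * C"
        proof (rule AE_I2)
          fix x show "norm (\<phi> (fract x + lat n) * p x) \<le> B0 * C"
            unfolding norm_mult using B[of "fract x + lat n"] C[of x] B0(1) by (intro mult_mono) simp_all
        qed
        show "(\<lambda>x. \<phi> (fract x + lat n) * p x) \<in> borel_measurable \<mu>"
          using fm pm torus_probD(1)[OF \<mu>] by (simp cong: measurable_cong_sets)
      qed
      have i2: "integrable unif_sq (\<lambda>x. \<phi> (fract x + lat n))" for n
        using B[of "fract _ + lat n"] fm[of n] by (intro U.integrable_const_bound[of _ B0] AE_I2) (simp_all add: measurable_cong_sets[OF sets_unif_sq refl])
      have "(\<integral>x. \<phi> x \<partial>M) = (\<Sum>j\<in>?F \<times> UNIV. \<integral>z. \<phi> (T j z) * W j z \<partial>?P)"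
        by (rule M(3)[OF m\<phi> B]) (use inJ finite_latball in auto)
      also have "\<dots> = (\<Sum>n\<in>?F. \<Sum>t\<in>UNIV. \<integral>z. \<phi> (T (n, t) z) * W (n, t) z \<partial>?P)"
        by (simp add: sum.cartesian_product case_prod_unfold)
      also have "\<dots> = (\<Sum>n\<in>?F. (\<integral>x. \<phi> (fract x + lat n) * p x \<partial>\<mu>) + r * (\<integral>x. \<phi> (fract x + lat n) \<partial>unif_sq))"
      proof (rule sum.cong[OF refl])
        fix n
        note C = PU.integral_pair_component[OF borel_measurable_integrable[OF i1[of n]] borel_measurable_integrable[OF i2[of n]]]
        have "(\<integral>z. \<phi> (T (n, True) z) * W (n, True) z \<partial>?P) = (\<integral>x. \<phi> (fract x + lat n) * p x \<partial>\<mu>)"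
          using C(1) by (simp add: T_def W_def)
        moreover have "(\<integral>z. \<phi> (T (n, False) z) * W (n, False) z \<partial>?P) = r * (\<integral>x. \<phi> (fract x + lat n) \<partial>unif_sq)"
          using C(2) by (simp add: T_def W_def mult.commute)
        ultimately show "(\<Sum>t\<in>UNIV. \<integral>z. \<phi> (T (n, t) z) * W (n, t) z \<partial>?P) = (\<integral>x. \<phi> (fract x + lat n) * p x \<partial>\<mu>) + r * (\<integral>x. \<phi> (fract x + lat n) \<partial>unif_sq)"
          by (simp add: UNIV_bool add.commute)
      qed
      also have "\<dots> = (\<integral>x. (\<Sum>n\<in>?F. \<phi> (fract x + lat n) * p x) \<partial>\<mu>) + r * (\<integral>x. (\<Sum>n\<in>?F. \<phi> (fract x + lat n)) \<partial>unif_sq)"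
        using i1 i2 by (simp add: sum.distrib sum_distrib_left Bochner_Integration.integral_sum)
      finally show ?thesis unfolding pe by (simp add: sum_distrib_right)
    qed
    note rep = this
    show ?thesis
    proof (intro exI[of _ M] conjI allI impI)
      fix \<phi> :: "real \<times> real \<Rightarrow> real" and R
      assume "continuous_on UNIV \<phi>" and s: "\<forall>x. \<phi> x \<noteq> 0 \<longrightarrow> norm x \<le> R"
      then show "(\<integral>x. \<phi> x \<partial>M) = (\<integral>x. periodize \<phi> x * p x \<partial>\<mu>) + r * (\<integral>x. periodize \<phi> x \<partial>unif_sq)"
        by (intro rep[OF _ s[rule_format]])
    qed (fact M)+
  qed
  have "continuous_on UNIV (\<lambda>x. max 0 (c x))" "periodic (\<lambda>x. max 0 (c x))"
    using c by (auto intro!: continuous_intros simp: periodic_def)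
  from half[OF this max.cobounded1 max.cobounded1[of 0 "q"]]
  obtain Mp where Mp0: "sets Mp = sets borel \<and> (\<forall>K. compact K \<longrightarrow> emeasure Mp K < \<infinity>) \<and>
     (\<forall>\<phi> R. continuous_on UNIV \<phi> \<longrightarrow> (\<forall>x. \<phi> x \<noteq> 0 \<longrightarrow> norm x \<le> R) \<longrightarrow>
       (\<integral>x. \<phi> x \<partial>Mp) = (\<integral>x. periodize \<phi> x * max 0 (c x) \<partial>\<mu>) + max 0 (q) * (\<integral>x. periodize \<phi> x \<partial>unif_sq))"
    by (rule exE)
  note Mp = Mp0[THEN conjunct1] Mp0[THEN conjunct2, THEN conjunct1, rule_format] Mp0[THEN conjunct2, THEN conjunct2, rule_format]
  have "continuous_on UNIV (\<lambda>x. max 0 (- c x))" "periodic (\<lambda>x. max 0 (- c x))"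
    using c by (auto intro!: continuous_intros simp: periodic_def)
  from half[OF this max.cobounded1 max.cobounded1[of 0 "- q"]]
  obtain Mn where Mn0: "sets Mn = sets borel \<and> (\<forall>K. compact K \<longrightarrow> emeasure Mn K < \<infinity>) \<and>
     (\<forall>\<phi> R. continuous_on UNIV \<phi> \<longrightarrow> (\<forall>x. \<phi> x \<noteq> 0 \<longrightarrow> norm x \<le> R) \<longrightarrow>
       (\<integral>x. \<phi> x \<partial>Mn) = (\<integral>x. periodize \<phi> x * max 0 (- c x) \<partial>\<mu>) + max 0 (- q) * (\<integral>x. periodize \<phi> x \<partial>unif_sq))"
    by (rule exE)
  note Mn = Mn0[THEN conjunct1] Mn0[THEN conjunct2, THEN conjunct1, rule_format] Mn0[THEN conjunct2, THEN conjunct2, rule_format]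
  show ?thesis
  proof (rule that[OF Mp(1) Mn(1)])
    show "emeasure Mp K < \<infinity> \<and> emeasure Mn K < \<infinity>" if "compact K" for K using Mp(2) Mn(2) that by blast
    fix \<phi> :: "real \<times> real \<Rightarrow> real" and R assume \<phi>: "continuous_on UNIV \<phi>" "\<And>x. \<phi> x \<noteq> 0 \<Longrightarrow> norm x \<le> R"
    have eqs: "(\<integral>x. \<phi> x \<partial>Mp) = (\<integral>x. periodize \<phi> x * max 0 (c x) \<partial>\<mu>) + max 0 q * (\<integral>x. periodize \<phi> x \<partial>unif_sq)"
      "(\<integral>x. \<phi> x \<partial>Mn) = (\<integral>x. periodize \<phi> x * max 0 (- c x) \<partial>\<mu>) + max 0 (- q) * (\<integral>x. periodize \<phi> x \<partial>unif_sq)"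
      by (rule Mp(3)[OF \<phi>(1)], erule \<phi>(2)) (rule Mn(3)[OF \<phi>(1)], erule \<phi>(2))
    have pp: "continuous_on UNIV (periodize \<phi>)" "periodic (periodize \<phi>)"
      using periodize_cont[OF \<phi>(2,1)] periodize_periodic by auto
    have i: "integrable \<mu> (\<lambda>x. periodize \<phi> x * max 0 (c x))" "integrable \<mu> (\<lambda>x. periodize \<phi> x * max 0 (- c x))"
      using pp c by (auto intro!: integrable_cont_periodic[OF \<mu>] continuous_intros simp: periodic_def)
    have "(\<integral>x. periodize \<phi> x * c x \<partial>\<mu>) = (\<integral>x. periodize \<phi> x * max 0 (c x) - periodize \<phi> x * max 0 (- c x) \<partial>\<mu>)"
      by (rule Bochner_Integration.integral_cong) (auto simp: max_def)
    then have "(\<integral>x. periodize \<phi> x * c x \<partial>\<mu>) = (\<integral>x. periodize \<phi> x * max 0 (c x) \<partial>\<mu>) - (\<integral>x. periodize \<phi> x * max 0 (- c x) \<partial>\<mu>)"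
      using i by simp
    moreover have "q * (\<integral>x. periodize \<phi> x \<partial>unif_sq) =
        max 0 q * (\<integral>x. periodize \<phi> x \<partial>unif_sq) - max 0 (- q) * (\<integral>x. periodize \<phi> x \<partial>unif_sq)"
      by (simp add: max_def)
    ultimately show "(\<integral>x. \<phi> x \<partial>Mp) - (\<integral>x. \<phi> x \<partial>Mn) = (\<integral>x. periodize \<phi> x * c x \<partial>\<mu>) + q * (\<integral>x. periodize \<phi> x \<partial>unif_sq)"
      using eqs by linarith
  qed
qed

lemma partial_support:
  assumes f: "\<And>x. f x \<noteq> 0 \<Longrightarrow> norm x \<le> R" and x: "partial i f x \<noteq> (0::real)"
  shows "norm (x :: real \<times> real) \<le> R"
proof (rule ccontr)
  assume "\<not> norm x \<le> R"
  define S where "S = {t. norm (x + t *\<^sub>R i) > R}"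
  have "open S" unfolding S_def by (intro open_Collect_less continuous_intros)
  moreover have "0 \<in> S" using \<open>\<not> norm x \<le> R\<close> by (simp add: S_def)
  moreover have "0 = f (x + t *\<^sub>R i)" if "t \<in> S" for t using that f[of "x + t *\<^sub>R i"] by (auto simp: S_def)
  ultimately have "((\<lambda>t. f (x + t *\<^sub>R i)) has_vector_derivative 0) (at 0)"
    by (intro has_vector_derivative_transform_within_open[OF has_vector_derivative_const, where S = S]) auto
  then have "partial i f x = 0" unfolding partial_def by (rule vector_derivative_at)
  with x show False by simp
qed

text \<open>The tiles are summed before integrating; periodicity lets \<open>u\<close> be taken out
  of the sum.\<close>

lemma integral_periodize:
  assumes u: "periodic u" "u \<in> borel_measurable borel" "integrable unif_sq u"
    and f: "continuous_on UNIV f" "\<And>x. f x \<noteq> 0 \<Longrightarrow> norm x \<le> R"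
  shows "(\<integral>x. u x * f x \<partial>lborel) = (\<integral>x. u x * periodize f x \<partial>unif_sq)"
proof -
  have fm: "f \<in> borel_measurable borel" by (rule borel_measurable_continuous_onI[OF f(1)])
  have "bounded (f ` cball 0 R)"
    by (intro compact_imp_bounded compact_continuous_image continuous_on_subset[OF f(1)]) auto
  then obtain B0 where B0: "B0 > 0" "\<And>x. x \<in> cball 0 R \<Longrightarrow> \<bar>f x\<bar> \<le> B0" by (force simp: bounded_pos)
  have B: "\<bar>f x\<bar> \<le> B0" for x using B0 f(2)[of x] by (cases "f x = 0") auto
  have sm: "(\<lambda>x. f (x + lat n)) \<in> borel_measurable borel" for n using fm by measurable
  have int: "integrable unif_sq (\<lambda>x. u x * f (x + lat n))" for n
  proof (rule Bochner_Integration.integrable_bound)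
    show "integrable unif_sq (\<lambda>x. \<bar>u x\<bar> * B0)" using u(3) by simp
    show "(\<lambda>x. u x * f (x + lat n)) \<in> borel_measurable unif_sq" using u(2) sm by (simp cong: measurable_cong_sets)
    show "AE x in unif_sq. norm (u x * f (x + lat n)) \<le> norm (\<bar>u x\<bar> * B0)"
    proof (rule AE_I2)
      fix x show "norm (u x * f (x + lat n)) \<le> norm (\<bar>u x\<bar> * B0)"
        using mult_left_mono[OF B[of "x + lat n"] abs_ge_zero[of "u x"]] B0(1) by (simp add: abs_mult)
    qed
  qed
  have "(\<integral>x. u x * f x \<partial>lborel) = (\<Sum>n\<in>latball (R + 2). \<integral>x. u (x + lat n) * f (x + lat n) \<partial>unif_sq)"
  proof (rule integral_lborel_lattice)
    show "(\<lambda>x. u x * f x) \<in> borel_measurable borel" using u(2) fm by simp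
    show "norm x \<le> R" if "u x * f x \<noteq> 0" for x using f(2)[of x] that by simp
    show "integrable unif_sq (\<lambda>x. u (x + lat n) * f (x + lat n))" for n using int by (simp add: periodic_lat[OF u(1)])
  qed
  also have "\<dots> = (\<Sum>n\<in>latball (R + 2). \<integral>x. u x * f (x + lat n) \<partial>unif_sq)" by (simp add: periodic_lat[OF u(1)])
  also have "\<dots> = (\<integral>x. (\<Sum>n\<in>latball (R + 2). u x * f (x + lat n)) \<partial>unif_sq)"
    by (intro Bochner_Integration.integral_sum[symmetric] int)
  also have "\<dots> = (\<integral>x. u x * periodize f x \<partial>unif_sq)"
  proof (rule integral_cong_AE)
    show "(\<lambda>x. \<Sum>n\<in>latball (R + 2). u x * f (x + lat n)) \<in> borel_measurable unif_sq"
      using int by (intro borel_measurable_sum borel_measurable_integrable)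
    show "(\<lambda>x. u x * periodize f x) \<in> borel_measurable unif_sq"
      using u(2) borel_measurable_continuous_onI[OF periodize_cont[OF f(2,1)]] by (simp cong: measurable_cong_sets)
    show "AE x in unif_sq. (\<Sum>n\<in>latball (R + 2). u x * f (x + lat n)) = u x * periodize f x"
      using AE_unif_sq_in
    proof eventually_elim
      case (elim x)
      then show ?case using periodize_eq[OF f(2) norm_unit_sq[OF elim]] by (simp add: sum_distrib_left)
    qed
  qed
  finally show ?thesis .
qed

text \<open>Periodizing a test function moves the distributional derivative to the torus, where the
  derivative rules of \<open>stream_fun\<close> apply. With \<open>m = mean \<mu> b\<close> they
  give \<open>\<partial>\<^sub>1 u = - b\<^sub>2 \<mu> + m\<^sub>2 dx\<close> and
  \<open>\<partial>\<^sub>2 u = b\<^sub>1 \<mu> - m\<^sub>1 dx\<close>.\<close>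

lemma (in invariant_flow) stream_BV:
  assumes u: "periodic u" "u \<in> borel_measurable borel" "integrable unif_sq (\<lambda>x. (u x)\<^sup>2)"
    and rep: "\<And>\<phi>. continuous_on UNIV \<phi> \<Longrightarrow> periodic \<phi> \<Longrightarrow> stream_fun \<phi> = (\<integral>x. u x * \<phi> x \<partial>unif_sq)"
  shows "BV_per u"
proof -
  have u1: "integrable unif_sq u" by (rule integrable_unif_sq_of_square[OF u(2,3)])
  let ?m = "mean \<mu> b"
  obtain P1 N1 where 1: "sets P1 = sets borel" "sets N1 = sets borel"
    "\<And>K. compact K \<Longrightarrow> emeasure P1 K < \<infinity> \<and> emeasure N1 K < \<infinity>"
    "\<And>\<phi> R. continuous_on UNIV \<phi> \<Longrightarrow> (\<And>x. \<phi> x \<noteq> 0 \<Longrightarrow> norm x \<le> R) \<Longrightarrow>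
       (\<integral>x. \<phi> x \<partial>P1) - (\<integral>x. \<phi> x \<partial>N1) = (\<integral>x. periodize \<phi> x * (- snd (b x)) \<partial>\<mu>) + snd ?m * (\<integral>x. periodize \<phi> x \<partial>unif_sq)"
    by (rule periodized_measures[OF \<mu>, of "\<lambda>x. - snd (b x)" "snd ?m"])
      (auto intro!: continuous_intros b_cont simp: periodic_b_comp(2)[unfolded periodic_def] periodic_def)
  obtain P2 N2 where 2: "sets P2 = sets borel" "sets N2 = sets borel"
    "\<And>K. compact K \<Longrightarrow> emeasure P2 K < \<infinity> \<and> emeasure N2 K < \<infinity>"
    "\<And>\<phi> R. continuous_on UNIV \<phi> \<Longrightarrow> (\<And>x. \<phi> x \<noteq> 0 \<Longrightarrow> norm x \<le> R) \<Longrightarrow>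
       (\<integral>x. \<phi> x \<partial>P2) - (\<integral>x. \<phi> x \<partial>N2) = (\<integral>x. periodize \<phi> x * fst (b x) \<partial>\<mu>) + (- fst ?m) * (\<integral>x. periodize \<phi> x \<partial>unif_sq)"
    by (rule periodized_measures[OF \<mu>, of "\<lambda>x. fst (b x)" "- fst ?m"])
      (auto intro!: continuous_intros b_cont periodic_b_comp)
  have main: "(\<integral>x. u x * partial (1,0) \<phi> x \<partial>lborel) = - ((\<integral>x. \<phi> x \<partial>P1) - (\<integral>x. \<phi> x \<partial>N1)) \<and>
      (\<integral>x. u x * partial (0,1) \<phi> x \<partial>lborel) = - ((\<integral>x. \<phi> x \<partial>P2) - (\<integral>x. \<phi> x \<partial>N2))"
    if t: "test_fun \<phi>" for \<phi>
  proof -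
    have C: "Ck (Suc 0) \<phi>" using t unfolding test_fun_def smooth_def by blast
    have "bounded (closure {x. \<phi> x \<noteq> 0})" using t by (simp add: test_fun_def compact_imp_bounded)
    then obtain R where R: "\<And>x. x \<in> closure {x. \<phi> x \<noteq> 0} \<Longrightarrow> norm x \<le> R" by (auto simp: bounded_iff)
    have s: "norm x \<le> R" if "\<phi> x \<noteq> 0" for x
      using that closure_subset[of "{x. \<phi> x \<noteq> 0}"] by (intro R) auto
    have B: "(1,0) \<in> (Basis :: (real\<times>real) set)" "(0,1) \<in> (Basis :: (real\<times>real) set)" by (auto simp: Basis_prod_def)
    note c = Ck_cont[OF Ck_partial[OF C B(1)]] Ck_cont[OF Ck_partial[OF C B(2)]]
    note d = dir_deriv_shift[of \<phi> "partial (1,0) \<phi>" "partial (0,1) \<phi>",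
      OF partial_has_vector_derivative[OF C B(1)] partial_has_vector_derivative[OF C B(2)]]
    note s1 = partial_support[of \<phi> R "(1,0)", OF s] and s2 = partial_support[of \<phi> R "(0,1)", OF s]
    have G: "C1grad (periodize \<phi>) (periodize (partial (1,0) \<phi>)) (periodize (partial (0,1) \<phi>))"
      by (rule periodize_C1grad[OF s s1 s2 c d])
    have pc: "continuous_on UNIV (periodize (partial (1,0) \<phi>))" "continuous_on UNIV (periodize (partial (0,1) \<phi>))"
      using G by (auto simp: C1grad_def)
    have "(\<integral>x. u x * partial (1,0) \<phi> x \<partial>lborel) = stream_fun (periodize (partial (1,0) \<phi>))"
      using integral_periodize[OF u(1,2) u1 c(1) s1] rep[OF pc(1) periodize_periodic] by simp
    moreover have "(\<integral>x. u x * partial (0,1) \<phi> x \<partial>lborel) = stream_fun (periodize (partial (0,1) \<phi>))"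
      using integral_periodize[OF u(1,2) u1 c(2) s2] rep[OF pc(2) periodize_periodic] by simp
    ultimately show ?thesis
      using stream_fun_deriv1[OF G] stream_fun_deriv2[OF G] 1(4)[OF Ck_cont[OF C] s] 2(4)[OF Ck_cont[OF C] s] by simp
  qed
  let ?Mp = "\<lambda>i. if i = (1,0) then P1 else P2" and ?Mn = "\<lambda>i. if i = (1,0) then N1 else N2"
  have Bas: "(Basis :: (real\<times>real) set) = {(1,0), (0,1)}" by (auto simp: Basis_prod_def)
  have "\<forall>i\<in>(Basis :: (real \<times> real) set).
        sets (?Mp i) = sets borel \<and> sets (?Mn i) = sets borel \<and>
        (\<forall>K. compact K \<longrightarrow> emeasure (?Mp i) K < \<infinity> \<and> emeasure (?Mn i) K < \<infinity>) \<and>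
        (\<forall>\<phi>. test_fun \<phi> \<longrightarrow>
           (\<integral>x. u x * partial i \<phi> x \<partial>lborel) = - ((\<integral>x. \<phi> x \<partial>?Mp i) - (\<integral>x. \<phi> x \<partial>?Mn i)))"
    unfolding Bas using 1(1-3) 2(1-3) main by simp
  moreover have "set_integrable lborel unit_sq (\<lambda>x. (u x)\<^sup>2)" using u(2,3) by (subst integrable_unif_sq) auto
  ultimately show ?thesis unfolding BV_per_def using u(1,2) by (intro conjI exI[of _ ?Mp] exI[of _ ?Mn]) auto
qed

section \<open>Weak representation, Fourier coefficients and the bilinear formula\<close>

text \<open>Fubini in the only form needed: a bounded continuous kernel times a product of
  integrable functions, where the factors may be components of \<open>b\<close>, stream functions or
  1.\<close>

lemma double_integral_swap:
  fixes h :: "real \<times> real \<Rightarrow> real \<times> real \<Rightarrow> real"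
  assumes M: "torus_prob M" and N: "torus_prob N"
    and h: "continuous_on UNIV (case_prod h)" "periodic2 h"
    and f: "integrable M f" and g: "integrable N g"
  shows "(\<integral>y. (\<integral>x. h x y * (f x * g y) \<partial>M) \<partial>N) = (\<integral>x. (\<integral>y. h x y * (f x * g y) \<partial>N) \<partial>M)"
    and "integrable M (\<lambda>x. \<integral>y. h x y * (f x * g y) \<partial>N)"
    and "integrable N (\<lambda>y. \<integral>x. h x y * (f x * g y) \<partial>M)"
proof -
  interpret A: prob_space M using torus_probD[OF M] by simp
  interpret B: prob_space N using torus_probD[OF N] by simp
  interpret P: pair_prob_space M N ..
  note [measurable] = borel_measurable_integrable[OF f] borel_measurable_integrable[OF g]
  have sets: "sets (M \<Otimes>\<^sub>M N) = sets borel"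
    using torus_probD(1)[OF M] torus_probD(1)[OF N] by (simp add: borel_prod[symmetric] cong: sets_pair_measure_cong)
  obtain C where C: "C > 0" "\<And>x y. norm (h x y) \<le> C" using periodic2_bounded[OF h(2,1)] by blast
  have fg: "integrable (M \<Otimes>\<^sub>M N) (\<lambda>z. f (fst z) * g (snd z))"
  proof (rule P.Fubini_integrable)
    show "(\<lambda>z. f (fst z) * g (snd z)) \<in> borel_measurable (M \<Otimes>\<^sub>M N)" by measurable
    show "integrable M (\<lambda>x. \<integral>y. norm (f (fst (x, y)) * g (snd (x, y))) \<partial>N)"
      using f by (simp add: abs_mult)
    show "AE x in M. integrable N (\<lambda>y. f (fst (x, y)) * g (snd (x, y)))" using g by simp
  qed
  have "integrable (M \<Otimes>\<^sub>M N) (\<lambda>z. case_prod h z * (f (fst z) * g (snd z)))"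
  proof (rule Bochner_Integration.integrable_bound)
    show "integrable (M \<Otimes>\<^sub>M N) (\<lambda>z. C * \<bar>f (fst z) * g (snd z)\<bar>)" using fg by simp
    have "case_prod h \<in> borel_measurable (M \<Otimes>\<^sub>M N)"
      using borel_measurable_continuous_onI[OF h(1)] by (simp cong: measurable_cong_sets add: measurable_cong_sets[OF sets refl])
    then show "(\<lambda>z. case_prod h z * (f (fst z) * g (snd z))) \<in> borel_measurable (M \<Otimes>\<^sub>M N)" by measurable
    show "AE z in M \<Otimes>\<^sub>M N. norm (case_prod h z * (f (fst z) * g (snd z))) \<le> norm (C * \<bar>f (fst z) * g (snd z)\<bar>)"
    proof (rule AE_I2)
      fix z
      have "\<bar>case_prod h z\<bar> \<le> C" using C(2)[of "fst z" "snd z"] by (simp add: case_prod_unfold)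
      from mult_right_mono[OF this, of "\<bar>f (fst z) * g (snd z)\<bar>"] C(1)
      show "norm (case_prod h z * (f (fst z) * g (snd z))) \<le> norm (C * \<bar>f (fst z) * g (snd z)\<bar>)"
        by (simp add: abs_mult)
    qed
  qed
  then have I: "integrable (M \<Otimes>\<^sub>M N) (case_prod (\<lambda>x y. h x y * (f x * g y)))" by (simp add: case_prod_unfold)
  show "(\<integral>y. (\<integral>x. h x y * (f x * g y) \<partial>M) \<partial>N) = (\<integral>x. (\<integral>y. h x y * (f x * g y) \<partial>N) \<partial>M)"
    by (rule P.Fubini_integral[OF I])
  show "integrable M (\<lambda>x. \<integral>y. h x y * (f x * g y) \<partial>N)" by (rule P.integrable_fst[OF I])
  show "integrable N (\<lambda>y. \<integral>x. h x y * (f x * g y) \<partial>M)" by (rule P.integrable_snd[OF I])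
qed

text \<open>One of the two products in the determinant, with \<open>A\<close> and \<open>B\<close>
  standing for components of \<open>b\<close>. \<open>H1\<close> and \<open>H2\<close> are the weak
  equations in \<open>y\<close> and in \<open>x\<close>; \<open>r\<close> and \<open>D\<close>
  stand, up to sign, for a first and a mixed second derivative of \<open>\<rho>\<close>. The term
  with \<open>m * n\<close> is the one that survives unless the determinant of the means is
  zero.\<close>

lemma bilinear_half:
  fixes \<rho> r D :: "real \<times> real \<Rightarrow> real \<times> real \<Rightarrow> real"
  assumes \<mu>: "torus_prob \<mu>" and \<nu>: "torus_prob \<nu>"
    and \<rho>: "continuous_on UNIV (case_prod \<rho>)" "periodic2 \<rho>"
    and r: "continuous_on UNIV (case_prod r)" "periodic2 r"
    and A: "integrable \<mu> A" and B: "integrable \<nu> B" and u: "integrable unif_sq u" and v: "integrable unif_sq v"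
    and D: "continuous_on UNIV (case_prod D)" "periodic2 D"
    and H1: "\<And>x. (\<integral>y. \<rho> x y * B y \<partial>\<nu>) = n * (\<integral>y. \<rho> x y \<partial>unif_sq) + (\<integral>y. v y * r x y \<partial>unif_sq)"
    and H2: "\<And>y. (\<integral>x. r x y * A x \<partial>\<mu>) = m * (\<integral>x. r x y \<partial>unif_sq) + (\<integral>x. u x * D x y \<partial>unif_sq)"
  shows "(\<integral>y. (\<integral>x. \<rho> x y * (A x * B y) \<partial>\<mu>) \<partial>\<nu>) =
      n * (\<integral>x. (\<integral>y. \<rho> x y \<partial>unif_sq) * A x \<partial>\<mu>) + m * (\<integral>y. (\<integral>x. \<rho> x y \<partial>unif_sq) * B y \<partial>\<nu>)
      - m * n * (\<integral>x. (\<integral>y. \<rho> x y \<partial>unif_sq) \<partial>unif_sq) + (\<integral>y. (\<integral>x. D x y * (u x * v y) \<partial>unif_sq) \<partial>unif_sq)"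
proof -
  interpret U: prob_space unif_sq by (rule prob_space_unif_sq)
  let ?U = unif_sq
  note tU = torus_prob_unif_sq
  have one: "integrable ?U (\<lambda>_. 1 :: real)" by simp
  define P where "P x = (\<integral>y. \<rho> x y \<partial>?U)" for x
  define Q where "Q y = (\<integral>x. \<rho> x y \<partial>?U)" for y
  note s1 = double_integral_swap[OF \<mu> \<nu> \<rho> A B]
  note s2 = double_integral_swap[OF \<mu> tU \<rho> A one]
  note s3 = double_integral_swap[OF \<mu> tU r A v]
  note s4 = double_integral_swap[OF tU tU r one v]
  note s5 = double_integral_swap[OF tU tU D u v]
  note s6 = double_integral_swap[OF tU \<nu> \<rho> one B]
  note s7 = double_integral_swap[OF tU tU \<rho> one one]
  have iPA: "integrable \<mu> (\<lambda>x. P x * A x)" using s2(2) by (simp add: P_def)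
  have iP: "integrable ?U P" using s7(2) by (simp add: P_def[abs_def])
  have c1: "(\<integral>y. \<rho> x y * (A x * B y) \<partial>\<nu>) = n * (P x * A x) + (\<integral>y. r x y * (A x * v y) \<partial>?U)" for x
  proof -
    have "(\<integral>y. \<rho> x y * (A x * B y) \<partial>\<nu>) = A x * (\<integral>y. \<rho> x y * B y \<partial>\<nu>)" by (simp add: mult.left_commute)
    also have "\<dots> = n * (P x * A x) + A x * (\<integral>y. v y * r x y \<partial>?U)" unfolding H1 P_def by (simp add: algebra_simps)
    also have "A x * (\<integral>y. v y * r x y \<partial>?U) = (\<integral>y. r x y * (A x * v y) \<partial>?U)"
      by (subst integral_mult_right_zero[symmetric]) (simp add: mult_ac)
    finally show ?thesis .
  qed
  have c2: "(\<integral>x. r x y * (A x * v y) \<partial>\<mu>) = m * (\<integral>x. r x y * (1 * v y) \<partial>?U) + (\<integral>x. D x y * (u x * v y) \<partial>?U)" for y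
  proof -
    have "(\<integral>x. r x y * (A x * v y) \<partial>\<mu>) = v y * (\<integral>x. r x y * A x \<partial>\<mu>)"
      by (subst integral_mult_right_zero[symmetric]) (simp add: mult_ac)
    also have "\<dots> = m * (v y * (\<integral>x. r x y \<partial>?U)) + v y * (\<integral>x. u x * D x y \<partial>?U)" unfolding H2 by (simp add: algebra_simps)
    also have "v y * (\<integral>x. u x * D x y \<partial>?U) = (\<integral>x. D x y * (u x * v y) \<partial>?U)"
      by (subst integral_mult_right_zero[symmetric]) (simp add: mult_ac)
    also have "v y * (\<integral>x. r x y \<partial>?U) = (\<integral>x. r x y * (1 * v y) \<partial>?U)"
      by (subst integral_mult_right_zero[symmetric]) (simp add: mult_ac)
    finally show ?thesis .
  qed
  \<comment> \<open>The weak equation in \<open>y\<close> read backwards: the lower-order term left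
    by \<open>H2\<close> still contains \<open>v\<close>, and is turned into an integral against
    \<open>B\<close> again.\<close>
  have c3: "(\<integral>y. r x y * (1 * v y) \<partial>?U) = (\<integral>y. \<rho> x y * (1 * B y) \<partial>\<nu>) - n * P x" for x
    using H1[of x] by (simp add: P_def mult.commute)
  have "(\<integral>y. (\<integral>x. \<rho> x y * (A x * B y) \<partial>\<mu>) \<partial>\<nu>) = (\<integral>x. n * (P x * A x) + (\<integral>y. r x y * (A x * v y) \<partial>?U) \<partial>\<mu>)"
    unfolding s1(1) c1 ..
  also have "\<dots> = n * (\<integral>x. P x * A x \<partial>\<mu>) + (\<integral>y. (\<integral>x. r x y * (A x * v y) \<partial>\<mu>) \<partial>?U)"
    using iPA s3(2) by (simp add: s3(1))
  also have "(\<integral>y. (\<integral>x. r x y * (A x * v y) \<partial>\<mu>) \<partial>?U) =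
      m * (\<integral>y. (\<integral>x. r x y * (1 * v y) \<partial>?U) \<partial>?U) + (\<integral>y. (\<integral>x. D x y * (u x * v y) \<partial>?U) \<partial>?U)"
    unfolding c2 using s4(3) s5(3) by (subst Bochner_Integration.integral_add) auto
  also have "(\<integral>y. (\<integral>x. r x y * (1 * v y) \<partial>?U) \<partial>?U) = (\<integral>x. (\<integral>y. \<rho> x y * (1 * B y) \<partial>\<nu>) - n * P x \<partial>?U)"
    unfolding s4(1) c3 ..
  also have "\<dots> = (\<integral>x. (\<integral>y. \<rho> x y * (1 * B y) \<partial>\<nu>) \<partial>?U) - n * (\<integral>x. P x \<partial>?U)"
    using s6(2) iP by (subst Bochner_Integration.integral_diff) auto
  also have "(\<integral>x. (\<integral>y. \<rho> x y * (1 * B y) \<partial>\<nu>) \<partial>?U) = (\<integral>y. Q y * B y \<partial>\<nu>)"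
    unfolding s6(1)[symmetric] by (simp add: Q_def)
  finally show ?thesis by (simp add: P_def Q_def algebra_simps)
qed

text \<open>The weak equation by components and against \<open>C^1\<close> functions rather than
  smooth fields: for \<open>\<rho>\<close> of class \<open>C^2\<close> the first derivatives, which
  become test functions in the second step, are only \<open>C^1\<close>.\<close>

definition stream_rep :: "(real \<times> real \<Rightarrow> real \<times> real) \<Rightarrow> (real \<times> real) measure \<Rightarrow> (real \<times> real \<Rightarrow> real) \<Rightarrow> bool" where
  "stream_rep b \<mu> u \<longleftrightarrow> u \<in> borel_measurable borel \<and> integrable unif_sq u \<and>
    (\<forall>\<psi> \<psi>1 \<psi>2. C1grad \<psi> \<psi>1 \<psi>2 \<longrightarrow>
      (\<integral>x. u x * \<psi>1 x \<partial>unif_sq) = (\<integral>y. \<psi> y * snd (b y) \<partial>\<mu>) - snd (mean \<mu> b) * (\<integral>x. \<psi> x \<partial>unif_sq) \<and>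
      (\<integral>x. u x * \<psi>2 x \<partial>unif_sq) = fst (mean \<mu> b) * (\<integral>x. \<psi> x \<partial>unif_sq) - (\<integral>y. \<psi> y * fst (b y) \<partial>\<mu>))"

lemma (in invariant_flow) stream_exists:
  obtains u where "BV_per u" "stream_rep b \<mu> u"
proof -
  obtain u where u: "periodic u" "u \<in> borel_measurable borel" "integrable unif_sq (\<lambda>x. (u x)\<^sup>2)"
    "\<And>\<phi>. continuous_on UNIV \<phi> \<Longrightarrow> periodic \<phi> \<Longrightarrow> stream_fun \<phi> = (\<integral>x. u x * \<phi> x \<partial>unif_sq)"
    by (rule stream_fun_represented) (rule that)
  have "stream_rep b \<mu> u"
    unfolding stream_rep_def
  proof (intro conjI allI impI)
    show "u \<in> borel_measurable borel" by (rule u(2))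
    show "integrable unif_sq u" by (rule integrable_unif_sq_of_square[OF u(2,3)])
    fix \<psi> \<psi>1 \<psi>2 assume C: "C1grad \<psi> \<psi>1 \<psi>2"
    have c: "continuous_on UNIV \<psi>1" "continuous_on UNIV \<psi>2" using C by (auto simp: C1grad_def)
    show "(\<integral>x. u x * \<psi>1 x \<partial>unif_sq) = (\<integral>y. \<psi> y * snd (b y) \<partial>\<mu>) - snd (mean \<mu> b) * (\<integral>x. \<psi> x \<partial>unif_sq)"
      using stream_fun_deriv1[OF C] u(4)[OF c(1) C1grad_periodic(1)[OF C]] by simp
    show "(\<integral>x. u x * \<psi>2 x \<partial>unif_sq) = fst (mean \<mu> b) * (\<integral>x. \<psi> x \<partial>unif_sq) - (\<integral>y. \<psi> y * fst (b y) \<partial>\<mu>)"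
      using stream_fun_deriv2[OF C] u(4)[OF c(2) C1grad_periodic(2)[OF C]] by simp
  qed
  then show ?thesis using that stream_BV[OF u] by blast
qed

lemma divg_Rperp:
  fixes \<Psi> :: "real \<times> real \<Rightarrow> real \<times> real"
  assumes "Ck (Suc k) \<Psi>"
  shows "divg (\<lambda>y. Rperp (\<Psi> y)) x = snd (partial (1,0) \<Psi> x) - fst (partial (0,1) \<Psi> x)"
proof -
  have B: "(1,0) \<in> (Basis :: (real\<times>real) set)" "(0,1) \<in> (Basis :: (real\<times>real) set)" by (auto simp: Basis_prod_def)
  have "bounded_linear Rperp" unfolding Rperp_def[abs_def]
    by (intro bounded_linear_Pair bounded_linear_snd bounded_linear_minus bounded_linear_fst)
  note hv = bounded_linear.has_vector_derivative[OF this partial_has_vector_derivative[OF assms B(1)]]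
    bounded_linear.has_vector_derivative[OF this partial_has_vector_derivative[OF assms B(2)]]
  have "partial (1,0) (\<lambda>y. Rperp (\<Psi> y)) x = Rperp (partial (1,0) \<Psi> x)"
    by (subst partial_def) (rule vector_derivative_at[OF hv(1)])
  moreover have "partial (0,1) (\<lambda>y. Rperp (\<Psi> y)) x = Rperp (partial (0,1) \<Psi> x)"
    by (subst partial_def) (rule vector_derivative_at[OF hv(2)])
  ultimately show ?thesis by (simp add: divg_def Rperp_def)
qed

lemma integrable_bounded_mult:
  fixes \<phi> u :: "real \<times> real \<Rightarrow> real"
  assumes "continuous_on UNIV \<phi>" "periodic \<phi>" "integrable unif_sq u" "u \<in> borel_measurable borel"
  shows "integrable unif_sq (\<lambda>x. u x * \<phi> x)"
proof -
  obtain C where C: "C > 0" "\<And>x. norm (\<phi> x) \<le> C" using periodic_bounded[OF assms(2,1)] by blast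
  show ?thesis
  proof (rule Bochner_Integration.integrable_bound)
    show "integrable unif_sq (\<lambda>x. \<bar>u x\<bar> * C)" using assms(3) by simp
    show "(\<lambda>x. u x * \<phi> x) \<in> borel_measurable unif_sq"
      using assms(4) borel_measurable_continuous_onI[OF assms(1)] by (simp cong: measurable_cong_sets)
    show "AE x in unif_sq. norm (u x * \<phi> x) \<le> norm (\<bar>u x\<bar> * C)"
    proof (rule AE_I2)
      fix x show "norm (u x * \<phi> x) \<le> norm (\<bar>u x\<bar> * C)"
        using mult_left_mono[OF C(2)[of x] abs_ge_zero[of "u x"]] C(1) by (simp add: abs_mult)
    qed
  qed
qed

lemma divg_Rperp_cont_periodic:
  assumes "Ck (Suc 0) \<Psi>" "periodic \<Psi>"
  shows "continuous_on UNIV (divg (\<lambda>y. Rperp (\<Psi> y)))" "periodic (divg (\<lambda>y. Rperp (\<Psi> y)))"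
proof -
  note C = Ck_C1grad_pair[OF assms]
  have eq: "divg (\<lambda>y. Rperp (\<Psi> y)) = (\<lambda>x. snd (partial (1,0) \<Psi> x) - fst (partial (0,1) \<Psi> x))"
    using divg_Rperp[OF assms(1)] by auto
  show "continuous_on UNIV (divg (\<lambda>y. Rperp (\<Psi> y)))"
    unfolding eq using C by (intro continuous_on_diff) (simp_all add: C1grad_def)
  show "periodic (divg (\<lambda>y. Rperp (\<Psi> y)))"
    unfolding eq using C1grad_periodic(2)[OF C(1)] C1grad_periodic(1)[OF C(2)] by (simp add: periodic_def)
qed

lemma (in invariant_flow) stream_weak_repr:
  assumes "stream_rep b \<mu> u" shows "weak_repr b \<mu> u"
  unfolding weak_repr_def
proof (intro allI impI)
  fix \<Psi> :: "real \<times> real \<Rightarrow> real \<times> real" assume \<Psi>: "smooth \<Psi> \<and> periodic \<Psi>"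
  then have C: "Ck (Suc 0) \<Psi>" and p: "periodic \<Psi>" unfolding smooth_def by blast+
  note G = Ck_C1grad_pair[OF C p]
  have um: "u \<in> borel_measurable borel" "integrable unif_sq u" using assms by (auto simp: stream_rep_def)
  note rep1 = assms[unfolded stream_rep_def, THEN conjunct2, THEN conjunct2, rule_format, OF G(1)]
  note rep2 = assms[unfolded stream_rep_def, THEN conjunct2, THEN conjunct2, rule_format, OF G(2)]
  have cp: "continuous_on UNIV (\<lambda>x. fst (\<Psi> x))" "continuous_on UNIV (\<lambda>x. snd (\<Psi> x))"
    "periodic (\<lambda>x. fst (\<Psi> x))" "periodic (\<lambda>x. snd (\<Psi> x))"
    using C1grad_cont[OF G(1)] C1grad_cont[OF G(2)] G by (auto simp: C1grad_def)
  note i\<mu> = integrable_b(1)[OF cp(1,3)] integrable_b(2)[OF cp(2,4)]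
  note iU = integrable_cont_periodic[OF torus_prob_unif_sq cp(1,3)] integrable_cont_periodic[OF torus_prob_unif_sq cp(2,4)]
  have iu: "integrable unif_sq (\<lambda>x. u x * snd (partial (1,0) \<Psi> x))" "integrable unif_sq (\<lambda>x. u x * fst (partial (0,1) \<Psi> x))"
    using G um C1grad_periodic[OF G(1)] C1grad_periodic[OF G(2)] by (auto intro!: integrable_bounded_mult simp: C1grad_def)
  have "(\<integral>x. b x \<bullet> \<Psi> x \<partial>\<mu>) = (\<integral>x. fst (\<Psi> x) * fst (b x) + snd (\<Psi> x) * snd (b x) \<partial>\<mu>)"
    by (simp add: inner_prod_def mult.commute)
  also have "\<dots> = (\<integral>x. fst (\<Psi> x) * fst (b x) \<partial>\<mu>) + (\<integral>x. snd (\<Psi> x) * snd (b x) \<partial>\<mu>)"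
    using i\<mu> by (rule Bochner_Integration.integral_add)
  also have "\<dots> = fst (mean \<mu> b) * (\<integral>x. fst (\<Psi> x) \<partial>unif_sq) + snd (mean \<mu> b) * (\<integral>x. snd (\<Psi> x) \<partial>unif_sq)
     + ((\<integral>x. u x * snd (partial (1,0) \<Psi> x) \<partial>unif_sq) - (\<integral>x. u x * fst (partial (0,1) \<Psi> x) \<partial>unif_sq))"
    using rep1 rep2 by simp
  also have "fst (mean \<mu> b) * (\<integral>x. fst (\<Psi> x) \<partial>unif_sq) + snd (mean \<mu> b) * (\<integral>x. snd (\<Psi> x) \<partial>unif_sq)
     = (\<integral>x. mean \<mu> b \<bullet> \<Psi> x \<partial>unif_sq)"
    using iU by (simp add: inner_prod_def)
  also have "(\<integral>x. u x * snd (partial (1,0) \<Psi> x) \<partial>unif_sq) - (\<integral>x. u x * fst (partial (0,1) \<Psi> x) \<partial>unif_sq)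
     = (\<integral>x. u x * snd (partial (1,0) \<Psi> x) - u x * fst (partial (0,1) \<Psi> x) \<partial>unif_sq)"
    using iu by simp
  also have "\<dots> = (\<integral>x. divg (\<lambda>y. Rperp (\<Psi> y)) x * u x \<partial>unif_sq)"
    unfolding divg_Rperp[OF C] by (rule Bochner_Integration.integral_cong) (simp_all add: algebra_simps)
  also have "\<dots> = (LINT x:unit_sq|lborel. divg (\<lambda>y. Rperp (\<Psi> y)) x * u x)"
    using borel_measurable_continuous_onI[OF divg_Rperp_cont_periodic(1)[OF C p]] um
    by (intro integral_unif_sq[symmetric]) simp
  also have "(\<integral>x. mean \<mu> b \<bullet> \<Psi> x \<partial>unif_sq) = (LINT x:unit_sq|lborel. mean \<mu> b \<bullet> \<Psi> x)"
    by (intro integral_unif_sq[symmetric] borel_measurable_continuous_onI continuous_intros Ck_cont[OF C])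
  finally show "(\<integral>x. b x \<bullet> \<Psi> x \<partial>\<mu>) = (LINT x:unit_sq|lborel. mean \<mu> b \<bullet> \<Psi> x)
     + (LINT x:unit_sq|lborel. divg (\<lambda>y. Rperp (\<Psi> y)) x * u x)" .
qed

lemma BV_perD:
  assumes "BV_per u"
  shows "periodic u" "u \<in> borel_measurable borel" "integrable unif_sq u"
proof -
  show p: "periodic u" and m: "u \<in> borel_measurable borel" using assms by (simp_all add: BV_per_def)
  have "integrable unif_sq (\<lambda>x. (u x)\<^sup>2)"
    using assms m by (subst integrable_unif_sq[symmetric]) (auto simp: BV_per_def)
  then show "integrable unif_sq u" by (rule integrable_unif_sq_of_square[OF m])
qed

lemma weak_repr_unique:
  assumes "BV_per u" "weak_repr b \<mu> u" "BV_per u'" "weak_repr b \<mu> u'"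
  shows "\<exists>c. AE x in lborel. u' x = u x + c"
proof -
  note u = BV_perD[OF assms(1)] and u' = BV_perD[OF assms(3)]
  have "\<exists>c. AE x in lborel. u' x - u x = c"
  proof (rule weakly_constant)
    show "(\<lambda>x. u' x - u x) \<in> borel_measurable borel" using u u' by simp
    show "periodic (\<lambda>x. u' x - u x)" using u u' by (simp add: periodic_def)
    show "integrable unif_sq (\<lambda>x. u' x - u x)" using u u' by simp
    fix \<Psi> :: "real \<times> real \<Rightarrow> real \<times> real" assume s: "smooth \<Psi>" and p: "periodic \<Psi>"
    then have C: "Ck (Suc 0) \<Psi>" unfolding smooth_def by blast
    let ?d = "divg (\<lambda>y. Rperp (\<Psi> y))"
    note d = divg_Rperp_cont_periodic[OF C p]
    have dm: "?d \<in> borel_measurable borel" by (rule borel_measurable_continuous_onI[OF d(1)])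
    have i: "integrable unif_sq (\<lambda>x. ?d x * u x)" "integrable unif_sq (\<lambda>x. ?d x * u' x)"
      using integrable_bounded_mult[OF d u(3,2)] integrable_bounded_mult[OF d u'(3,2)] by (simp_all add: mult.commute)
    have "(LINT x:unit_sq|lborel. ?d x * u x) = (LINT x:unit_sq|lborel. ?d x * u' x)"
      using assms(2)[unfolded weak_repr_def, rule_format, OF conjI[OF s p]]
        assms(4)[unfolded weak_repr_def, rule_format, OF conjI[OF s p]] by linarith
    then have "(\<integral>x. ?d x * u x \<partial>unif_sq) = (\<integral>x. ?d x * u' x \<partial>unif_sq)"
      using dm u u' by (simp add: integral_unif_sq)
    then show "(\<integral>x. ?d x * (u' x - u x) \<partial>unif_sq) = 0"
      using i by (simp add: right_diff_distrib)
  qed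
  then obtain c where "AE x in lborel. u' x - u x = c" by blast
  then have "AE x in lborel. u' x = u x + c" by eventually_elim simp
  then show ?thesis by blast
qed

section \<open>Fourier coefficients\<close>

lemma trig_C1grad:
  "C1grad (\<lambda>x. cos (phase k x)) (\<lambda>x. - (2 * pi * of_int (fst k)) * sin (phase k x)) (\<lambda>x. - (2 * pi * of_int (snd k)) * sin (phase k x))"
  "C1grad (\<lambda>x. sin (phase k x)) (\<lambda>x. 2 * pi * of_int (fst k) * cos (phase k x)) (\<lambda>x. 2 * pi * of_int (snd k) * cos (phase k x))"
proof -
  have pc: "periodic (\<lambda>x. cos (phase k x))" using cos_phase_periodic[of "\<lambda>t. t" k 0] by simp
  have ps: "periodic (\<lambda>x. sin (phase k x))"
    using cos_phase_periodic[of "\<lambda>t. t" k "- (pi / 2)"] by (simp add: cos_diff)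
  show "C1grad (\<lambda>x. cos (phase k x)) (\<lambda>x. - (2 * pi * of_int (fst k)) * sin (phase k x)) (\<lambda>x. - (2 * pi * of_int (snd k)) * sin (phase k x))"
    by (intro C1gradI pc continuous_intros phase_cont) (auto simp: phase_def intro!: derivative_eq_intros)
  show "C1grad (\<lambda>x. sin (phase k x)) (\<lambda>x. 2 * pi * of_int (fst k) * cos (phase k x)) (\<lambda>x. 2 * pi * of_int (snd k) * cos (phase k x))"
    by (intro C1gradI ps continuous_intros phase_cont) (auto simp: phase_def intro!: derivative_eq_intros)
qed

lemma trig_integral_zero:
  assumes "k \<noteq> 0"
  shows "(\<integral>x. cos (phase k x) \<partial>unif_sq) = 0" "(\<integral>x. sin (phase k x) \<partial>unif_sq) = 0"
proof -
  have "fst k \<noteq> 0 \<or> snd k \<noteq> 0" using assms by (auto simp: prod_eq_iff)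
  then show "(\<integral>x. cos (phase k x) \<partial>unif_sq) = 0" "(\<integral>x. sin (phase k x) \<partial>unif_sq) = 0"
    using C1grad_integral_zero[OF trig_C1grad(1)[of k]] C1grad_integral_zero[OF trig_C1grad(2)[of k]] by auto
qed

lemma integral_ekx:
  assumes "integrable M (\<lambda>x. cos (phase k x) * f x)" "integrable M (\<lambda>x. sin (phase k x) * f x)"
  shows "(\<integral>x. ekx k x * complex_of_real (f x) \<partial>M) =
    complex_of_real (\<integral>x. cos (phase k x) * f x \<partial>M) - \<i> * complex_of_real (\<integral>x. sin (phase k x) * f x \<partial>M)"
proof -
  have e: "ekx k x * complex_of_real (f x) = complex_of_real (cos (phase k x) * f x) - \<i> * complex_of_real (sin (phase k x) * f x)" for x
  proof -
    have "ekx k x = cis (- phase k x)" by (simp add: ekx_def phase_def)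
    then show ?thesis by (simp add: complex_eq_iff)
  qed
  show ?thesis unfolding e using assms
    by (subst Bochner_Integration.integral_diff) (auto simp del: of_real_mult)
qed

text \<open>The coefficient of \<open>b \<mu>\<close> is \<open>2 * pi * \<i>\<close> times the
  rotated frequency \<open>Rperp k\<close> times that of \<open>u\<close>. It is read off from the
  weak equation for \<open>cos\<close> and \<open>sin\<close> separately; the mean term disappears
  because \<open>k \<noteq> 0\<close>.\<close>

lemma (in invariant_flow) fourier_stream:
  assumes u: "stream_rep b \<mu> u" and k: "k \<noteq> 0"
  shows "fst (fourier_meas \<mu> b k) = 2 * pi * \<i> * of_int (snd k) * fourier_fun u k"
    and "snd (fourier_meas \<mu> b k) = - (2 * pi * \<i> * of_int (fst k) * fourier_fun u k)"
proof -
  have um: "u \<in> borel_measurable borel" "integrable unif_sq u" using u by (auto simp: stream_rep_def)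
  note T = trig_C1grad[of k]
  have cp: "continuous_on UNIV (\<lambda>x. cos (phase k x))" "periodic (\<lambda>x. cos (phase k x))"
    "continuous_on UNIV (\<lambda>x. sin (phase k x))" "periodic (\<lambda>x. sin (phase k x))"
    using C1grad_cont[OF T(1)] C1grad_cont[OF T(2)] T by (simp_all add: C1grad_def)
  note rep = u[unfolded stream_rep_def, THEN conjunct2, THEN conjunct2, rule_format, OF T(1)]
    u[unfolded stream_rep_def, THEN conjunct2, THEN conjunct2, rule_format, OF T(2)]
  define Cu where "Cu = (\<integral>x. cos (phase k x) * u x \<partial>unif_sq)"
  define Su where "Su = (\<integral>x. sin (phase k x) * u x \<partial>unif_sq)"
  have c: "(\<integral>x. u x * (a * cos (phase k x)) \<partial>unif_sq) = a * Cu" for a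
    unfolding Cu_def by (subst integral_mult_right_zero[symmetric]) (simp add: mult_ac)
  have s: "(\<integral>x. u x * (a * sin (phase k x)) \<partial>unif_sq) = a * Su" for a
    unfolding Su_def by (subst integral_mult_right_zero[symmetric]) (simp add: mult_ac)
  have r: "(\<integral>y. cos (phase k y) * snd (b y) \<partial>\<mu>) = - (2 * pi * of_int (fst k)) * Su"
    "(\<integral>y. cos (phase k y) * fst (b y) \<partial>\<mu>) = 2 * pi * of_int (snd k) * Su"
    "(\<integral>y. sin (phase k y) * snd (b y) \<partial>\<mu>) = 2 * pi * of_int (fst k) * Cu"
    "(\<integral>y. sin (phase k y) * fst (b y) \<partial>\<mu>) = - (2 * pi * of_int (snd k) * Cu)"
    using rep unfolding c s trig_integral_zero[OF k] by simp_all
  have em: "(\<lambda>x. ekx k x * complex_of_real (u x)) \<in> borel_measurable borel"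
  proof -
    have "(\<lambda>x. ekx k x) \<in> borel_measurable borel"
      unfolding ekx_def by (intro borel_measurable_continuous_onI continuous_intros)
    then show ?thesis using um(1) by simp
  qed
  have ff: "fourier_fun u k = complex_of_real Cu - \<i> * complex_of_real Su"
    unfolding fourier_fun_def integral_unif_sq[OF em] Cu_def Su_def
    using integrable_bounded_mult[OF cp(1,2) um(2,1)] integrable_bounded_mult[OF cp(3,4) um(2,1)]
    by (intro integral_ekx) (simp_all add: mult.commute)
  show "fst (fourier_meas \<mu> b k) = 2 * pi * \<i> * of_int (snd k) * fourier_fun u k"
    unfolding fourier_meas_def fst_conv integral_ekx[OF integrable_b(1)[OF cp(1,2)] integrable_b(1)[OF cp(3,4)]] r ff
    by (simp add: complex_eq_iff)
  show "snd (fourier_meas \<mu> b k) = - (2 * pi * \<i> * of_int (fst k) * fourier_fun u k)"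
    unfolding fourier_meas_def snd_conv integral_ekx[OF integrable_b(2)[OF cp(1,2)] integrable_b(2)[OF cp(3,4)]] r ff
    by (simp add: complex_eq_iff)
qed

lemma (in invariant_flow) fourier_meas_zero:
  "fourier_meas \<mu> b 0 = (complex_of_real (fst (mean \<mu> b)), complex_of_real (snd (mean \<mu> b)))"
  by (simp add: fourier_meas_def ekx_def mean_comp)

lemma flow_of_C1_field:
  assumes "Ck 1 b" "periodic b" "is_flow b X"
  obtains L M where "torus_flow b X L M"
proof -
  have C: "Ck (Suc 0) b" using assms(1) by simp
  note G = Ck_C1grad_pair[OF C assms(2)]
  obtain L1 where L1: "L1 \<ge> 0" "\<And>x y. \<bar>fst (b x) - fst (b y)\<bar> \<le> L1 * norm (x - y)" using C1grad_lipschitz[OF G(1)] by metis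
  obtain L2 where L2: "L2 \<ge> 0" "\<And>x y. \<bar>snd (b x) - snd (b y)\<bar> \<le> L2 * norm (x - y)" using C1grad_lipschitz[OF G(2)] by metis
  obtain M where M: "M > 0" "\<And>x. norm (b x) \<le> M" using periodic_bounded[OF assms(2) Ck_cont[OF C]] by metis
  \<comment> \<open>The summand 1 makes the Lipschitz constant positive also when \<open>b\<close>
    is constant.\<close>
  have "norm (b x - b y) \<le> (L1 + L2 + 1) * norm (x - y)" for x y
  proof -
    have "norm (b x - b y) \<le> \<bar>fst (b x) - fst (b y)\<bar> + \<bar>snd (b x) - snd (b y)\<bar>"
      using norm_Pair_le[of "fst (b x - b y)" "snd (b x - b y)"] unfolding prod.collapse by simp
    also have "\<dots> \<le> L1 * norm (x - y) + L2 * norm (x - y)" by (intro add_mono L1 L2)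
    also have "\<dots> \<le> (L1 + L2 + 1) * norm (x - y)" by (simp add: algebra_simps)
    finally show ?thesis .
  qed
  then have "torus_flow b X (L1 + L2 + 1) M"
    using assms L1(1) L2(1) M by unfold_locales auto
  then show ?thesis by (rule that)
qed

lemma Rperp_inner: "Rperp n \<bullet> w = snd n * fst w - fst n * snd w"
  by (simp add: Rperp_def inner_prod_def)

lemma pair_integral:
  fixes f g :: "'a \<Rightarrow> real"
  assumes "integrable M f" "integrable M g"
  shows "(\<integral>x. (f x, g x) \<partial>M) = (\<integral>x. f x \<partial>M, \<integral>x. g x \<partial>M)"
proof -
  have "(\<integral>x. (f x, g x) \<partial>M) = (\<integral>x. f x *\<^sub>R (1, 0) + g x *\<^sub>R (0, 1) \<partial>M)" by simp
  also have "\<dots> = (\<integral>x. f x *\<^sub>R (1, 0) \<partial>M) + (\<integral>x. g x *\<^sub>R (0, 1) \<partial>M)"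
    by (intro Bochner_Integration.integral_add integrable_scaleR_left assms)
  also have "\<dots> = (\<integral>x. f x \<partial>M) *\<^sub>R (1, 0) + (\<integral>x. g x \<partial>M) *\<^sub>R (0, 1)"
    by (subst (1 2) integral_scaleR_left) (use assms in auto)
  finally show ?thesis by simp
qed

text \<open>Each of the two products in the determinant is handled by \<open>bilinear_half\<close>,
  with the derivatives in \<open>y\<close> and \<open>x\<close> dictated by the component of
  \<open>b\<close> that is present.\<close>

lemma bilinear_formula:
  fixes \<rho> :: "real \<times> real \<Rightarrow> real \<times> real \<Rightarrow> real"
  assumes \<mu>: "invariant_flow b X L M \<mu>" and \<nu>: "invariant_flow b X L M \<nu>"
    and u: "stream_rep b \<mu> u" and v: "stream_rep b \<nu> v"
    and par: "det2 (mean \<mu> b) (mean \<nu> b) = 0"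
    and \<rho>2: "Ck 2 (case_prod \<rho>)" and \<rho>p: "periodic2 \<rho>"
  shows "(\<integral>y. (\<integral>x. \<rho> x y * det2 (b x) (b y) \<partial>\<mu>) \<partial>\<nu>) =
          Rperp (mean \<nu> b) \<bullet> (\<integral>x. (LINT y:unit_sq|lborel. \<rho> x y) *\<^sub>R b x \<partial>\<mu>)
        - Rperp (mean \<mu> b) \<bullet> (\<integral>y. (LINT x:unit_sq|lborel. \<rho> x y) *\<^sub>R b y \<partial>\<nu>)
        + (LINT y:unit_sq|lborel. (LINT x:unit_sq|lborel.
             (partial ((1,0),(0,0)) (partial ((0,0),(0,1)) (case_prod \<rho>)) (x, y)
              - partial ((0,1),(0,0)) (partial ((0,0),(1,0)) (case_prod \<rho>)) (x, y))
             * u x * v y))"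
proof -
  interpret A: invariant_flow b X L M \<mu> by fact
  interpret B: invariant_flow b X L M \<nu> by fact
  let ?U = unif_sq
  note tU = torus_prob_unif_sq
  define g where "g = case_prod \<rho>"
  define y1 y2 where "y1 = partial ((0,0),(1,0)) g" and "y2 = partial ((0,0),(0,1)) g"
  define D12 D21 where "D12 = partial ((1,0),(0,0)) y2" and "D21 = partial ((0,1),(0,0)) y1"
  have \<rho>g: "\<rho> x y = g (x, y)" for x y by (simp add: g_def)
  have gC: "Ck (Suc (Suc 0)) g" using \<rho>2 by (simp add: g_def numeral_2_eq_2)
  have gp: "periodic2 (\<lambda>x y. g (x, y))" using \<rho>p by (simp add: g_def)
  have Bs: "((1,0),(0,0)) \<in> (Basis :: ((real\<times>real)\<times>(real\<times>real)) set)" "((0,1),(0,0)) \<in> (Basis :: ((real\<times>real)\<times>(real\<times>real)) set)"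
   "((0,0),(1,0)) \<in> (Basis :: ((real\<times>real)\<times>(real\<times>real)) set)" "((0,0),(0,1)) \<in> (Basis :: ((real\<times>real)\<times>(real\<times>real)) set)"
    by (auto simp: Basis_prod_def zero_prod_def)
  have yC: "Ck (Suc 0) y1" "Ck (Suc 0) y2" unfolding y1_def y2_def by (intro Ck_partial gC Bs)+
  have yp: "periodic2 (\<lambda>x y. y1 (x, y))" "periodic2 (\<lambda>x y. y2 (x, y))"
    unfolding y1_def y2_def by (intro periodic2_partial gp)+
  have Dc: "continuous_on UNIV D12" "continuous_on UNIV D21"
    unfolding D12_def D21_def by (intro Ck_cont[of 0] Ck_partial yC Bs)+
  have Dp: "periodic2 (\<lambda>x y. D12 (x, y))" "periodic2 (\<lambda>x y. D21 (x, y))"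
    unfolding D12_def D21_def by (intro periodic2_partial yp)+
  have gc: "continuous_on UNIV g" "continuous_on UNIV y1" "continuous_on UNIV y2"
    by (rule Ck_cont[OF gC], rule Ck_cont[OF yC(1)], rule Ck_cont[OF yC(2)])
  have G: "C1grad (\<lambda>y. g (x, y)) (\<lambda>y. y1 (x, y)) (\<lambda>y. y2 (x, y))" for x
    unfolding y1_def y2_def by (rule Ck_C1grad_section(2)[OF gC gp])
  have Y1: "C1grad (\<lambda>x. y1 (x, y)) (\<lambda>x. partial ((1,0),(0,0)) y1 (x, y)) (\<lambda>x. D21 (x, y))" for y
    unfolding D21_def by (rule Ck_C1grad_section(1)[OF yC(1) yp(1)])
  have Y2: "C1grad (\<lambda>x. y2 (x, y)) (\<lambda>x. D12 (x, y)) (\<lambda>x. partial ((0,1),(0,0)) y2 (x, y))" for y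
    unfolding D12_def by (rule Ck_C1grad_section(1)[OF yC(2) yp(2)])
  have uv: "integrable ?U u" "integrable ?U v" using u v by (simp_all add: stream_rep_def)
  note repu = u[unfolded stream_rep_def, THEN conjunct2, THEN conjunct2, rule_format]
  note repv = v[unfolded stream_rep_def, THEN conjunct2, THEN conjunct2, rule_format]
  define P where "P x = (\<integral>y. g (x, y) \<partial>?U)" for x
  define Q where "Q y = (\<integral>x. g (x, y) \<partial>?U)" for y
  define J where "J = (\<integral>x. P x \<partial>?U)"
  let ?m = "mean \<mu> b" and ?n = "mean \<nu> b"
  \<comment> \<open>The second component of \<open>b\<close> in \<open>y\<close> brings the
    derivative in \<open>y\<^sub>1\<close> with a plus sign, the first component in \<open>x\<close>
    the one in \<open>x\<^sub>2\<close> with a minus sign.\<close>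
  have L1: "(\<integral>y. (\<integral>x. g (x, y) * (fst (b x) * snd (b y)) \<partial>\<mu>) \<partial>\<nu>) =
      snd ?n * (\<integral>x. P x * fst (b x) \<partial>\<mu>) + fst ?m * (\<integral>y. Q y * snd (b y) \<partial>\<nu>) - fst ?m * snd ?n * J
      + (\<integral>y. (\<integral>x. - D21 (x, y) * (u x * v y) \<partial>?U) \<partial>?U)"
    unfolding P_def Q_def J_def
  proof (rule bilinear_half[OF A.\<mu> B.\<mu> _ gp _ yp(1) A.integrable_mean_b(1) B.integrable_mean_b(2) uv])
    show "continuous_on UNIV (\<lambda>(x, y). g (x, y))" "continuous_on UNIV (\<lambda>(x, y). y1 (x, y))" using gc by simp_all
    show "continuous_on UNIV (\<lambda>(x, y). - D21 (x, y))" using Dc(2) by (simp add: case_prod_unfold continuous_on_minus)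
    show "periodic2 (\<lambda>x y. - D21 (x, y))" using Dp(2) by (simp add: periodic2_def periodic_def)
    show "(\<integral>y. g (x, y) * snd (b y) \<partial>\<nu>) = snd ?n * (\<integral>y. g (x, y) \<partial>?U) + (\<integral>y. v y * y1 (x, y) \<partial>?U)" for x
      using repv[OF G[of x]] by simp
    show "(\<integral>x. y1 (x, y) * fst (b x) \<partial>\<mu>) = fst ?m * (\<integral>x. y1 (x, y) \<partial>?U) + (\<integral>x. u x * - D21 (x, y) \<partial>?U)" for y
      using repu[OF Y1[of y]] by simp
  qed
  \<comment> \<open>Here the derivative in \<open>y\<^sub>2\<close> carries the minus sign, so it is
    built into \<open>r\<close>.\<close>
  have L2: "(\<integral>y. (\<integral>x. g (x, y) * (snd (b x) * fst (b y)) \<partial>\<mu>) \<partial>\<nu>) =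
      fst ?n * (\<integral>x. P x * snd (b x) \<partial>\<mu>) + snd ?m * (\<integral>y. Q y * fst (b y) \<partial>\<nu>) - snd ?m * fst ?n * J
      + (\<integral>y. (\<integral>x. - D12 (x, y) * (u x * v y) \<partial>?U) \<partial>?U)"
    unfolding P_def Q_def J_def
  proof (rule bilinear_half[where r = "\<lambda>x y. - y2 (x, y)", OF A.\<mu> B.\<mu> _ gp _ _ A.integrable_mean_b(2) B.integrable_mean_b(1) uv])
    show "continuous_on UNIV (\<lambda>(x, y). g (x, y))" using gc by simp
    show "continuous_on UNIV (\<lambda>(x, y). - y2 (x, y))" using gc(3) by (simp add: case_prod_unfold continuous_on_minus)
    show "periodic2 (\<lambda>x y. - y2 (x, y))" using yp(2) by (simp add: periodic2_def periodic_def)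
    show "continuous_on UNIV (\<lambda>(x, y). - D12 (x, y))" using Dc(1) by (simp add: case_prod_unfold continuous_on_minus)
    show "periodic2 (\<lambda>x y. - D12 (x, y))" using Dp(1) by (simp add: periodic2_def periodic_def)
    show "(\<integral>y. g (x, y) * fst (b y) \<partial>\<nu>) = fst ?n * (\<integral>y. g (x, y) \<partial>?U) + (\<integral>y. v y * - y2 (x, y) \<partial>?U)" for x
      using repv[OF G[of x]] by simp
    show "(\<integral>x. - y2 (x, y) * snd (b x) \<partial>\<mu>) = snd ?m * (\<integral>x. - y2 (x, y) \<partial>?U) + (\<integral>x. u x * - D12 (x, y) \<partial>?U)" for y
      using repu[OF Y2[of y]] by simp
  qed
  have cp: "continuous_on UNIV (\<lambda>(x, y). h (x, y))" if "continuous_on UNIV h" for h :: "(real \<times> real) \<times> (real \<times> real) \<Rightarrow> real"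
    using that by simp
  note swg = double_integral_swap[OF A.\<mu> B.\<mu> cp[OF gc(1)] gp]
  note swD12 = double_integral_swap[OF tU tU cp[OF Dc(1)] Dp(1) uv]
  note swD21 = double_integral_swap[OF tU tU cp[OF Dc(2)] Dp(2) uv]
  note i1 = swg[OF A.integrable_mean_b(1) B.integrable_mean_b(2)]
  note i2 = swg[OF A.integrable_mean_b(2) B.integrable_mean_b(1)]
  have secx: "continuous_on UNIV (\<lambda>x. h (x, y))" "continuous_on UNIV (\<lambda>x. h (y, x))"
    if "continuous_on UNIV h" for h :: "(real \<times> real) \<times> (real \<times> real) \<Rightarrow> real" and y
    by (rule continuous_on_compose2[OF that]; auto intro!: continuous_intros)+
  have perx: "periodic (\<lambda>x. h (x, y))" "periodic (\<lambda>x. h (y, x))"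
    if "periodic2 (\<lambda>x y. h (x, y))" for h :: "(real \<times> real) \<times> (real \<times> real) \<Rightarrow> real" and y
    using that unfolding periodic2_def by blast+
  have ib: "integrable \<mu> (\<lambda>x. g (x, y) * (fst (b x) * c))" "integrable \<mu> (\<lambda>x. g (x, y) * (snd (b x) * c))" for y c
    using A.integrable_b[OF secx(1)[OF gc(1)] perx(1)[OF gp], of y]
    by (simp_all add: mult.assoc[symmetric] integrable_mult_left)
  have "(\<integral>x. \<rho> x y * det2 (b x) (b y) \<partial>\<mu>) =
     (\<integral>x. g (x, y) * (fst (b x) * snd (b y)) \<partial>\<mu>) - (\<integral>x. g (x, y) * (snd (b x) * fst (b y)) \<partial>\<mu>)" for y
    unfolding \<rho>g det2_def right_diff_distrib by (intro Bochner_Integration.integral_diff ib)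
  then have lhs: "(\<integral>y. (\<integral>x. \<rho> x y * det2 (b x) (b y) \<partial>\<mu>) \<partial>\<nu>) =
      (\<integral>y. (\<integral>x. g (x, y) * (fst (b x) * snd (b y)) \<partial>\<mu>) \<partial>\<nu>) - (\<integral>y. (\<integral>x. g (x, y) * (snd (b x) * fst (b y)) \<partial>\<mu>) \<partial>\<nu>)"
    using i1(3) i2(3) by simp
  have iu: "integrable ?U (\<lambda>x. h (x, y) * (u x * v y))"
    if "continuous_on UNIV h" "periodic2 (\<lambda>x y. h (x, y))" for h :: "(real \<times> real) \<times> (real \<times> real) \<Rightarrow> real" and y
  proof -
    have "integrable ?U (\<lambda>x. u x * h (x, y))"
      by (rule integrable_bounded_mult[OF secx(1)[OF that(1)] perx(1)[OF that(2)] uv(1)]) (use u in \<open>simp add: stream_rep_def\<close>)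
    from integrable_mult_left[of "v y", OF this] show ?thesis by (simp add: mult_ac)
  qed
  have inn: "(LINT x:unit_sq|lborel. (D12 (x, y) - D21 (x, y)) * u x * v y)
      = (\<integral>x. D12 (x, y) * (u x * v y) \<partial>?U) - (\<integral>x. D21 (x, y) * (u x * v y) \<partial>?U)" for y
  proof -
    have "u \<in> borel_measurable borel" using u by (simp add: stream_rep_def)
    moreover note borel_measurable_continuous_onI[OF secx(1)[OF Dc(1)], of y] borel_measurable_continuous_onI[OF secx(1)[OF Dc(2)], of y]
    ultimately have "(LINT x:unit_sq|lborel. (D12 (x, y) - D21 (x, y)) * u x * v y)
       = (\<integral>x. (D12 (x, y) - D21 (x, y)) * u x * v y \<partial>?U)"
      by (intro integral_unif_sq) simp
    also have "\<dots> = (\<integral>x. D12 (x, y) * (u x * v y) - D21 (x, y) * (u x * v y) \<partial>?U)"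
      by (rule Bochner_Integration.integral_cong) (simp_all add: algebra_simps)
    also have "\<dots> = (\<integral>x. D12 (x, y) * (u x * v y) \<partial>?U) - (\<integral>x. D21 (x, y) * (u x * v y) \<partial>?U)"
      by (intro Bochner_Integration.integral_diff iu Dc Dp)
    finally show ?thesis .
  qed
  have outer: "(LINT y:unit_sq|lborel. (LINT x:unit_sq|lborel. (D12 (x, y) - D21 (x, y)) * u x * v y))
     = (\<integral>y. (\<integral>x. D12 (x, y) * (u x * v y) \<partial>?U) \<partial>?U) - (\<integral>y. (\<integral>x. D21 (x, y) * (u x * v y) \<partial>?U) \<partial>?U)"
  proof -
    have "(\<lambda>y. (\<integral>x. D12 (x, y) * (u x * v y) \<partial>?U) - (\<integral>x. D21 (x, y) * (u x * v y) \<partial>?U)) \<in> borel_measurable unif_sq"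
      using borel_measurable_integrable[OF swD12(3)] borel_measurable_integrable[OF swD21(3)] by simp
    then have "(\<lambda>y. (\<integral>x. D12 (x, y) * (u x * v y) \<partial>?U) - (\<integral>x. D21 (x, y) * (u x * v y) \<partial>?U)) \<in> borel_measurable borel"
      by (simp cong: measurable_cong_sets)
    from integral_unif_sq[OF this] show ?thesis unfolding inn
      using swD12(3) swD21(3) by simp
  qed
  have Pm: "(LINT y:unit_sq|lborel. \<rho> x y) = P x" for x
    unfolding \<rho>g P_def by (intro integral_unif_sq borel_measurable_continuous_onI secx gc)
  have Qm: "(LINT x:unit_sq|lborel. \<rho> x y) = Q y" for y
    unfolding \<rho>g Q_def by (intro integral_unif_sq borel_measurable_continuous_onI secx gc)
  have one: "integrable ?U (\<lambda>_. 1 :: real)" 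
    by (intro integrable_cont_periodic[OF tU]) (auto simp: periodic_def)
  have iP: "integrable \<mu> (\<lambda>x. P x * fst (b x))" "integrable \<mu> (\<lambda>x. P x * snd (b x))"
    using double_integral_swap(2)[OF A.\<mu> tU cp[OF gc(1)] gp A.integrable_mean_b(1) one]
      double_integral_swap(2)[OF A.\<mu> tU cp[OF gc(1)] gp A.integrable_mean_b(2) one] by (simp_all add: P_def)
  have iQ: "integrable \<nu> (\<lambda>y. Q y * fst (b y))" "integrable \<nu> (\<lambda>y. Q y * snd (b y))"
    using double_integral_swap(3)[OF tU B.\<mu> cp[OF gc(1)] gp one B.integrable_mean_b(1)]
      double_integral_swap(3)[OF tU B.\<mu> cp[OF gc(1)] gp one B.integrable_mean_b(2)] by (simp_all add: Q_def)
  have t1: "Rperp ?n \<bullet> (\<integral>x. P x *\<^sub>R b x \<partial>\<mu>) = snd ?n * (\<integral>x. P x * fst (b x) \<partial>\<mu>) - fst ?n * (\<integral>x. P x * snd (b x) \<partial>\<mu>)"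
    using pair_integral[OF iP] by (simp add: Rperp_inner scaleR_prod_def)
  have t2: "Rperp ?m \<bullet> (\<integral>y. Q y *\<^sub>R b y \<partial>\<nu>) = snd ?m * (\<integral>y. Q y * fst (b y) \<partial>\<nu>) - fst ?m * (\<integral>y. Q y * snd (b y) \<partial>\<nu>)"
    using pair_integral[OF iQ] by (simp add: Rperp_inner scaleR_prod_def)
  \<comment> \<open>In the difference of \<open>L1\<close> and \<open>L2\<close> the two multiples
    of \<open>J\<close> combine to \<open>- det2 ?m ?n * J\<close>; only here the vanishing
    determinant is used.\<close>
  have d0: "fst ?m * snd ?n = snd ?m * fst ?n" using par by (simp add: det2_def)
  show ?thesis
    unfolding lhs L1 L2 Pm Qm t1 t2
    unfolding g_def[symmetric] y1_def[symmetric] y2_def[symmetric] D12_def[symmetric] D21_def[symmetric] outer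
    using d0 by simp
qed

theorem theorem3p1:
  fixes b :: "real \<times> real \<Rightarrow> real \<times> real"
    and X :: "real \<Rightarrow> real \<times> real \<Rightarrow> real \<times> real"
    and \<mu> \<nu> :: "(real \<times> real) measure"
  assumes b_C1: "Ck 1 b" and b_per: "periodic b"
    and flow: "is_flow b X"
    and mu: "torus_prob \<mu>" "invariant_measure X \<mu>"
    and nu: "torus_prob \<nu>" "invariant_measure X \<nu>"
  shows "\<exists>u v. BV_per u \<and> BV_per v \<and> weak_repr b \<mu> u \<and> weak_repr b \<nu> v \<and>
     (\<forall>u'. BV_per u' \<and> weak_repr b \<mu> u' \<longrightarrow> (\<exists>c. AE x in lborel. u' x = u x + c)) \<and>
     (\<forall>v'. BV_per v' \<and> weak_repr b \<nu> v' \<longrightarrow> (\<exists>c. AE x in lborel. v' x = v x + c)) \<and>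
     (\<forall>\<rho>::real \<times> real \<Rightarrow> real \<times> real \<Rightarrow> real. Ck 2 (case_prod \<rho>) \<and> periodic2 \<rho> \<longrightarrow>
        (\<integral>y. (\<integral>x. \<rho> x y * det2 (b x) (b y) \<partial>\<mu>) \<partial>\<nu>) =
          Rperp (mean \<nu> b) \<bullet> (\<integral>x. (LINT y:unit_sq|lborel. \<rho> x y) *\<^sub>R b x \<partial>\<mu>)
        - Rperp (mean \<mu> b) \<bullet> (\<integral>y. (LINT x:unit_sq|lborel. \<rho> x y) *\<^sub>R b y \<partial>\<nu>)
        + (LINT y:unit_sq|lborel. (LINT x:unit_sq|lborel.
             (partial ((1,0),(0,0)) (partial ((0,0),(0,1)) (case_prod \<rho>)) (x, y)
              - partial ((0,1),(0,0)) (partial ((0,0),(1,0)) (case_prod \<rho>)) (x, y))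
             * u x * v y))) \<and>
     (\<forall>j k :: int \<times> int. (j \<noteq> 0 \<and> k \<noteq> 0) \<or> (j = 0 \<and> k = 0) \<longrightarrow>
        det2 (fourier_meas \<mu> b j) (fourier_meas \<nu> b k) =
          - 4 * complex_of_real (pi\<^sup>2) * of_int (det2 j k) * fourier_fun u j * fourier_fun v k)"
proof -
  obtain L M where "torus_flow b X L M" using flow_of_C1_field[OF b_C1 b_per flow] .
  then interpret F: torus_flow b X L M .
  interpret A: invariant_flow b X L M \<mu> by unfold_locales (fact mu)+
  interpret B: invariant_flow b X L M \<nu> by unfold_locales (fact nu)+
  obtain u where u: "BV_per u" "stream_rep b \<mu> u" by (rule A.stream_exists)
  obtain v where v: "BV_per v" "stream_rep b \<nu> v" by (rule B.stream_exists)
  note wu = A.stream_weak_repr[OF u(2)] and wv = B.stream_weak_repr[OF v(2)]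
  have par: "det2 (mean \<mu> b) (mean \<nu> b) = 0" by (rule F.means_parallel[OF mu nu])
  have four: "det2 (fourier_meas \<mu> b j) (fourier_meas \<nu> b k) =
          - 4 * complex_of_real (pi\<^sup>2) * of_int (det2 j k) * fourier_fun u j * fourier_fun v k"
    if jk: "(j \<noteq> 0 \<and> k \<noteq> 0) \<or> (j = 0 \<and> k = 0)" for j k :: "int \<times> int"
  \<comment> \<open>At frequency zero the left side is the determinant of the means, so this case is
    again the vanishing of that determinant. For nonzero frequencies
    \<open>(2 * pi * \<i>)\<^sup>2\<close> gives the factor, and rotating both frequencies leaves
    their determinant unchanged.\<close>
  proof (cases "j = 0")
    case True
    then have k: "k = 0" using jk by auto
    have "det2 (fourier_meas \<mu> b 0) (fourier_meas \<nu> b 0) = complex_of_real (det2 (mean \<mu> b) (mean \<nu> b))"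
      unfolding A.fourier_meas_zero B.fourier_meas_zero by (simp add: det2_def)
    then have "det2 (fourier_meas \<mu> b 0) (fourier_meas \<nu> b 0) = 0" by (simp add: par)
    moreover have "det2 (0 :: int \<times> int) 0 = 0" by (simp add: det2_def)
    ultimately show ?thesis using True k by simp
  next
    case False
    then have k: "k \<noteq> 0" using jk by auto
    have i2: "\<i> * (\<i> * z) = - z" for z by (simp add: mult.assoc[symmetric])
    show ?thesis
      unfolding det2_def A.fourier_stream[OF u(2) False] B.fourier_stream[OF v(2) k]
      by (simp add: algebra_simps power2_eq_square i2)
  qed
  show ?thesis
  proof (rule exI[of _ u], rule exI[of _ v], intro conjI)
    show "\<forall>u'. BV_per u' \<and> weak_repr b \<mu> u' \<longrightarrow> (\<exists>c. AE x in lborel. u' x = u x + c)"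
      using weak_repr_unique[OF u(1) wu] by simp
    show "\<forall>v'. BV_per v' \<and> weak_repr b \<nu> v' \<longrightarrow> (\<exists>c. AE x in lborel. v' x = v x + c)"
      using weak_repr_unique[OF v(1) wv] by simp
  qed (fact u v wu wv | intro allI impI, elim conjE, rule bilinear_formula[OF A.invariant_flow_axioms B.invariant_flow_axioms u(2) v(2) par], assumption+ | intro allI impI, rule four, assumption)+
qed

end
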